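(* Let $\Gamma$ be an irreducible lattice of $G=\mathrm{PSL}(2,\mathbb{R})\times\mathrm{PSL}(2,\mathbb{R})$. Let $g\in G$ and let $x=\Gamma g$ be the class of $g$ in $\Gamma\backslash G$. Then the following properties are equivalent: 1) the orbit $xA$ is compact; 2) the subgroup $g^{-1}\Gamma g\cap A$ is isomorphic to $\mathbb{Z}^2$; 3) the points $g(\infty,\infty)$ and $g(0,0)$ of $\partial\mathbb{H}\times\partial\mathbb{H}$ are fixed by a (common) hyperbolic hyper-regular element of $\Gamma$.
   Context: A lattice in $G=\mathrm{PSL}(2,\mathbb{R})\times\mathrm{PSL}(2,\mathbb{R})$ is a discrete subgroup of finite covolume. It is reducible if, up to finite index, it is a product of two lattices of $\mathrm{PSL}(2,\mathbb{R})$ (one in each factor), and irreducible otherwise. $A$ is the maximal diagonal subgroup of $G$, i.e. the group of all pairs $\left(\pm\begin{pmatrix}\lambda_1&0\\0&\lambda_1^{-1}\end{pmatrix},\pm\begin{pmatrix}\lambda_2&0\\0&\lambda_2^{-1}\end{pmatrix}\right)$ with $\lambda_1,\lambda_2>0$, acting on $\Gamma\backslash G$ by right translation; $xA=\{xa:a\in A\}$. $\partial\mathbb{H}=\mathbb{R}\cup\{\infty\}$ is the boundary of the upper half-plane $\mathbb{H}$, on which $\mathrm{PSL}(2,\mathbb{R})$ acts by Möbius transformations; $G$ acts on $\partial\mathbb{H}\times\partial\mathbb{H}$ componentwise. A non-identity element of $\mathrm{PSL}(2,\mathbb{R})$ is hyperbolic if its absolute trace is $>2$. An element of $G$ is hyperbolic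 if both its components are hyperbolic. A hyperbolic element $\gamma=(\gamma_1,\gamma_2)$ is hyper-regular if the dominant (positive) eigenvalues of $\gamma_1$ and $\gamma_2$ (the eigenvalues $>1$ of their representatives with positive trace) are distinct. *)

theory Defs
  imports "HOL-Analysis.Analysis" "HOL-Algebra.Coset" "HOL-Algebra.Elementary_Groups"
begin

subsection \<open>Quotient topologies\<close>

definition quotient_topology :: "'a topology \<Rightarrow> ('a \<Rightarrow> 'b) \<Rightarrow> 'b topology" where
  "quotient_topology X f =
     topology (\<lambda>U. U \<subseteq> f ` topspace X \<and> openin X {x \<in> topspace X. f x \<in> U})"

lemma openin_quotient_topology:
  "openin (quotient_topology X f) U \<longleftrightarrow>
     U \<subseteq> f ` topspace X \<and> openin X {x \<in> topspace X. f x \<in> U}"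
proof -
  have "istopology (\<lambda>U. U \<subseteq> f ` topspace X \<and> openin X {x \<in> topspace X. f x \<in> U})"
    unfolding istopology_def
  proof (intro conjI allI impI; (elim conjE)?)
    fix S T
    assume "openin X {x \<in> topspace X. f x \<in> S}" "openin X {x \<in> topspace X. f x \<in> T}"
    moreover have "{x \<in> topspace X. f x \<in> S \<inter> T} =
        {x \<in> topspace X. f x \<in> S} \<inter> {x \<in> topspace X. f x \<in> T}" by auto
    ultimately show "openin X {x \<in> topspace X. f x \<in> S \<inter> T}" by auto
  next
    fix \<K>
    assume *: "\<forall>K\<in>\<K>. K \<subseteq> f ` topspace X \<and> openin X {x \<in> topspace X. f x \<in> K}"
    have "{x \<in> topspace X. f x \<in> \<Union>\<K>} = (\<Union>K\<in>\<K>. {x \<in> topspace X. f x \<in> K})" by auto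
    then show "openin X {x \<in> topspace X. f x \<in> \<Union>\<K>}" using * by auto
  qed auto
  then show ?thesis by (simp add: quotient_topology_def topology_inverse')
qed

lemma topspace_quotient_topology: "topspace (quotient_topology X f) = f ` topspace X"
proof
  show "topspace (quotient_topology X f) \<subseteq> f ` topspace X"
    using openin_quotient_topology[of X f "topspace (quotient_topology X f)"] by simp
  have "{x \<in> topspace X. f x \<in> f ` topspace X} = topspace X" by auto
  then have "openin (quotient_topology X f) (f ` topspace X)"
    by (simp add: openin_quotient_topology)
  then show "f ` topspace X \<subseteq> topspace (quotient_topology X f)" by (rule openin_subset)
qed

lemma quotient_map_quotient_topology: "quotient_map X (quotient_topology X f) f"
  unfolding quotient_map_def
  by (simp add: openin_quotient_topology topspace_quotient_topology)

subsection \<open>The groups\<close>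

definition mat2 :: "real \<Rightarrow> real \<Rightarrow> real \<Rightarrow> real \<Rightarrow> real^2^2" where
  "mat2 a b c d = vector [vector [a, b], vector [c, d]]"

definition SL2R :: "(real^2^2) monoid" where
  "SL2R = \<lparr>carrier = {M. det M = 1}, mult = (**), one = mat 1\<rparr>"

text \<open>An element of \<open>PSL2R\<close> is a coset \<open>{M, - M}\<close>.\<close>

definition PSL2R :: "(real^2^2) set monoid" where
  "PSL2R = SL2R Mod {mat 1, - mat 1}"

definition psl :: "real^2^2 \<Rightarrow> (real^2^2) set" where
  "psl M = {mat 1, - mat 1} #>\<^bsub>SL2R\<^esub> M"

definition PSL2R_topology :: "(real^2^2) set topology" where
  "PSL2R_topology = quotient_topology (top_of_set (carrier SL2R)) psl"

definition GG :: "((real^2^2) set \<times> (real^2^2) set) monoid" where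
  "GG = PSL2R \<times>\<times> PSL2R"

definition GG_topology :: "((real^2^2) set \<times> (real^2^2) set) topology" where
  "GG_topology = prod_topology PSL2R_topology PSL2R_topology"

lemma det_uminus_2: "det (- M :: real^2^2) = det M"
  by (simp add: det_2)

lemma uminus_matrix_mult: "(- A :: real^2^2) ** B = - (A ** B)"
  by (simp add: vec_eq_iff matrix_matrix_mult_def sum_negf)

lemma matrix_mult_uminus: "(A :: real^2^2) ** (- B) = - (A ** B)"
  by (simp add: vec_eq_iff matrix_matrix_mult_def sum_negf)

lemma psl_eq: "psl M = {M, - M}"
  by (auto simp: psl_def r_coset_def SL2R_def uminus_matrix_mult)

lemma group_SL2R: "group SL2R"
proof (rule groupI)
  fix M assume "M \<in> carrier SL2R"
  then have M: "det M = 1" by (simp add: SL2R_def)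
  then obtain N where N: "N ** M = mat 1" "M ** N = mat 1"
    using invertible_det_nz[of M] by (auto simp: invertible_def)
  then have "det N = 1"
    using M det_mul[of N M] by simp
  then show "\<exists>N\<in>carrier SL2R. N \<otimes>\<^bsub>SL2R\<^esub> M = \<one>\<^bsub>SL2R\<^esub>"
    using N by (auto simp: SL2R_def)
qed (auto simp: SL2R_def det_mul matrix_mul_assoc)

lemma center_normal_SL2R: "{mat 1, - mat 1} \<lhd> SL2R"
proof -
  interpret group SL2R by (rule group_SL2R)
  have sub: "subgroup {mat 1, - mat 1} SL2R"
  proof (rule subgroupI)
    fix a assume a: "a \<in> {mat 1, - mat 1 :: real^2^2}"
    then have "a \<otimes>\<^bsub>SL2R\<^esub> a = \<one>\<^bsub>SL2R\<^esub>" "a \<in> carrier SL2R"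
      by (auto simp: SL2R_def uminus_matrix_mult matrix_mult_uminus det_uminus_2)
    then have "inv\<^bsub>SL2R\<^esub> a = a" by (metis inv_equality)
    then show "inv\<^bsub>SL2R\<^esub> a \<in> {mat 1, - mat 1}" using a by simp
  qed (auto simp: SL2R_def uminus_matrix_mult matrix_mult_uminus det_uminus_2)
  show ?thesis
    by (rule normalI[OF sub])
      (auto simp: r_coset_def l_coset_def SL2R_def uminus_matrix_mult matrix_mult_uminus)
qed

lemma group_PSL2R: "group PSL2R"
  unfolding PSL2R_def by (rule normal.factorgroup_is_group[OF center_normal_SL2R])

lemma carrier_PSL2R: "carrier PSL2R = psl ` carrier SL2R"
  by (auto simp: PSL2R_def FactGroup_def RCOSETS_def psl_def)

lemma topspace_PSL2R_topology: "topspace PSL2R_topology = carrier PSL2R"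
  by (simp add: PSL2R_topology_def topspace_quotient_topology carrier_PSL2R)

lemma group_GG: "group GG"
  unfolding GG_def by (intro DirProd_group group_PSL2R)

lemma topspace_GG_topology: "topspace GG_topology = carrier GG"
  by (simp add: GG_topology_def GG_def topspace_PSL2R_topology)

subsection \<open>Lattices\<close>

text \<open>The space \<open>\<Gamma>\<backslash>G\<close> of cosets \<open>\<Gamma>g\<close>; its underlying set is \<open>rcosets\<^bsub>G\<^esub> \<Gamma>\<close>.\<close>

definition coset_topology ::
  "('a, 'b) monoid_scheme \<Rightarrow> 'a topology \<Rightarrow> 'a set \<Rightarrow> 'a set topology" where
  "coset_topology G T \<Gamma> = quotient_topology T (\<lambda>g. \<Gamma> #>\<^bsub>G\<^esub> g)"

text \<open>For a discrete subgroup \<open>\<Gamma>\<close>, a nonzero finite Borel measure on \<open>\<Gamma>\<backslash>G\<close> that is invariant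
  under right translation by \<open>G\<close> is, up to scaling, the measure induced by Haar measure, and its
  total mass is the covolume of \<open>\<Gamma>\<close>.\<close>

definition finite_covolume ::
  "('a, 'b) monoid_scheme \<Rightarrow> 'a topology \<Rightarrow> 'a set \<Rightarrow> bool" where
  "finite_covolume G T \<Gamma> \<longleftrightarrow>
     (\<exists>\<nu>. space \<nu> = rcosets\<^bsub>G\<^esub> \<Gamma> \<and>
          sets \<nu> = sigma_sets (rcosets\<^bsub>G\<^esub> \<Gamma>) {U. openin (coset_topology G T \<Gamma>) U} \<and>
          (\<forall>g\<in>carrier G. \<forall>B\<in>sets \<nu>. emeasure \<nu> ((\<lambda>x. x #>\<^bsub>G\<^esub> g) ` B) = emeasure \<nu> B) \<and>
          0 < emeasure \<nu> (space \<nu>) \<and> emeasure \<nu> (space \<nu>) < \<infinity>)"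

definition is_lattice :: "('a, 'b) monoid_scheme \<Rightarrow> 'a topology \<Rightarrow> 'a set \<Rightarrow> bool" where
  "is_lattice G T \<Gamma> \<longleftrightarrow>
     subgroup \<Gamma> G \<and> subtopology T \<Gamma> = discrete_topology \<Gamma> \<and> finite_covolume G T \<Gamma>"

definition reducible_lattice :: "((real^2^2) set \<times> (real^2^2) set) set \<Rightarrow> bool" where
  "reducible_lattice \<Gamma> \<longleftrightarrow>
     is_lattice GG GG_topology \<Gamma> \<and>
     (\<exists>\<Gamma>\<^sub>1 \<Gamma>\<^sub>2. is_lattice PSL2R PSL2R_topology \<Gamma>\<^sub>1 \<and> is_lattice PSL2R PSL2R_topology \<Gamma>\<^sub>2 \<and>
        \<Gamma>\<^sub>1 \<times> \<Gamma>\<^sub>2 \<subseteq> \<Gamma> \<and> finite (rcosets\<^bsub>GG\<lparr>carrier := \<Gamma>\<rparr>\<^esub> (\<Gamma>\<^sub>1 \<times> \<Gamma>\<^sub>2)))"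

definition irreducible_lattice :: "((real^2^2) set \<times> (real^2^2) set) set \<Rightarrow> bool" where
  "irreducible_lattice \<Gamma> \<longleftrightarrow> is_lattice GG GG_topology \<Gamma> \<and> \<not> reducible_lattice \<Gamma>"

subsection \<open>The diagonal subgroup and its orbits\<close>

definition diag_subgroup :: "((real^2^2) set \<times> (real^2^2) set) set" where
  "diag_subgroup =
     {(psl (mat2 l\<^sub>1 0 0 (inverse l\<^sub>1)), psl (mat2 l\<^sub>2 0 0 (inverse l\<^sub>2))) | l\<^sub>1 l\<^sub>2. 0 < l\<^sub>1 \<and> 0 < l\<^sub>2}"

definition diag_orbit ::
  "((real^2^2) set \<times> (real^2^2) set) set \<Rightarrow> ((real^2^2) set \<times> (real^2^2) set) set set" where
  "diag_orbit x = (\<lambda>a. x #>\<^bsub>GG\<^esub> a) ` diag_subgroup"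

subsection \<open>Action on the boundary\<close>

datatype boundary = Fin real | Infty

fun moebius_mat :: "real^2^2 \<Rightarrow> boundary \<Rightarrow> boundary" where
  "moebius_mat M Infty =
     (if M$2$1 = 0 then Infty else Fin (M$1$1 / M$2$1))"
| "moebius_mat M (Fin t) =
     (if M$2$1 * t + M$2$2 = 0 then Infty
      else Fin ((M$1$1 * t + M$1$2) / (M$2$1 * t + M$2$2)))"

definition moebius :: "(real^2^2) set \<Rightarrow> boundary \<Rightarrow> boundary" where
  "moebius p z = (THE w. \<exists>M\<in>p. w = moebius_mat M z)"

definition act :: "(real^2^2) set \<times> (real^2^2) set \<Rightarrow> boundary \<times> boundary \<Rightarrow> boundary \<times> boundary"
  where "act g z = (moebius (fst g) (fst z), moebius (snd g) (snd z))"

lemma moebius_mat_uminus: "moebius_mat (- M) z = moebius_mat M z"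
proof (cases z)
  case (Fin t)
  have "- (M$2$1 * t) - M$2$2 = - (M$2$1 * t + M$2$2)" "- (M$1$1 * t) - M$1$2 = - (M$1$1 * t + M$1$2)"
    by simp_all
  then show ?thesis unfolding Fin moebius_mat.simps
    by (simp only: vector_uminus_component mult_minus_left diff_conv_add_uminus[symmetric]
        neg_equal_0_iff_equal minus_divide_divide)
qed simp

lemma moebius_psl: "moebius (psl M) z = moebius_mat M z"
  by (simp add: moebius_def psl_eq moebius_mat_uminus)

subsection \<open>Hyperbolic and hyper-regular elements\<close>

definition abs_trace :: "(real^2^2) set \<Rightarrow> real" where
  "abs_trace p = (THE t. \<exists>M\<in>p. t = \<bar>trace M\<bar>)"

lemma abs_trace_psl: "abs_trace (psl M) = \<bar>trace M\<bar>"
proof -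
  have "\<bar>trace (- M)\<bar> = \<bar>trace M\<bar>" by (simp add: trace_def sum_negf)
  then show ?thesis by (simp add: abs_trace_def psl_eq)
qed

definition hyperbolic_PSL2R :: "(real^2^2) set \<Rightarrow> bool" where
  "hyperbolic_PSL2R p \<longleftrightarrow> p \<in> carrier PSL2R \<and> p \<noteq> \<one>\<^bsub>PSL2R\<^esub> \<and> abs_trace p > 2"

definition hyperbolic :: "(real^2^2) set \<times> (real^2^2) set \<Rightarrow> bool" where
  "hyperbolic g \<longleftrightarrow> hyperbolic_PSL2R (fst g) \<and> hyperbolic_PSL2R (snd g)"

definition dominant_eigenvalue :: "(real^2^2) set \<Rightarrow> real" where
  "dominant_eigenvalue p =
     (THE l. l > 1 \<and> (\<exists>M\<in>p. trace M > 0 \<and> (\<exists>v. v \<noteq> 0 \<and> M *v v = l *\<^sub>R v)))"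

definition hyper_regular :: "(real^2^2) set \<times> (real^2^2) set \<Rightarrow> bool" where
  "hyper_regular g \<longleftrightarrow>
     hyperbolic g \<and> dominant_eigenvalue (fst g) \<noteq> dominant_eigenvalue (snd g)"

end

theory Submission
  imports Defs
begin

text \<open>
  Lift everything to \<open>SL(2,\<real>) \<times> SL(2,\<real>)\<close>, let \<open>D\<close> be the preimage of \<open>\<Gamma>\<close>, and let \<open>L \<subseteq> \<real>\<^sup>2\<close> be the
  discrete group of logarithms of the elements of \<open>g\<^sup>-\<^sup>1 D g \<inter> A\<close>. Each of the three properties says that
  \<open>L\<close> contains two independent vectors. For 1) this is Baire's theorem in the compact Hausdorff space
  \<open>xA\<close>; 2) implies 3) because a lattice is not covered by the two axes and the two diagonals.

  For 3) implies 2), let \<open>a = diag(exp t)\<close> with \<open>t \<in> L\<close> hyper-regular and consider the groups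
  \<open>E = (g b)\<^sup>-\<^sup>1 D (g b)\<close> for \<open>b \<in> A\<close>, all of which contain \<open>a\<close>. If some \<open>E\<close> had a very short non-trivial
  element, an almost shortest one \<open>\<delta>\<close> would commute with its conjugate by \<open>a\<close>, so each component of
  \<open>\<delta>\<close> would be diagonal or unipotent upper or lower triangular. By discreteness of \<open>L\<close> and by
  contraction under \<open>a\<close> or its inverse both components are unipotent, one expanded and one contracted
  by \<open>a\<close>; then \<open>a\<close> acts with determinant 1 on a planar lattice of unipotent elements,
  which contradicts hyper-regularity. Hence short elements of the \<open>E\<close> are trivial, uniformly in \<open>b\<close>. If \<open>L\<close> lay
  on a line, the translates of a fixed small neighbourhood of 1 by \<open>g b\<^sup>n\<close>, with \<open>b\<close> off that line, would
  embed disjointly into the quotient by \<open>\<Gamma>\<close>. They have the same positive Haar measure, contradicting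
  finite covolume.
\<close>

section \<open>The topological group \<open>SL(2,\<real>)\<close>\<close>

text \<open>The translates of the neighbourhood by g b^n are left translates, whereas the finite
  measure on the quotient is only known to be invariant under right translations. Their masses are
  therefore compared through an explicit Haar measure that is invariant under left translation and
  inversion. On a set that embeds into the quotient, the pulled back measure is invariant under
  those right translations that stay inside the set, and this already makes it proportional to Haar
  measure there.

  Short elements matter because the translates could drift into a cusp, where no neighbourhood of
  fixed size embeds. Their absence gives disjointness as well. If g b^n u and g b^m u' have the same
  image, then u u'^-1 and b^(n-m) u u'^-1 have the same commutator with a, because b commutes with
  a. This commutator is short and lies in one of the groups E, so it is trivial and u u'^-1 is
  diagonal. Then b^(n-m) u u'^-1 has its logarithm in L. Since u u'^-1 is close to 1 while b points
  off the line that contains L, this forces n = m.\<close>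

lemma mat2_nth [simp]:
  "mat2 a b c d $ 1 $ 1 = a" "mat2 a b c d $ 1 $ 2 = b"
  "mat2 a b c d $ 2 $ 1 = c" "mat2 a b c d $ 2 $ 2 = d"
  by (simp_all add: mat2_def)

lemma mat2_eqI:
  fixes M N :: "real^2^2"
  assumes "M$1$1 = N$1$1" "M$1$2 = N$1$2" "M$2$1 = N$2$1" "M$2$2 = N$2$2"
  shows "M = N"
  using assms by (simp add: vec_eq_iff forall_2)

lemma matrix_mult_2_nth:
  fixes A B :: "real^2^2"
  shows "(A ** B) $ i $ j = A$i$1 * B$1$j + A$i$2 * B$2$j"
  by (simp add: matrix_matrix_mult_def sum_2)

lemma mat_1_2_nth [simp]:
  "(mat 1 :: real^2^2)$1$1 = 1" "(mat 1 :: real^2^2)$1$2 = 0"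
  "(mat 1 :: real^2^2)$2$1 = 0" "(mat 1 :: real^2^2)$2$2 = 1"
  by (simp_all add: mat_def)

text \<open>The adjugate is the inverse of a matrix of determinant 1. Its entries are linear in
  those of the matrix, so inversion is visibly continuous and easy to bound in norm.\<close>

definition adj2 :: "real^2^2 \<Rightarrow> real^2^2" where
  "adj2 M = mat2 (M$2$2) (- M$1$2) (- M$2$1) (M$1$1)"

lemma adj2_nth [simp]:
  "adj2 M $ 1 $ 1 = M$2$2" "adj2 M $ 1 $ 2 = - M$1$2"
  "adj2 M $ 2 $ 1 = - M$2$1" "adj2 M $ 2 $ 2 = M$1$1"
  by (simp_all add: adj2_def)

lemma det_adj2: "det (adj2 M) = det M"
  by (simp add: det_2)

lemma adj2_mult: "det M = 1 \<Longrightarrow> adj2 M ** M = mat 1"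
  by (intro mat2_eqI) (simp_all add: matrix_mult_2_nth det_2 algebra_simps)

lemma tendsto_matrix_matrix_mult:
  fixes f g :: "'a \<Rightarrow> real^2^2"
  assumes "(f \<longlongrightarrow> M) F" "(g \<longlongrightarrow> N) F"
  shows "((\<lambda>x. f x ** g x) \<longlongrightarrow> M ** N) F"
  by (intro vec_tendstoI, unfold matrix_mult_2_nth) (intro tendsto_intros tendsto_vec_nth assms)

lemma tendsto_mat2I:
  fixes f :: "'a \<Rightarrow> real^2^2"
  assumes "((\<lambda>x. f x $1$1) \<longlongrightarrow> M$1$1) F" "((\<lambda>x. f x $1$2) \<longlongrightarrow> M$1$2) F"
    "((\<lambda>x. f x $2$1) \<longlongrightarrow> M$2$1) F" "((\<lambda>x. f x $2$2) \<longlongrightarrow> M$2$2) F"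
  shows "(f \<longlongrightarrow> M) F"
proof (intro vec_tendstoI)
  fix i j :: 2
  show "((\<lambda>x. f x $ i $ j) \<longlongrightarrow> M $ i $ j) F"
    using assms exhaust_2[of i] exhaust_2[of j] by auto
qed

text \<open>The group \<open>SL(2,\<real>)\<close> as a type. It is written additively, since the type class of
  (not necessarily commutative) topological groups is \<^class>\<open>topological_group_add\<close>.\<close>

typedef sl2 = "{M :: real^2^2. det M = 1}" morphisms mat_of Sl2
  by (rule exI[of _ "mat 1"]) simp

lemma det_mat_of [simp]: "det (mat_of s) = 1"
  using mat_of[of s] by simp

lemma mat_of_Sl2: "det M = 1 \<Longrightarrow> mat_of (Sl2 M) = M"
  by (simp add: Sl2_inverse)

lemma sl2_eqI: "mat_of s = mat_of t \<Longrightarrow> s = t"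
  by (simp add: mat_of_inject)

instantiation sl2 :: group_add
begin
definition zero_sl2 where "0 = Sl2 (mat 1)"
definition plus_sl2 where "s + t = Sl2 (mat_of s ** mat_of t)"
definition uminus_sl2 where "- s = Sl2 (adj2 (mat_of s))"
definition minus_sl2 where "s - t = s + - (t::sl2)"

lemma mat_of_0: "mat_of 0 = mat 1"
  and mat_of_plus: "mat_of (s + t) = mat_of s ** mat_of t"
  and mat_of_uminus: "mat_of (- s) = adj2 (mat_of s)"
  by (simp_all add: zero_sl2_def plus_sl2_def uminus_sl2_def mat_of_Sl2 det_mul det_adj2)

instance
  by standard
    (auto intro!: sl2_eqI simp: mat_of_0 mat_of_plus mat_of_uminus matrix_mul_assoc adj2_mult minus_sl2_def)
end

instantiation sl2 :: metric_space
begin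
definition dist_sl2 where "dist s t = dist (mat_of s) (mat_of t)"
definition uniformity_sl2 :: "(sl2 \<times> sl2) filter"
  where "uniformity_sl2 = (INF e\<in>{0<..}. principal {(x, y). dist x y < e})"
definition open_sl2 :: "sl2 set \<Rightarrow> bool"
  where "open_sl2 U = (\<forall>x\<in>U. eventually (\<lambda>(x', y). x' = x \<longrightarrow> y \<in> U) uniformity)"
instance
proof
  fix x y z :: sl2
  show "(dist x y = 0) = (x = y)" by (auto simp: dist_sl2_def mat_of_inject)
  show "dist x y \<le> dist x z + dist y z" unfolding dist_sl2_def by (rule dist_triangle2)
qed (simp_all add: uniformity_sl2_def open_sl2_def)
end

lemma tendsto_sl2_iff: "(f \<longlongrightarrow> l) F \<longleftrightarrow> ((\<lambda>x. mat_of (f x)) \<longlongrightarrow> mat_of l) F"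
  by (simp add: tendsto_iff dist_sl2_def)

lemma tendsto_mat_of [tendsto_intros]: "(f \<longlongrightarrow> l) F \<Longrightarrow> ((\<lambda>x. mat_of (f x)) \<longlongrightarrow> mat_of l) F"
  by (simp add: tendsto_sl2_iff)

lemma continuous_on_mat_of [continuous_intros]:
  "continuous_on A f \<Longrightarrow> continuous_on A (\<lambda>x. mat_of (f x))"
  by (simp add: continuous_on_def tendsto_mat_of)

text \<open>The metric is pulled back along \<open>mat_of\<close>, so the topology is the subspace
  topology of the matrix space. This transports a countable basis.\<close>

lemma open_sl2_iff: "open U \<longleftrightarrow> (\<exists>V. open V \<and> U = mat_of -` V)"
proof
  assume U: "open U"
  have "\<exists>e>0. \<forall>t. dist s t < e \<longrightarrow> t \<in> U" if "s \<in> U" for s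
    using U that by (metis open_dist dist_commute)
  then obtain e where e: "\<And>s. s \<in> U \<Longrightarrow> e s > 0" "\<And>s t. s \<in> U \<Longrightarrow> dist s t < e s \<Longrightarrow> t \<in> U"
    by metis
  have "open (\<Union>s\<in>U. ball (mat_of s) (e s))" by auto
  moreover have "U = mat_of -` (\<Union>s\<in>U. ball (mat_of s) (e s))"
    using e by (auto simp: dist_sl2_def) (metis dist_self)
  ultimately show "\<exists>V. open V \<and> U = mat_of -` V" by blast
next
  assume "\<exists>V. open V \<and> U = mat_of -` V"
  then show "open U" by (auto intro!: open_vimage continuous_on_mat_of continuous_on_id)
qed

instance sl2 :: second_countable_topology
proof
  obtain B :: "(real^2^2) set set" where B: "countable B" "topological_basis B"
    using ex_countable_basis by blast
  let ?B = "(\<lambda>b. mat_of -` b) ` B"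
  have "topological_basis ?B"
  proof (rule topological_basisI)
    fix U assume "U \<in> ?B"
    then show "open U" using B(2) unfolding open_sl2_iff by (blast dest: topological_basis_open)
  next
    fix U :: "sl2 set" and s assume "open U" "s \<in> U"
    then obtain V where V: "open V" "U = mat_of -` V" by (auto simp: open_sl2_iff)
    then obtain b where "b \<in> B" "mat_of s \<in> b" "b \<subseteq> V"
      using topological_basisE[OF B(2) V(1), of "mat_of s"] \<open>s \<in> U\<close> by auto
    then show "\<exists>U'\<in>?B. s \<in> U' \<and> U' \<subseteq> U" using V by blast
  qed
  then show "\<exists>B::sl2 set set. countable B \<and> open = generate_topology B"
    using B(1) by (metis countable_image topological_basis_imp_subbasis)
qed

instance sl2 :: topological_group_add
proof
  fix a b :: sl2
  show "((\<lambda>x. fst x + snd x) \<longlongrightarrow> a + b) (nhds a \<times>\<^sub>F nhds b)"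
    unfolding tendsto_sl2_iff mat_of_plus
    by (intro tendsto_matrix_matrix_mult tendsto_mat_of filterlim_fst filterlim_snd)
  show "(uminus \<longlongrightarrow> - a) (nhds a)"
    unfolding tendsto_sl2_iff mat_of_uminus
    by (rule tendsto_mat2I) (auto intro!: tendsto_intros tendsto_vec_nth filterlim_ident)
qed

instance prod :: (topological_group_add, topological_group_add) topological_group_add
proof
  fix a b :: "'a \<times> 'b"
  have *: "((\<lambda>x. fst x) \<longlongrightarrow> a) (nhds a \<times>\<^sub>F nhds b)" "((\<lambda>x. snd x) \<longlongrightarrow> b) (nhds a \<times>\<^sub>F nhds b)"
    by (rule filterlim_fst filterlim_snd)+
  show "((\<lambda>x. fst x + snd x) \<longlongrightarrow> a + b) (nhds a \<times>\<^sub>F nhds b)"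
    unfolding plus_prod_def using * by (intro tendsto_intros)
  have *: "((\<lambda>x. x) \<longlongrightarrow> a) (nhds a)" by (rule filterlim_ident)
  show "(uminus \<longlongrightarrow> - a) (nhds a)"
    unfolding uminus_prod_def using * by (intro tendsto_intros)
qed

section \<open>Invariant measures and packings\<close>

lemma borel_measurable_group_add [measurable (raw)]:
  fixes f g :: "'a \<Rightarrow> 'g :: {topological_group_add, second_countable_topology}"
  assumes "f \<in> borel_measurable M" "g \<in> borel_measurable M"
  shows "(\<lambda>x. f x + g x) \<in> borel_measurable M"
  using assms by (rule borel_measurable_continuous_Pair) (intro continuous_intros)

lemma borel_measurable_group_uminus [measurable (raw)]:
  fixes f :: "'a \<Rightarrow> 'g :: {topological_group_add, second_countable_topology}"
  assumes "f \<in> borel_measurable M"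
  shows "(\<lambda>x. - f x) \<in> borel_measurable M"
  using borel_measurable_continuous_on[OF _ assms, of uminus] by (simp add: continuous_intros)

text \<open>For each fixed h, left invariance gives m(B') as the integral of the indicator of B' at
  h + k over k. Integrating over h in B and exchanging the integrals yields the formula.\<close>

lemma emeasure_mult_Haar_eq_nn_integral:
  fixes m :: "'g :: {topological_group_add, second_countable_topology} measure"
  assumes m: "sigma_finite_measure m" "sets m = sets borel"
    and left: "\<And>h. distr m borel ((+) h) = m"
    and N: "finite_measure N" "sets N = sets borel"
    and B: "B \<in> sets borel" "B' \<in> sets borel"
  shows "emeasure N B * emeasure m B' = (\<integral>\<^sup>+k. emeasure N (B \<inter> (\<lambda>h. h + k) -` B') \<partial>m)"
proof -
  interpret m: sigma_finite_measure m by fact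
  interpret N: finite_measure N by fact
  interpret pair_sigma_finite N m ..
  note [measurable_cong] = m(2) N(2)
  note [measurable] = B
  have "emeasure N B * emeasure m B' = (\<integral>\<^sup>+h. emeasure m B' * indicator B h \<partial>N)"
    by (subst nn_integral_cmult) (simp_all add: mult.commute)
  also have "\<dots> = (\<integral>\<^sup>+h. (\<integral>\<^sup>+k. indicator B h * indicator B' (h + k) \<partial>m) \<partial>N)"
  proof (rule nn_integral_cong)
    fix h
    have "emeasure m B' = emeasure (distr m borel ((+) h)) B'" by (simp add: left)
    also have "\<dots> = (\<integral>\<^sup>+k. indicator B' k \<partial>distr m borel ((+) h))" by simp
    also have "\<dots> = (\<integral>\<^sup>+k. indicator B' (h + k) \<partial>m)" by (rule nn_integral_distr) measurable
    finally show "emeasure m B' * indicator B h = (\<integral>\<^sup>+k. indicator B h * indicator B' (h + k) \<partial>m)"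
      by (subst nn_integral_cmult) (simp_all add: mult.commute)
  qed
  also have "\<dots> = (\<integral>\<^sup>+k. (\<integral>\<^sup>+h. indicator B h * indicator B' (h + k) \<partial>N) \<partial>m)"
    by (rule Fubini'[symmetric]) measurable
  also have "\<dots> = (\<integral>\<^sup>+k. emeasure N (B \<inter> (\<lambda>h. h + k) -` B') \<partial>m)"
  proof (rule nn_integral_cong)
    fix k
    have "(\<lambda>h. h + k) -` B' \<inter> space borel \<in> sets borel" by (rule measurable_sets) measurable
    then have "emeasure N (B \<inter> (\<lambda>h. h + k) -` B') = (\<integral>\<^sup>+h. indicator (B \<inter> (\<lambda>h. h + k) -` B') h \<partial>N)"
      using B by (subst nn_integral_indicator) auto
    also have "\<dots> = (\<integral>\<^sup>+h. indicator B h * indicator B' (h + k) \<partial>N)"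
      by (intro nn_integral_cong) (auto simp: indicator_def)
    finally show "(\<integral>\<^sup>+h. indicator B h * indicator B' (h + k) \<partial>N) =
      emeasure N (B \<inter> (\<lambda>h. h + k) -` B')" by simp
  qed
  finally show ?thesis .
qed

text \<open>Local uniqueness of Haar measure: by Fubini the left-hand side is
  \<open>\<integral> N (B \<inter> (B' - k)) dm(k)\<close>; translating by \<open>k\<close> inside \<open>F\<close> and substituting \<open>- k\<close> for \<open>k\<close> exchanges
  \<open>B\<close> and \<open>B'\<close>.\<close>

lemma locally_right_invariant_unique:
  fixes m :: "'g :: {topological_group_add, second_countable_topology} measure"
  assumes m: "sigma_finite_measure m" "sets m = sets borel"
    and left: "\<And>h. distr m borel ((+) h) = m" and inversion: "distr m borel uminus = m"
    and N: "finite_measure N" "sets N = sets borel"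
    and inv: "\<And>E k. E \<in> sets borel \<Longrightarrow> E \<subseteq> F \<Longrightarrow> (\<lambda>h. h + k) ` E \<subseteq> F \<Longrightarrow>
                emeasure N ((\<lambda>h. h + k) ` E) = emeasure N E"
    and B: "B \<in> sets borel" "B' \<in> sets borel" "B \<subseteq> F" "B' \<subseteq> F"
  shows "emeasure N B * emeasure m B' = emeasure N B' * emeasure m B"
proof -
  note [measurable_cong] = m(2) N(2)
  note [measurable] = B(1,2)
  interpret N: finite_measure N by fact
  have "emeasure N B * emeasure m B' = (\<integral>\<^sup>+k. emeasure N (B \<inter> (\<lambda>h. h + k) -` B') \<partial>m)"
    by (rule emeasure_mult_Haar_eq_nn_integral) (fact m left N B)+
  also have "\<dots> = (\<integral>\<^sup>+k. emeasure N (B' \<inter> (\<lambda>h. h + - k) -` B) \<partial>m)"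
  proof (rule nn_integral_cong)
    fix k
    let ?E = "B \<inter> (\<lambda>h. h + k) -` B'"
    have "(\<lambda>h. h + k) -` B' \<inter> space borel \<in> sets borel" by (rule measurable_sets) measurable
    then have E: "?E \<in> sets borel" using B by auto
    have eq: "(\<lambda>h. h + k) ` ?E = B' \<inter> (\<lambda>h. h + - k) -` B"
    proof (intro equalityI subsetI)
      fix h assume "h \<in> B' \<inter> (\<lambda>h. h + - k) -` B"
      then show "h \<in> (\<lambda>h. h + k) ` ?E" by (intro image_eqI[of _ _ "h + - k"]) (auto simp: add.assoc)
    qed (auto simp: add.assoc)
    \<comment> \<open>Local invariance applies because \<open>?E\<close> lies in B and its translate
      lies in B', both inside F.\<close>
    have "emeasure N ((\<lambda>h. h + k) ` ?E) = emeasure N ?E"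
      using B E by (intro inv) auto
    then show "emeasure N ?E = emeasure N (B' \<inter> (\<lambda>h. h + - k) -` B)" by (simp only: eq)
  qed
  also have "\<dots> = (\<integral>\<^sup>+k. emeasure N (B' \<inter> (\<lambda>h. h + k) -` B) \<partial>distr m borel uminus)"
  proof (rule nn_integral_distr[symmetric])
    \<comment> \<open>The substitution of - k for k needs a measurable integrand; it is the measure
      of the sections of a measurable set of pairs.\<close>
    have "{x \<in> space (borel \<Otimes>\<^sub>M N). snd x \<in> B' \<and> snd x + fst x \<in> B} \<in> sets (borel \<Otimes>\<^sub>M N)"
      by measurable
    then have "(\<lambda>k. emeasure N (Pair k -` {x \<in> space (borel \<Otimes>\<^sub>M N). snd x \<in> B' \<and> snd x + fst x \<in> B}))
       \<in> borel_measurable borel"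
      by (rule N.measurable_emeasure_Pair)
    moreover have "Pair k -` {x \<in> space (borel \<Otimes>\<^sub>M N). snd x \<in> B' \<and> snd x + fst x \<in> B} =
        B' \<inter> (\<lambda>h. h + k) -` B" for k
      using sets_eq_imp_space_eq[OF N(2)] by (auto simp: space_pair_measure)
    ultimately show "(\<lambda>k. emeasure N (B' \<inter> (\<lambda>h. h + k) -` B)) \<in> borel_measurable (distr m borel uminus)" by simp
  qed measurable
  also have "\<dots> = emeasure N B' * emeasure m B"
    unfolding inversion
    by (rule emeasure_mult_Haar_eq_nn_integral[symmetric]) (fact m left N B)+
  finally show ?thesis .
qed

lemma open_left_translation:
  fixes U :: "'g :: topological_group_add set"
  assumes "open U" shows "open ((+) h ` U)"
proof -
  have "(+) h ` U = (\<lambda>x. - h + x) -` U"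
    by (auto simp: image_iff add.assoc[symmetric] intro!: bexI[of _ "- h + _"])
  then show ?thesis using assms by (auto intro!: open_vimage continuous_intros)
qed

lemma open_right_translation:
  fixes U :: "'g :: topological_group_add set"
  assumes "open U" shows "open ((\<lambda>x. x + h) ` U)"
proof -
  have "(\<lambda>x. x + h) ` U = (\<lambda>x. x + - h) -` U"
    by (auto simp: image_iff add.assoc intro!: bexI[of _ "_ + - h"])
  then show ?thesis using assms by (auto intro!: open_vimage continuous_intros)
qed

text \<open>On the embedded union, the measure pulled back from the quotient is proportional to m.
  All pieces have the same m-mass by left invariance, hence the same pulled back mass; as the total
  is finite, that mass is 0. Right translates of one piece then cover the quotient by countably many
  null sets.\<close>

lemma no_infinite_packing:
  fixes m :: "'g :: {topological_group_add, second_countable_topology} measure"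
    and \<nu> :: "'x measure" and \<pi> :: "'g \<Rightarrow> 'x" and h :: "nat \<Rightarrow> 'g"
  assumes m: "sigma_finite_measure m" "sets m = sets borel"
    and left: "\<And>h. distr m borel ((+) h) = m" and inversion: "distr m borel uminus = m"
    and \<nu>: "finite_measure \<nu>" "space \<nu> = range \<pi>" "emeasure \<nu> (space \<nu>) \<noteq> 0"
    and open_image: "\<And>V. open V \<Longrightarrow> \<pi> ` V \<in> sets \<nu>"
    and inv: "\<And>E k. \<pi> ` E \<in> sets \<nu> \<Longrightarrow> emeasure \<nu> (\<pi> ` (\<lambda>h. h + k) ` E) = emeasure \<nu> (\<pi> ` E)"
    and U: "open U" "0 \<in> U" "emeasure m U \<noteq> 0" "emeasure m U \<noteq> \<infinity>"
    and disj: "disjoint_family (\<lambda>n. (+) (h n) ` U)"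
  shows "\<not> inj_on \<pi> (\<Union>n. (+) (h n) ` U)"
proof
  define B where "B n = (+) (h n) ` U" for n
  define F where "F = (\<Union>n. B n)"
  assume "inj_on \<pi> (\<Union>n. (+) (h n) ` U)"
  then have inj: "inj_on \<pi> F" by (simp add: F_def B_def)
  have openB: "open (B n)" for n unfolding B_def by (rule open_left_translation[OF U(1)])
  then have openF: "open F" by (auto simp: F_def)
  interpret \<nu>: finite_measure \<nu> by fact
  have BF: "B n \<subseteq> F" for n by (auto simp: F_def)
  \<comment> \<open>Images under \<open>\<pi>\<close> commute with complements only where
    \<open>\<pi>\<close> is injective, which is why everything is intersected with F.\<close>
  have image: "\<pi> ` (E \<inter> F) \<in> sets \<nu>" if "E \<in> sets borel" for E
  proof -
    have "E \<in> sigma_sets UNIV {S. open S}" using that by (simp add: borel_def)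
    then show ?thesis
    proof induction
      case (Compl A)
      have "\<pi> ` ((UNIV - A) \<inter> F) = \<pi> ` F - \<pi> ` (A \<inter> F)" using inj by (auto simp: inj_on_def)
      then show ?case using Compl open_image[OF openF] by auto
    next
      case (Union A)
      have "\<pi> ` (\<Union> (range A) \<inter> F) = (\<Union>i. \<pi> ` (A i \<inter> F))" by auto
      then show ?case using Union by auto
    qed (use openF open_image in auto)
  qed
  define \<sigma> where "\<sigma> = the_inv_into F \<pi>"
  have \<sigma>: "\<sigma> (\<pi> x) = x" if "x \<in> F" for x
    using that inj by (simp add: \<sigma>_def the_inv_into_f_f)
  have sp: "space (restrict_space \<nu> (\<pi> ` F)) = \<pi> ` F"
    using \<nu>(2) by (auto simp: space_restrict_space)
  have pre: "\<sigma> -` E \<inter> \<pi> ` F = \<pi> ` (E \<inter> F)" for E using \<sigma> by auto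
  have \<pi>F: "\<pi> ` F \<inter> space \<nu> \<in> sets \<nu>" using open_image[OF openF] by auto
  have \<sigma>_meas [measurable]: "\<sigma> \<in> restrict_space \<nu> (\<pi> ` F) \<rightarrow>\<^sub>M borel"
  proof (rule measurableI)
    fix E :: "'g set" assume "E \<in> sets borel"
    then show "\<sigma> -` E \<inter> space (restrict_space \<nu> (\<pi> ` F)) \<in> sets (restrict_space \<nu> (\<pi> ` F))"
      unfolding sp pre using image \<pi>F by (auto simp: sets_restrict_space_iff)
  qed simp
  \<comment> \<open>The measure \<open>\<nu>\<close> pulled back to F along the inverse of the
    injective restriction of \<open>\<pi>\<close>.\<close>
  define N where "N = distr (restrict_space \<nu> (\<pi> ` F)) borel \<sigma>"
  have N: "emeasure N E = emeasure \<nu> (\<pi> ` (E \<inter> F))" if "E \<in> sets borel" for E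
    using that \<pi>F image[OF that]
    by (simp add: N_def emeasure_distr sp pre emeasure_restrict_space image_mono)
  have finN: "finite_measure N"
    unfolding N_def
    by (intro finite_measure.finite_measure_distr \<sigma>_meas finite_measure_restrict_space \<nu>(1) open_image openF)
  have eq: "emeasure N (B n) * emeasure m (B 0) = emeasure N (B 0) * emeasure m (B n)" for n
  proof (rule locally_right_invariant_unique[where F = F])
    fix E k assume E: "E \<in> sets borel" "E \<subseteq> F" "(\<lambda>h. h + k) ` E \<subseteq> F"
    have "(\<lambda>h. h + k) ` E = (\<lambda>h. h + - k) -` E \<inter> space borel"
      by (auto simp: image_iff add.assoc intro!: bexI[of _ "_ + - k"])
    moreover have "(\<lambda>h. h + - k) -` E \<inter> space borel \<in> sets borel"
      by (rule measurable_sets[OF _ E(1)]) measurable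
    ultimately have "(\<lambda>h. h + k) ` E \<in> sets borel" by simp
    then show "emeasure N ((\<lambda>h. h + k) ` E) = emeasure N E"
      using E inv[of E k] image[OF E(1)] by (simp add: N Int_absorb2)
  qed (use m left inversion finN openB BF in \<open>auto simp: N_def\<close>)
  have mB: "emeasure m (B n) = emeasure m U" for n
  proof -
    have [measurable]: "(+) (h n) \<in> m \<rightarrow>\<^sub>M borel"
      using m(2) by (simp cong: measurable_cong_sets)
    have "emeasure m (B n) = emeasure (distr m borel ((+) (h n))) (B n)" by (simp add: left)
    also have "\<dots> = emeasure m ((+) (h n) -` B n \<inter> space m)"
      using openB by (intro emeasure_distr) auto
    also have "(+) (h n) -` B n \<inter> space m = U"
      using sets_eq_imp_space_eq[OF m(2)] by (auto simp: B_def)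
    finally show ?thesis .
  qed
  have const: "emeasure N (B n) = emeasure N (B 0)" for n
    using eq[of n] U(3,4) by (simp add: mB ennreal_mult_cancel_left mult.commute[of _ "emeasure m U"])
  \<comment> \<open>A series with constant terms and finite sum has terms 0.\<close>
  have "(\<integral>\<^sup>+n. emeasure N (B 0) \<partial>count_space (UNIV :: nat set)) = (\<Sum>n. emeasure N (B n))"
    unfolding nn_integral_count_space_nat by (rule suminf_cong) (rule const[symmetric])
  also have "\<dots> = emeasure N F"
    unfolding F_def using openB disj by (intro suminf_emeasure) (auto simp: N_def B_def)
  also have "\<dots> \<noteq> \<infinity>" using finite_measure.emeasure_finite[OF finN] by simp
  finally have "emeasure N (B 0) = 0" by (auto simp: ennreal_mult_eq_top_iff)
  then have null: "emeasure \<nu> (\<pi> ` B 0) = 0" using openB BF[of 0] by (simp add: N Int_absorb2)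
  \<comment> \<open>All right translates of B 0 have null image by invariance; by Lindelof,
    countably many of them cover the group.\<close>
  define \<C> where "\<C> = range (\<lambda>c. (\<lambda>x. x + c) ` B 0)"
  have "\<And>C. C \<in> \<C> \<Longrightarrow> open C" by (auto simp: \<C>_def open_right_translation openB)
  then obtain \<C>' where \<C>': "\<C>' \<subseteq> \<C>" "countable \<C>'" "\<Union>\<C>' = \<Union>\<C>" using Lindelof by metis
  have "x \<in> \<Union>\<C>" for x
  proof -
    have "h 0 \<in> B 0" using U(2) by (force simp: B_def)
    then have "x \<in> (\<lambda>y. y + (- h 0 + x)) ` B 0"
      by (intro image_eqI[of _ _ "h 0"]) (simp_all add: add.assoc[symmetric])
    then show ?thesis by (auto simp: \<C>_def)
  qed
  then have "\<Union>\<C>' = UNIV" using \<C>'(3) by blast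
  then have "space \<nu> = (\<Union>C\<in>\<C>'. \<pi> ` C)" using \<nu>(2) by (metis image_Union)
  moreover have "(\<Union>C\<in>\<C>'. \<pi> ` C) \<in> null_sets \<nu>"
  proof (rule null_sets_UN')
    fix C assume "C \<in> \<C>'"
    then obtain c where "C = (\<lambda>x. x + c) ` B 0" using \<C>'(1) by (auto simp: \<C>_def)
    then show "\<pi> ` C \<in> null_sets \<nu>"
      using null inv[of "B 0" c] openB open_image open_right_translation
      by (auto simp: null_sets_def)
  qed fact
  ultimately show False using \<nu>(3) by auto
qed

section \<open>Haar measure on \<open>SL(2,\<real>)\<close>\<close>

lemma distr_lborel_shear:
  fixes \<phi> :: "'a::euclidean_space \<Rightarrow> 'b::euclidean_space"
  assumes [measurable]: "\<phi> \<in> borel_measurable borel"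
  shows "distr lborel borel (\<lambda>(x, y). (x, y + \<phi> x)) = lborel"
proof (rule measure_eqI)
  fix A assume "A \<in> sets (distr lborel borel (\<lambda>(x::'a, y::'b). (x, y + \<phi> x)))"
  then have A [measurable]: "A \<in> sets borel" by simp
  have [measurable]: "(\<lambda>(x, y). (x, y + \<phi> x)) \<in> (borel :: ('a \<times> 'b) measure) \<rightarrow>\<^sub>M borel"
    unfolding borel_prod[symmetric] by measurable
  have A': "(\<lambda>(x, y). (x, y + \<phi> x)) -` A \<in> sets (lborel \<Otimes>\<^sub>M lborel)"
    unfolding lborel_prod sets_lborel
    using measurable_sets[of "\<lambda>(x, y). (x, y + \<phi> x)" borel borel A] by simp
  have fib: "Pair x -` A \<in> sets borel" for x
  proof -
    have "Pair x \<in> borel \<rightarrow>\<^sub>M (borel :: ('a \<times> 'b) measure)"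
      unfolding borel_prod[symmetric] by measurable
    from measurable_sets[OF this A] show ?thesis by simp
  qed
  have "emeasure (distr lborel borel (\<lambda>(x, y). (x, y + \<phi> x))) A =
      emeasure (lborel \<Otimes>\<^sub>M lborel) ((\<lambda>(x, y). (x, y + \<phi> x)) -` A)"
    by (subst emeasure_distr) (simp_all add: lborel_prod)
  also have "\<dots> = (\<integral>\<^sup>+x. emeasure lborel (Pair x -` (\<lambda>(x, y). (x, y + \<phi> x)) -` A) \<partial>lborel)"
    by (rule lborel.emeasure_pair_measure_alt[OF A'])
  also have "\<dots> = (\<integral>\<^sup>+x. emeasure lborel (Pair x -` A) \<partial>lborel)"
  proof (rule nn_integral_cong)
    fix x
    \<comment> \<open>On the fibre over x the shear is the translation by
      \<open>\<phi> x\<close>.\<close>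
    have "emeasure lborel (Pair x -` A) = emeasure (distr lborel borel ((+) (\<phi> x))) (Pair x -` A)"
      by (simp add: lborel_distr_plus)
    also have "\<dots> = emeasure lborel ((+) (\<phi> x) -` Pair x -` A)"
      using fib by (subst emeasure_distr) auto
    also have "(+) (\<phi> x) -` Pair x -` A = Pair x -` (\<lambda>(x, y). (x, y + \<phi> x)) -` A"
      by (auto simp: add.commute)
    finally show "emeasure lborel (Pair x -` (\<lambda>(x, y). (x, y + \<phi> x)) -` A) =
        emeasure lborel (Pair x -` A)" ..
  qed
  also have "\<dots> = emeasure (lborel \<Otimes>\<^sub>M lborel) A"
    by (rule lborel.emeasure_pair_measure_alt[symmetric]) (use A in \<open>simp only: lborel_prod sets_lborel\<close>)
  finally show "emeasure (distr lborel borel (\<lambda>(x, y). (x, y + \<phi> x))) A = emeasure lborel A"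
    by (simp add: lborel_prod)
qed simp

lemma distr_lborel_swap:
  "distr lborel borel prod.swap = (lborel :: ('b::euclidean_space \<times> 'a::euclidean_space) measure)"
proof -
  have "(lborel :: 'b measure) \<Otimes>\<^sub>M (lborel :: 'a measure) =
      distr (lborel \<Otimes>\<^sub>M lborel) (lborel \<Otimes>\<^sub>M lborel) (\<lambda>(x, y). (y, x))"
    by (rule pair_sigma_finite.distr_pair_swap) (rule pair_sigma_finite.intro; rule lborel.sigma_finite_measure_axioms)
  then show ?thesis
    unfolding lborel_prod prod.swap_def[abs_def] by (simp add: case_prod_beta' cong: distr_cong)
qed

lemma distr_lborel_shear_fst:
  fixes \<phi> :: "'b::euclidean_space \<Rightarrow> 'a::euclidean_space"
  assumes [measurable]: "\<phi> \<in> borel_measurable borel"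
  shows "distr lborel borel (\<lambda>(x, y). (x + \<phi> y, y)) = lborel"
proof -
  have [measurable]: "(\<lambda>(x, y). (x, y + \<phi> x)) \<in> (borel :: ('b \<times> 'a) measure) \<rightarrow>\<^sub>M borel"
    "prod.swap \<in> (borel :: ('b \<times> 'a) measure) \<rightarrow>\<^sub>M borel"
    "prod.swap \<in> (borel :: ('a \<times> 'b) measure) \<rightarrow>\<^sub>M borel"
    unfolding borel_prod[symmetric] prod.swap_def[abs_def] by measurable
  have "(lborel :: ('a \<times> 'b) measure) =
      distr (distr (distr lborel borel prod.swap) borel (\<lambda>(x, y). (x, y + \<phi> x))) borel prod.swap"
    by (simp add: distr_lborel_swap distr_lborel_shear)
  also have "\<dots> = distr lborel borel (prod.swap \<circ> (\<lambda>(x, y). (x, y + \<phi> x)) \<circ> prod.swap)"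
    by (simp add: distr_distr comp_assoc)
  also have "prod.swap \<circ> (\<lambda>(x, y). (x, y + \<phi> x)) \<circ> prod.swap = (\<lambda>(x, y). (x + \<phi> y, y))"
    by auto
  finally show ?thesis ..
qed

lemma distr_lborel_map_prod:
  fixes f :: "'a::euclidean_space \<Rightarrow> 'a" and g :: "'b::euclidean_space \<Rightarrow> 'b"
  assumes "distr lborel borel f = lborel" "distr lborel borel g = lborel"
    and [measurable]: "f \<in> borel_measurable borel" "g \<in> borel_measurable borel"
  shows "distr lborel borel (\<lambda>(x, y). (f x, g y)) = lborel"
proof -
  have "distr lborel borel f \<Otimes>\<^sub>M distr lborel borel g =
      distr (lborel \<Otimes>\<^sub>M lborel) (borel \<Otimes>\<^sub>M borel) (\<lambda>(x, y). (f x, g y))"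
    by (rule pair_measure_distr) (simp_all add: assms(2) lborel.sigma_finite_measure_axioms)
  then show ?thesis by (simp add: assms(1,2) lborel_prod borel_prod)
qed

text \<open>Haar measure on \<open>SL(2,\<real>)\<close> is the Lebesgue measure of the cone over a set, with apex \<open>0\<close>.
  A matrix \<open>(a b; c d)\<close> is encoded as \<open>((a, d), (b, c))\<close>: then elementary row operations are
  products of two shears, and the adjugate is the product of a swap and a point reflection.\<close>

type_synonym coords = "(real \<times> real) \<times> (real \<times> real)"

definition cdet :: "coords \<Rightarrow> real" where
  "cdet = (\<lambda>((a, d), (b, c)). a * d - b * c)"

definition sl2_cone :: "coords set" where
  "sl2_cone = {v. 0 < cdet v \<and> cdet v \<le> 1}"

text \<open>The radial projection of the cone onto \<open>SL(2,\<real>)\<close>: the matrix r s with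
  r > 0 and s of determinant 1 has determinant r * r, so dividing by the square root of the
  determinant recovers s.\<close>

definition normalise :: "coords \<Rightarrow> sl2" where
  "normalise = (\<lambda>((a, d), (b, c)). Sl2 (inverse (sqrt (a * d - b * c)) *\<^sub>R mat2 a b c d))"

definition haar_sl2 :: "sl2 measure" where
  "haar_sl2 = distr (restrict_space lborel sl2_cone) borel normalise"

lemma mat_of_normalise:
  assumes "0 < cdet ((a, d), (b, c))"
  shows "mat_of (normalise ((a, d), (b, c))) = inverse (sqrt (a * d - b * c)) *\<^sub>R mat2 a b c d"
proof -
  let ?D = "a * d - b * c"
  have "?D > 0" using assms by (simp add: cdet_def)
  then have "inverse (sqrt ?D) * inverse (sqrt ?D) = inverse ?D"
    by (metis inverse_mult_distrib less_eq_real_def real_sqrt_mult_self abs_of_pos)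
  moreover have "det (inverse (sqrt ?D) *\<^sub>R mat2 a b c d) = (inverse (sqrt ?D) * inverse (sqrt ?D)) * ?D"
    by (simp add: det_2 algebra_simps)
  ultimately have "det (inverse (sqrt ?D) *\<^sub>R mat2 a b c d) = 1" using \<open>?D > 0\<close> by simp
  then show ?thesis by (simp add: normalise_def mat_of_Sl2)
qed

lemma continuous_on_mat2I:
  fixes f :: "'a::topological_space \<Rightarrow> real^2^2"
  assumes "continuous_on A (\<lambda>x. f x $1$1)" "continuous_on A (\<lambda>x. f x $1$2)"
    "continuous_on A (\<lambda>x. f x $2$1)" "continuous_on A (\<lambda>x. f x $2$2)"
  shows "continuous_on A f"
  using assms by (auto simp: continuous_on_def intro!: tendsto_mat2I)

lemma continuous_on_sl2_iff: "continuous_on A f \<longleftrightarrow> continuous_on A (\<lambda>x. mat_of (f x))"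
  unfolding continuous_on_def tendsto_sl2_iff ..

lemma continuous_on_cdet: "continuous_on A cdet"
  unfolding cdet_def case_prod_beta by (intro continuous_intros)

lemma sets_sl2_cone [measurable]: "sl2_cone \<in> sets borel"
proof -
  have [measurable]: "cdet \<in> borel_measurable borel"
    by (rule borel_measurable_continuous_onI) (rule continuous_on_cdet)
  show ?thesis unfolding sl2_cone_def by measurable
qed

lemma continuous_on_normalise: "continuous_on {v. 0 < cdet v} normalise"
proof -
  let ?f = "\<lambda>v::coords. inverse (sqrt (cdet v)) *\<^sub>R mat2 (fst (fst v)) (fst (snd v)) (snd (snd v)) (snd (fst v))"
  have eq: "mat_of (normalise v) = ?f v" if "v \<in> {v. 0 < cdet v}" for v
    using that mat_of_normalise by (cases v) (auto simp: cdet_def)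
  have "continuous_on {v. 0 < cdet v} ?f"
    by (rule continuous_on_mat2I) (auto intro!: continuous_intros continuous_on_cdet)
  then show ?thesis
    unfolding continuous_on_sl2_iff by (rule continuous_on_eq) (rule eq[symmetric])
qed

lemma measurable_normalise [measurable]: "normalise \<in> restrict_space lborel sl2_cone \<rightarrow>\<^sub>M borel"
proof -
  have "continuous_on sl2_cone normalise"
    by (rule continuous_on_subset[OF continuous_on_normalise]) (auto simp: sl2_cone_def)
  then have "normalise \<in> borel_measurable (restrict_space borel sl2_cone)"
    by (rule borel_measurable_continuous_on_restrict)
  then show ?thesis by (simp add: measurable_def space_restrict_space sets_restrict_space)
qed

lemma sets_haar_sl2 [simp, measurable_cong]: "sets haar_sl2 = sets borel"
  and space_haar_sl2 [simp]: "space haar_sl2 = UNIV"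
  by (simp_all add: haar_sl2_def)

lemma
  assumes "B \<in> sets borel"
  shows sets_sl2_cone_over [measurable]: "{v\<in>sl2_cone. normalise v \<in> B} \<in> sets borel"
    and emeasure_haar_sl2: "emeasure haar_sl2 B = emeasure lborel {v\<in>sl2_cone. normalise v \<in> B}"
proof -
  have eq: "normalise -` B \<inter> space (restrict_space lborel sl2_cone) = {v\<in>sl2_cone. normalise v \<in> B}"
    by (auto simp: space_restrict_space)
  have "{v\<in>sl2_cone. normalise v \<in> B} \<in> sets (restrict_space lborel sl2_cone)"
    using measurable_sets[OF measurable_normalise assms] by (simp only: eq)
  then show "{v\<in>sl2_cone. normalise v \<in> B} \<in> sets borel"
    by (auto simp: sets_restrict_space_iff)
  show "emeasure haar_sl2 B = emeasure lborel {v\<in>sl2_cone. normalise v \<in> B}"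
    unfolding haar_sl2_def using assms
    by (subst emeasure_distr) (auto simp only: eq measurable_normalise, subst emeasure_restrict_space, auto)
qed

text \<open>A map that preserves Lebesgue measure and the determinant also preserves the cone; if it
  covers \<open>\<phi>\<close> under radial projection, then it maps the cone over the preimage of a
  set to the cone over that set.\<close>

lemma distr_haar_sl2:
  assumes [measurable]: "T \<in> borel \<rightarrow>\<^sub>M borel" "\<phi> \<in> borel \<rightarrow>\<^sub>M borel"
    and T: "distr lborel borel T = lborel" "\<And>v. cdet (T v) = cdet v"
      "\<And>v. v \<in> sl2_cone \<Longrightarrow> normalise (T v) = \<phi> (normalise v)"
  shows "distr haar_sl2 borel \<phi> = haar_sl2"
proof (rule measure_eqI)
  fix B assume "B \<in> sets (distr haar_sl2 borel \<phi>)"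
  then have B [measurable]: "B \<in> sets borel" by simp
  then have B': "\<phi> -` B \<in> sets borel" using measurable_sets[OF assms(2) B] by simp
  have "emeasure (distr haar_sl2 borel \<phi>) B = emeasure lborel {v\<in>sl2_cone. normalise v \<in> \<phi> -` B}"
    using B' by (subst emeasure_distr) (auto simp: emeasure_haar_sl2)
  also have "{v\<in>sl2_cone. normalise v \<in> \<phi> -` B} = T -` {v\<in>sl2_cone. normalise v \<in> B}"
    using T(2,3) by (auto simp: sl2_cone_def)
  also have "emeasure lborel (T -` {v\<in>sl2_cone. normalise v \<in> B}) =
      emeasure (distr lborel borel T) {v\<in>sl2_cone. normalise v \<in> B}"
    using sets_sl2_cone_over[OF B] by (subst emeasure_distr) auto
  also have "\<dots> = emeasure haar_sl2 B" by (simp add: T(1) emeasure_haar_sl2[OF B])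
  finally show "emeasure (distr haar_sl2 borel \<phi>) B = emeasure haar_sl2 B" .
qed simp

definition upper :: "real \<Rightarrow> sl2" where "upper t = Sl2 (mat2 1 t 0 1)"
definition lower :: "real \<Rightarrow> sl2" where "lower t = Sl2 (mat2 1 0 t 1)"

lemma mat_of_upper: "mat_of (upper t) = mat2 1 t 0 1"
  and mat_of_lower: "mat_of (lower t) = mat2 1 0 t 1"
  by (simp_all add: upper_def lower_def mat_of_Sl2 det_2)

lemma sl2_eqI':
  assumes "mat_of s $1$1 = mat_of t $1$1" "mat_of s $1$2 = mat_of t $1$2"
    "mat_of s $2$1 = mat_of t $2$1" "mat_of s $2$2 = mat_of t $2$2"
  shows "s = t"
  using assms by (intro sl2_eqI mat2_eqI)

lemma continuous_on_add_left: "continuous_on A ((+) (h :: 'g::topological_group_add))"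
  by (intro continuous_intros)

lemma distr_haar_sl2_upper: "distr haar_sl2 borel ((+) (upper t)) = haar_sl2"
proof (rule distr_haar_sl2)
  \<comment> \<open>Adding t times the second row to the first replaces a by a + t c and then b by b
    + t d. With the encoding ((a, d), (b, c)), each replacement shifts one pair by a function of the
    other.\<close>
  let ?S = "(\<lambda>(x, y). (x + (t * snd y, 0), y)) :: coords \<Rightarrow> coords"
  let ?T = "(\<lambda>(x, y). (x, y + (t * snd x, 0))) :: coords \<Rightarrow> coords"
  have [measurable]: "?S \<in> borel \<rightarrow>\<^sub>M borel" "?T \<in> borel \<rightarrow>\<^sub>M borel"
    unfolding case_prod_beta by (auto intro!: borel_measurable_continuous_onI continuous_intros)
  show "?T \<circ> ?S \<in> borel \<rightarrow>\<^sub>M borel" by measurable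
  have "distr lborel borel ?S = lborel"
    by (rule distr_lborel_shear_fst) (auto intro!: borel_measurable_continuous_onI continuous_intros)
  moreover have "distr lborel borel ?T = lborel"
    by (rule distr_lborel_shear) (auto intro!: borel_measurable_continuous_onI continuous_intros)
  moreover have "distr (distr lborel borel ?S) borel ?T = distr lborel borel (?T \<circ> ?S)"
    by (rule distr_distr) simp_all
  ultimately show "distr lborel borel (?T \<circ> ?S) = lborel" by simp
  show det: "cdet ((?T \<circ> ?S) v) = cdet v" for v
    by (cases v) (auto simp: cdet_def algebra_simps)
  show "normalise ((?T \<circ> ?S) v) = upper t + normalise v" if "v \<in> sl2_cone" for v
  proof -
    obtain a b c d where v: "v = ((a, d), (b, c))" by (metis surj_pair)
    have "(?T \<circ> ?S) v = ((a + t * c, d), (b + t * d, c))" by (simp add: v)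
    then show ?thesis
      using that det[of v]
      by (intro sl2_eqI')
        (simp_all add: v sl2_cone_def mat_of_normalise mat_of_plus matrix_mult_2_nth mat_of_upper,
          simp_all add: algebra_simps)
  qed
qed (rule borel_measurable_continuous_onI, rule continuous_on_add_left)

lemma distr_haar_sl2_lower: "distr haar_sl2 borel ((+) (lower t)) = haar_sl2"
proof (rule distr_haar_sl2)
  \<comment> \<open>Here t times the first row is added to the second: d becomes d + t b, then c
    becomes c + t a.\<close>
  let ?S = "(\<lambda>(x, y). (x + (0, t * fst y), y)) :: coords \<Rightarrow> coords"
  let ?T = "(\<lambda>(x, y). (x, y + (0, t * fst x))) :: coords \<Rightarrow> coords"
  have [measurable]: "?S \<in> borel \<rightarrow>\<^sub>M borel" "?T \<in> borel \<rightarrow>\<^sub>M borel"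
    unfolding case_prod_beta by (auto intro!: borel_measurable_continuous_onI continuous_intros)
  show "?T \<circ> ?S \<in> borel \<rightarrow>\<^sub>M borel" by measurable
  have "distr lborel borel ?S = lborel"
    by (rule distr_lborel_shear_fst) (auto intro!: borel_measurable_continuous_onI continuous_intros)
  moreover have "distr lborel borel ?T = lborel"
    by (rule distr_lborel_shear) (auto intro!: borel_measurable_continuous_onI continuous_intros)
  moreover have "distr (distr lborel borel ?S) borel ?T = distr lborel borel (?T \<circ> ?S)"
    by (rule distr_distr) simp_all
  ultimately show "distr lborel borel (?T \<circ> ?S) = lborel" by simp
  show det: "cdet ((?T \<circ> ?S) v) = cdet v" for v
    by (cases v) (auto simp: cdet_def algebra_simps)
  show "normalise ((?T \<circ> ?S) v) = lower t + normalise v" if "v \<in> sl2_cone" for v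
  proof -
    obtain a b c d where v: "v = ((a, d), (b, c))" by (metis surj_pair)
    have "(?T \<circ> ?S) v = ((a, d + t * b), (b, c + t * a))" by (simp add: v)
    then show ?thesis
      using that det[of v]
      by (intro sl2_eqI')
        (simp_all add: v sl2_cone_def mat_of_normalise mat_of_plus matrix_mult_2_nth mat_of_lower,
          simp_all add: algebra_simps)
  qed
qed (rule borel_measurable_continuous_onI, rule continuous_on_add_left)

lemma distr_haar_sl2_uminus: "distr haar_sl2 borel uminus = haar_sl2"
proof (rule distr_haar_sl2)
  let ?T = "(\<lambda>(x, y). (prod.swap x, - y)) :: coords \<Rightarrow> coords"
  show "?T \<in> borel \<rightarrow>\<^sub>M borel"
    unfolding case_prod_beta prod.swap_def by (auto intro!: borel_measurable_continuous_onI continuous_intros)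
  have "distr lborel borel (\<lambda>(x::real, y::real). (- x, - y)) = lborel"
    by (rule distr_lborel_map_prod) (simp_all add: lborel_distr_uminus)
  moreover have "(\<lambda>(x::real, y::real). (- x, - y)) = uminus" by auto
  ultimately have "distr lborel borel uminus = (lborel :: (real \<times> real) measure)" by simp
  moreover have "prod.swap \<in> (borel :: (real \<times> real) measure) \<rightarrow>\<^sub>M borel"
    unfolding prod.swap_def[abs_def] by (auto intro!: borel_measurable_continuous_onI continuous_intros)
  moreover have "uminus \<in> (borel :: (real \<times> real) measure) \<rightarrow>\<^sub>M borel"
    by (auto intro!: borel_measurable_continuous_onI continuous_intros)
  ultimately show "distr lborel borel ?T = lborel"
    by (intro distr_lborel_map_prod distr_lborel_swap)
  show det: "cdet (?T v) = cdet v" for v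
    by (cases v) (auto simp: cdet_def algebra_simps)
  show "normalise (?T v) = - normalise v" if "v \<in> sl2_cone" for v
  proof -
    obtain a b c d where v: "v = ((a, d), (b, c))" by (metis surj_pair)
    then show ?thesis
      using that det[of v]
      by (intro sl2_eqI')
        (simp_all add: sl2_cone_def mat_of_normalise mat_of_uminus mult.commute)
  qed
qed (auto intro!: borel_measurable_continuous_onI continuous_intros)

text \<open>The elements whose left translation preserves the measure are closed under the group
  operation and contain the elementary matrices, which generate
  \<open>SL(2,\<real>)\<close>.\<close>

lemma distr_haar_sl2_plus: "distr haar_sl2 borel ((+) h) = haar_sl2"
proof -
  define H where "H = {h. distr haar_sl2 borel ((+) h) = haar_sl2}"
  have add: "g + h \<in> H" if "g \<in> H" "h \<in> H" for g h
  proof -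
    have "distr (distr haar_sl2 borel ((+) h)) borel ((+) g) = distr haar_sl2 borel ((+) g \<circ> (+) h)"
      by (rule distr_distr) (auto intro!: borel_measurable_continuous_onI continuous_on_add_left)
    moreover have "(+) g \<circ> (+) h = (+) (g + h)" by (auto simp: add.assoc)
    ultimately show ?thesis using that by (simp add: H_def)
  qed
  have *: "upper t \<in> H" "lower t \<in> H" for t
    by (simp_all add: H_def distr_haar_sl2_upper distr_haar_sl2_lower)
  have c: "h \<in> H" if "mat_of h $2$1 \<noteq> 0" for h
  proof -
    let ?a = "mat_of h $1$1" and ?b = "mat_of h $1$2" and ?c = "mat_of h $2$1" and ?d = "mat_of h $2$2"
    have "?a * ?d - ?b * ?c = 1" using det_mat_of[of h] by (simp only: det_2)
    \<comment> \<open>Explicit factorisation when c is nonzero: the first factor adjusts the entry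
      a, the last one the entry d, and the entry b then follows from the determinant.\<close>
    then have "h = upper ((?a - 1) / ?c) + (lower ?c + upper ((?d - 1) / ?c))"
      using that
      by (intro sl2_eqI')
        (simp_all add: mat_of_plus matrix_mult_2_nth mat_of_upper mat_of_lower field_simps)
    then show ?thesis using add * by metis
  qed
  have "h \<in> H"
  proof (cases "mat_of h $2$1 = 0")
    case True
    then have "mat_of h $1$1 \<noteq> 0" using det_mat_of[of h] by (auto simp: det_2)
    \<comment> \<open>Adding the first row to the second turns the lower left entry 0 into a, which
      is nonzero because a d = 1.\<close>
    then have "lower 1 + h \<in> H" using True
      by (intro c) (simp add: mat_of_plus matrix_mult_2_nth mat_of_lower)
    moreover have "h = lower (-1) + (lower 1 + h)"
      by (intro sl2_eqI') (simp_all add: mat_of_plus matrix_mult_2_nth mat_of_lower)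
    ultimately show ?thesis using add *(2) by metis
  qed (rule c)
  then show ?thesis by (simp add: H_def)
qed

text \<open>Points of the cone are r s with 0 < r and r at most 1, so the cone over a bounded set is
  bounded.\<close>

lemma emeasure_haar_sl2_bounded:
  "emeasure haar_sl2 {s. \<forall>i j. \<bar>mat_of s $ i $ j\<bar> \<le> n} < \<infinity>"
proof -
  let ?K = "{s. \<forall>i j. \<bar>mat_of s $ i $ j\<bar> \<le> n}"
  have "closed ?K"
    by (intro closed_Collect_all closed_Collect_le continuous_intros continuous_on_component)
  then have K: "?K \<in> sets borel" by (rule borel_closed)
  have "{v\<in>sl2_cone. normalise v \<in> ?K} \<subseteq> cbox ((- n, - n), (- n, - n)) ((n, n), (n, n))"
  proof
    fix v assume v: "v \<in> {v\<in>sl2_cone. normalise v \<in> ?K}"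
    obtain a b c d where v': "v = ((a, d), (b, c))" by (metis surj_pair)
    define r where "r = sqrt (a * d - b * c)"
    have r: "0 < r" "r \<le> 1" using v by (auto simp: v' sl2_cone_def cdet_def r_def)
    have *: "- n \<le> x \<and> x \<le> n" if "\<bar>inverse r * x\<bar> \<le> n" for x
    proof -
      have "\<bar>x\<bar> = r * \<bar>inverse r * x\<bar>" using r by (simp add: abs_mult)
      also have "\<dots> \<le> 1 * \<bar>inverse r * x\<bar>" using r by (intro mult_right_mono) auto
      finally show ?thesis using that by linarith
    qed
    have "0 < cdet ((a, d), (b, c))" using v by (simp add: v' sl2_cone_def)
    from mat_of_normalise[OF this] have "\<bar>inverse r * mat2 a b c d $ i $ j\<bar> \<le> n" for i j
      using v by (simp add: v' r_def)
    note entries = *[OF this]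
    have "- n \<le> a \<and> a \<le> n" "- n \<le> b \<and> b \<le> n" "- n \<le> c \<and> c \<le> n" "- n \<le> d \<and> d \<le> n"
      using entries[of 1 1] entries[of 1 2] entries[of 2 1] entries[of 2 2] by simp_all
    then show "v \<in> cbox ((- n, - n), (- n, - n)) ((n, n), (n, n))"
      by (simp add: v' cbox_Pair_eq mem_Times_iff)
  qed
  then have "bounded {v\<in>sl2_cone. normalise v \<in> ?K}" by (rule bounded_subset[OF bounded_cbox])
  then show ?thesis unfolding emeasure_haar_sl2[OF K] by (rule emeasure_bounded_finite)
qed

lemma emeasure_haar_sl2_open:
  assumes "open U" "s \<in> U"
  shows "emeasure haar_sl2 U \<noteq> 0"
proof
  \<comment> \<open>The strict bound on the determinant makes this part of the cone open, so that it
    has positive Lebesgue measure once it contains a point.\<close>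
  let ?V = "{v \<in> {v. 0 < cdet v \<and> cdet v < 1}. normalise v \<in> U}"
  assume "emeasure haar_sl2 U = 0"
  then have null: "emeasure lborel {v\<in>sl2_cone. normalise v \<in> U} = 0"
    using assms by (simp add: emeasure_haar_sl2)
  have "open {v. 0 < cdet v \<and> cdet v < 1}"
    by (intro open_Collect_conj open_Collect_less continuous_on_cdet continuous_intros)
  then have "open ?V"
    using continuous_open_preimage[OF continuous_on_subset[OF continuous_on_normalise] _ assms(1), of "{v. 0 < cdet v \<and> cdet v < 1}"]
    by (auto simp: vimage_def Int_def)
  have sub: "?V \<subseteq> {v\<in>sl2_cone. normalise v \<in> U}" by (auto simp only: sl2_cone_def)
  have "{v\<in>sl2_cone. normalise v \<in> U} \<in> sets lborel"
    using sets_sl2_cone_over[OF borel_open[OF assms(1)]] by (simp only: sets_lborel)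
  from emeasure_mono[OF sub this] have "emeasure lborel ?V = 0" unfolding null by simp
  then have "?V \<in> null_sets lborel" using \<open>open ?V\<close> by (intro null_setsI) simp_all
  then have "negligible ?V" by (simp only: negligible_iff_null_sets null_sets_completionI)
  \<comment> \<open>Half the matrix of s: its determinant 1/4 lies strictly between 0 and 1, and it
    projects radially to s.\<close>
  moreover define v where "v = (let M = mat_of s in ((M$1$1 / 2, M$2$2 / 2), (M$1$2 / 2, M$2$1 / 2)))"
  have det: "mat_of s$1$1 * mat_of s$2$2 - mat_of s$1$2 * mat_of s$2$1 = 1"
    using det_mat_of[of s] by (simp only: det_2)
  then have quarter: "mat_of s$1$1 * mat_of s$2$2 / 4 - mat_of s$1$2 * mat_of s$2$1 / 4 = 1 / 4"
    by (simp flip: diff_divide_distrib)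
  then have isq: "inverse (sqrt (mat_of s$1$1 * mat_of s$2$2 / 4 - mat_of s$1$2 * mat_of s$2$1 / 4)) = 2"
    by (simp only: quarter) (simp add: real_sqrt_divide)
  from det have cv: "cdet v = 1 / 4" by (simp add: v_def cdet_def Let_def field_simps)
  have "normalise v = s"
    using cv unfolding v_def Let_def
    by (intro sl2_eqI') (simp_all add: mat_of_normalise isq)
  then have "v \<in> ?V" using cv assms(2) by simp
  ultimately show False using open_not_negligible[OF \<open>open ?V\<close>] by blast
qed

lemma sigma_finite_haar_sl2: "sigma_finite_measure haar_sl2"
proof
  let ?K = "\<lambda>n::nat. {s. \<forall>i j. \<bar>mat_of s $ i $ j\<bar> \<le> real n}"
  have "closed (?K n)" for n
    by (intro closed_Collect_all closed_Collect_le continuous_intros continuous_on_component)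
  moreover have "s \<in> (\<Union>n. ?K n)" for s
  proof -
    obtain n where n: "norm (mat_of s) \<le> real n" using real_arch_simple by blast
    have "\<bar>mat_of s $ i $ j\<bar> \<le> real n" for i j
      using n component_le_norm_cart[of "mat_of s $ i" j]
        Finite_Cartesian_Product.norm_nth_le[of "mat_of s" i] by linarith
    then show ?thesis by blast
  qed
  ultimately show "\<exists>A. countable A \<and> A \<subseteq> sets haar_sl2 \<and> \<Union>A = space haar_sl2 \<and> (\<forall>a\<in>A. emeasure haar_sl2 a \<noteq> \<infinity>)"
    using emeasure_haar_sl2_bounded
    by (intro exI[of _ "range ?K"]) (auto simp: less_top[symmetric])
qed

section \<open>Haar measure on the product of two copies of the group\<close>

definition haar_sl2_prod :: "(sl2 \<times> sl2) measure" where
  "haar_sl2_prod = haar_sl2 \<Otimes>\<^sub>M haar_sl2"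

lemma sets_haar_sl2_prod: "sets haar_sl2_prod = sets borel"
  unfolding haar_sl2_prod_def borel_prod[symmetric] by (rule sets_pair_measure_cong) simp_all

lemma sigma_finite_haar_sl2_prod: "sigma_finite_measure haar_sl2_prod"
proof -
  interpret pair_sigma_finite haar_sl2 haar_sl2
    by (intro pair_sigma_finite.intro sigma_finite_haar_sl2)
  show ?thesis unfolding haar_sl2_prod_def by (rule sigma_finite_measure_axioms)
qed

lemma distr_haar_sl2_prod:
  assumes "distr haar_sl2 borel f = haar_sl2" "distr haar_sl2 borel g = haar_sl2"
    and "f \<in> borel_measurable borel" "g \<in> borel_measurable borel"
  shows "distr haar_sl2_prod borel (\<lambda>(x, y). (f x, g y)) = haar_sl2_prod"
proof -
  have "distr haar_sl2 borel f \<Otimes>\<^sub>M distr haar_sl2 borel g =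
      distr (haar_sl2 \<Otimes>\<^sub>M haar_sl2) (borel \<Otimes>\<^sub>M borel) (\<lambda>(x, y). (f x, g y))"
    using assms by (intro pair_measure_distr) (simp_all add: sigma_finite_haar_sl2)
  then show ?thesis by (simp add: assms(1,2) haar_sl2_prod_def borel_prod)
qed

lemma distr_haar_sl2_prod_plus: "distr haar_sl2_prod borel ((+) h) = haar_sl2_prod"
proof -
  have "(+) h = (\<lambda>(x, y). (fst h + x, snd h + y))" by (auto simp: plus_prod_def)
  then show ?thesis
    by (simp only:) (intro distr_haar_sl2_prod distr_haar_sl2_plus
        borel_measurable_continuous_onI continuous_on_add_left)
qed

lemma distr_haar_sl2_prod_uminus: "distr haar_sl2_prod borel uminus = haar_sl2_prod"
proof -
  have "uminus = (\<lambda>(x :: sl2, y :: sl2). (- x, - y))" by (auto simp: uminus_prod_def)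
  moreover have "uminus \<in> borel_measurable (borel :: sl2 measure)"
    by (auto intro!: borel_measurable_continuous_onI continuous_intros)
  ultimately show ?thesis by (metis distr_haar_sl2_prod distr_haar_sl2_uminus)
qed

lemma haar_sl2_small_nbhd:
  assumes "open W" "0 \<in> W"
  obtains U where "open U" "0 \<in> U" "U \<subseteq> W" "emeasure haar_sl2 U \<noteq> 0" "emeasure haar_sl2 U < \<infinity>"
proof
  \<comment> \<open>The bound 2 only has to exceed the entries 0 and 1 of the identity matrix; it
    makes the mass finite.\<close>
  define U where "U = W \<inter> {s. \<forall>i\<in>UNIV. \<forall>j\<in>UNIV. \<bar>mat_of s $ i $ j\<bar> < 2}"
  have "open {s. \<bar>mat_of s $ i $ j\<bar> < 2}" for i j
    by (intro open_Collect_less continuous_intros continuous_on_component)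
  then have "open {s. \<forall>i\<in>UNIV. \<forall>j\<in>UNIV. \<bar>mat_of s $ i $ j\<bar> < 2}"
    by (simp only: Collect_ball_eq) (intro open_INT ballI finite)
  then show "open U" unfolding U_def using assms(1) by (rule open_Int[rotated])
  show "0 \<in> U" using assms(2) by (simp add: U_def mat_of_0 forall_2)
  then show "emeasure haar_sl2 U \<noteq> 0" by (rule emeasure_haar_sl2_open[OF \<open>open U\<close>])
  show "U \<subseteq> W" by (auto simp: U_def)
  have K: "{s. \<forall>i j. \<bar>mat_of s $ i $ j\<bar> \<le> 2} \<in> sets haar_sl2"
    unfolding sets_haar_sl2
    by (intro borel_closed closed_Collect_all closed_Collect_le continuous_intros continuous_on_component)
  have "U \<subseteq> {s. \<forall>i j. \<bar>mat_of s $ i $ j\<bar> \<le> 2}" by (auto simp: U_def intro: less_imp_le)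
  from emeasure_mono[OF this K] show "emeasure haar_sl2 U < \<infinity>"
    using emeasure_haar_sl2_bounded by (rule le_less_trans)
qed

lemma haar_sl2_prod_small_nbhd:
  assumes "open W" "0 \<in> W"
  obtains U where "open U" "0 \<in> U" "U \<subseteq> W"
    "emeasure haar_sl2_prod U \<noteq> 0" "emeasure haar_sl2_prod U \<noteq> \<infinity>"
proof -
  obtain A B where AB: "open A" "open B" "0 \<in> A \<times> B" "A \<times> B \<subseteq> W"
    using open_prod_elim[OF assms] by blast
  then have "0 \<in> A" "0 \<in> B" by (simp_all add: zero_prod_def)
  obtain U where U: "open U" "0 \<in> U" "U \<subseteq> A" "emeasure haar_sl2 U \<noteq> 0" "emeasure haar_sl2 U < \<infinity>"
    using haar_sl2_small_nbhd[OF AB(1) \<open>0 \<in> A\<close>] .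
  obtain V where V: "open V" "0 \<in> V" "V \<subseteq> B" "emeasure haar_sl2 V \<noteq> 0" "emeasure haar_sl2 V < \<infinity>"
    using haar_sl2_small_nbhd[OF AB(2) \<open>0 \<in> B\<close>] .
  have "emeasure haar_sl2_prod (U \<times> V) = emeasure haar_sl2 U * emeasure haar_sl2 V"
    unfolding haar_sl2_prod_def using U(1) V(1)
    by (intro sigma_finite_measure.emeasure_pair_measure_Times sigma_finite_haar_sl2) simp_all
  then show ?thesis
    using U V AB by (intro that[of "U \<times> V"])
      (auto simp: open_Times zero_prod_def ennreal_mult_eq_top_iff)
qed

section \<open>Discrete subgroups and planar lattices\<close>

definition discrete_subgroup :: "'g::topological_group_add set \<Rightarrow> bool" where
  "discrete_subgroup D \<longleftrightarrow> 0 \<in> D \<and> (\<forall>x\<in>D. \<forall>y\<in>D. x - y \<in> D) \<and> (\<exists>V. open V \<and> 0 \<in> V \<and> V \<inter> D \<subseteq> {0})"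

lemma discrete_subgroup_zero: "discrete_subgroup D \<Longrightarrow> 0 \<in> D"
  and discrete_subgroup_diff: "discrete_subgroup D \<Longrightarrow> x \<in> D \<Longrightarrow> y \<in> D \<Longrightarrow> x - y \<in> D"
  by (simp_all add: discrete_subgroup_def)

lemma discrete_subgroup_uminus: "discrete_subgroup D \<Longrightarrow> x \<in> D \<Longrightarrow> - x \<in> D"
  using discrete_subgroup_diff[of D 0 x] discrete_subgroup_zero[of D] by simp

lemma discrete_subgroup_plus: "discrete_subgroup D \<Longrightarrow> x \<in> D \<Longrightarrow> y \<in> D \<Longrightarrow> x + y \<in> D"
  using discrete_subgroup_diff[of D x "- y"] discrete_subgroup_uminus[of D y] by simp

text \<open>Serves for the embeddings of the diagonal plane and of planes of unipotent elements, and
  for inner automorphisms.\<close>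

lemma discrete_subgroup_vimage:
  fixes f :: "'a::topological_group_add \<Rightarrow> 'b::topological_group_add"
  assumes D: "discrete_subgroup D" and f: "continuous_on UNIV f" "inj f" "\<And>x y. f (x - y) = f x - f y"
  shows "discrete_subgroup (f -` D)"
proof -
  have f0: "f 0 = 0" using f(3)[of 0 0] by simp
  obtain V where V: "open V" "0 \<in> V" "V \<inter> D \<subseteq> {0}" using D by (auto simp: discrete_subgroup_def)
  have "open (f -` V)" using V(1) f(1) by (rule open_vimage)
  moreover have "f -` V \<inter> f -` D \<subseteq> {0}"
    using V(3) f0 by (auto intro!: injD[OF f(2), of _ 0])
  ultimately show ?thesis
    using D V(2) f(3) f0 unfolding discrete_subgroup_def by (intro conjI exI[of _ "f -` V"]) auto
qed

text \<open>The quotients of consecutive terms lie in D and tend to 0, so they eventually enter the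
  neighbourhood that contains no other element of D.\<close>

lemma discrete_subgroup_eventually_const:
  fixes X :: "nat \<Rightarrow> 'g::topological_group_add"
  assumes D: "discrete_subgroup D" and X: "\<And>n. X n \<in> D" "X \<longlonglongrightarrow> l"
  shows "eventually (\<lambda>n. X (Suc n) = X n) sequentially"
proof -
  obtain V where V: "open V" "0 \<in> V" "V \<inter> D \<subseteq> {0}" using D by (auto simp: discrete_subgroup_def)
  have "(\<lambda>n. - X n + X (Suc n)) \<longlonglongrightarrow> - l + l"
    by (intro tendsto_intros X(2) LIMSEQ_Suc)
  then have "eventually (\<lambda>n. - X n + X (Suc n) \<in> V) sequentially"
    using V(1,2) by (auto dest: topological_tendstoD)
  then show ?thesis
  proof eventually_elim
    case (elim n)
    have "- X n + X (Suc n) \<in> D"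
      using X(1) D by (intro discrete_subgroup_plus discrete_subgroup_uminus)
    then have "- X n + X (Suc n) = 0" using elim V(3) by blast
    then have "X n + (- X n + X (Suc n)) = X n" by simp
    then show ?case by (simp add: add.assoc[symmetric])
  qed
qed

lemma discrete_subgroup_limit:
  fixes D :: "'g::{topological_group_add, t2_space} set"
  assumes D: "discrete_subgroup D" and X: "\<And>n. X n \<in> D" "X \<longlonglongrightarrow> l"
  obtains n where "X n = l"
proof -
  obtain N where N: "\<And>n. n \<ge> N \<Longrightarrow> X (Suc n) = X n"
    using discrete_subgroup_eventually_const[OF D X] by (auto simp: eventually_sequentially)
  have "X (n + N) = X N" for n by (induction n) (simp_all add: N)
  then have "(\<lambda>n. X (n + N)) \<longlonglongrightarrow> X N" by simp
  moreover have "(\<lambda>n. X (n + N)) \<longlonglongrightarrow> l" using X(2) by (rule LIMSEQ_ignore_initial_segment)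
  ultimately show ?thesis using LIMSEQ_unique that by blast
qed

lemma discrete_subgroup_closed:
  fixes D :: "'g::{topological_group_add, t2_space, first_countable_topology} set"
  assumes "discrete_subgroup D"
  shows "closed D"
  unfolding closed_sequential_limits using discrete_subgroup_limit[OF assms] by metis

lemma discrete_subgroup_finite:
  fixes D :: "'g::euclidean_space set"
  assumes D: "discrete_subgroup D"
  shows "finite (D \<inter> cball 0 r)"
proof (rule ccontr)
  assume "infinite (D \<inter> cball 0 r)"
  moreover have "compact (D \<inter> cball 0 r)"
    by (intro closed_Int_compact discrete_subgroup_closed D compact_cball)
  ultimately obtain l where "l islimpt (D \<inter> cball 0 r)"
    by (meson compact_eq_Bolzano_Weierstrass order_refl)
  then obtain X where X: "\<And>n. X n \<in> D \<inter> cball 0 r - {l}" "X \<longlonglongrightarrow> l"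
    unfolding islimpt_sequential by blast
  then show False using discrete_subgroup_limit[OF D, of X l] by auto
qed

lemma discrete_subgroup_shortest:
  fixes D :: "'g::euclidean_space set"
  assumes D: "discrete_subgroup D" and S: "S \<subseteq> D" "s \<in> S"
  obtains x where "x \<in> S" "\<And>y. y \<in> S \<Longrightarrow> norm x \<le> norm y"
proof -
  have fin: "finite (S \<inter> cball 0 (norm s))"
    by (rule finite_subset[OF _ discrete_subgroup_finite[OF D]]) (use S in auto)
  have ne: "S \<inter> cball 0 (norm s) \<noteq> {}" using S by auto
  obtain x where x: "x \<in> S \<inter> cball 0 (norm s)" "\<And>y. y \<in> S \<inter> cball 0 (norm s) \<Longrightarrow> norm x \<le> norm y"
    using ex_min_if_finite[of "norm ` (S \<inter> cball 0 (norm s))"] fin ne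
    by (metis (no_types, lifting) arg_min_least arg_min_if_finite(1))
  show ?thesis
  proof (rule that)
    fix y assume "y \<in> S"
    show "norm x \<le> norm y"
    proof (cases "norm y \<le> norm s")
      case True then show ?thesis using x(2) \<open>y \<in> S\<close> by auto
    qed (use x(1) in auto)
  qed (use x in auto)
qed

text \<open>The planar determinant. That it is nonzero is how linear independence is expressed
  throughout.\<close>

definition cross :: "real \<times> real \<Rightarrow> real \<times> real \<Rightarrow> real" where
  "cross u v = fst u * snd v - snd u * fst v"

lemma cross_add_right: "cross u (v + w) = cross u v + cross u w"
  and cross_diff_right: "cross u (v - w) = cross u v - cross u w"
  and cross_scaleR_right: "cross u (r *\<^sub>R v) = r * cross u v"
  by (simp_all add: cross_def algebra_simps)

text \<open>Cramer's rule.\<close>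

lemma cross_decomp:
  assumes "cross u v \<noteq> 0"
  shows "w = (cross w v / cross u v) *\<^sub>R u + (cross u w / cross u v) *\<^sub>R v"
proof -
  have "cross u v *\<^sub>R w = cross w v *\<^sub>R u + cross u w *\<^sub>R v"
    by (simp add: prod_eq_iff cross_def algebra_simps)
  then have "inverse (cross u v) *\<^sub>R (cross u v *\<^sub>R w) =
      inverse (cross u v) *\<^sub>R (cross w v *\<^sub>R u + cross u w *\<^sub>R v)" by simp
  then show ?thesis using assms by (simp add: scaleR_add_right divide_inverse mult.commute)
qed

lemma cross_eq_0_imp:
  assumes "cross u v = 0" "u \<noteq> 0"
  obtains r where "v = r *\<^sub>R u"
proof (cases "fst u = 0")
  case True
  then have "snd u \<noteq> 0" "fst v = 0" using assms by (auto simp: cross_def prod_eq_iff)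
  then show ?thesis using True by (intro that[of "snd v / snd u"]) (auto simp: prod_eq_iff)
next
  case False
  then show ?thesis using assms
    by (intro that[of "fst v / fst u"]) (auto simp: prod_eq_iff cross_def field_simps)
qed

lemma discrete_subgroup_scaleR_int:
  fixes D :: "'g::real_normed_vector set"
  assumes D: "discrete_subgroup D" "x \<in> D"
  shows "of_int k *\<^sub>R x \<in> D"
proof (induction k rule: int_induct[of _ 0])
  case base show ?case using discrete_subgroup_zero[OF D(1)] by simp
next
  case (step1 i) then show ?case
    using discrete_subgroup_plus[OF D(1) _ D(2)] by (simp add: scaleR_add_left)
next
  case (step2 i) then show ?case
    using discrete_subgroup_diff[OF D(1) _ D(2)] by (simp add: scaleR_diff_left)
qed

text \<open>Gauss reduction: the shortest non-zero vector and the shortest vector independent of it.\<close>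

lemma lattice_basis:
  fixes L :: "(real \<times> real) set"
  assumes L: "discrete_subgroup L" and uv: "u \<in> L" "v \<in> L" "cross u v \<noteq> 0"
  obtains u' v' where "u' \<in> L" "v' \<in> L" "cross u' v' \<noteq> 0"
    "\<And>w. w \<in> L \<Longrightarrow> \<exists>k l::int. w = of_int k *\<^sub>R u' + of_int l *\<^sub>R v'"
proof -
  have "u \<noteq> 0" using uv(3) by (auto simp: cross_def)
  obtain a where a: "a \<in> L - {0}" "\<And>y. y \<in> L - {0} \<Longrightarrow> norm a \<le> norm y"
    using discrete_subgroup_shortest[OF L, of "L - {0}" u] uv(1) \<open>u \<noteq> 0\<close> by auto
  have "cross a u \<noteq> 0 \<or> cross a v \<noteq> 0"
  proof (rule ccontr)
    assume "\<not> ?thesis"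
    then obtain r s where "u = r *\<^sub>R a" "v = s *\<^sub>R a" using a(1) by (auto elim!: cross_eq_0_imp)
    then show False using uv(3) by (simp add: cross_def)
  qed
  then obtain b where b: "b \<in> {y \<in> L. cross a y \<noteq> 0}" "\<And>y. y \<in> {y \<in> L. cross a y \<noteq> 0} \<Longrightarrow> norm b \<le> norm y"
    using discrete_subgroup_shortest[OF L, of "{y \<in> L. cross a y \<noteq> 0}"] uv(1,2) by blast
  have ab: "norm a \<le> norm b" using a(2)[of b] b(1) by (cases "b = 0") (auto simp: cross_def)
  show ?thesis
  proof (rule that[of a b])
    fix w assume w: "w \<in> L"
    define \<alpha> \<beta> where "\<alpha> = cross w b / cross a b" and "\<beta> = cross a w / cross a b"
    have dec: "w = \<alpha> *\<^sub>R a + \<beta> *\<^sub>R b" using cross_decomp[of a b w] b(1) by (simp add: \<alpha>_def \<beta>_def)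
    \<comment> \<open>Rounding the coordinates of w leaves a lattice vector whose coordinates are at
      most 1/2 in absolute value; minimality of a and b will force it to vanish.\<close>
    define x where "x = w - of_int (round \<alpha>) *\<^sub>R a - of_int (round \<beta>) *\<^sub>R b"
    define \<alpha>' \<beta>' where "\<alpha>' = \<alpha> - of_int (round \<alpha>)" and "\<beta>' = \<beta> - of_int (round \<beta>)"
    have x: "x = \<alpha>' *\<^sub>R a + \<beta>' *\<^sub>R b" by (simp add: x_def dec \<alpha>'_def \<beta>'_def algebra_simps)
    have small: "\<bar>\<alpha>'\<bar> \<le> 1/2" "\<bar>\<beta>'\<bar> \<le> 1/2"
      using of_int_round_abs_le[of \<alpha>] of_int_round_abs_le[of \<beta>] by (simp_all add: \<alpha>'_def \<beta>'_def abs_minus_commute)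
    have xL: "x \<in> L"
      unfolding x_def using w a(1) b(1) L
      by (intro discrete_subgroup_diff discrete_subgroup_scaleR_int) auto
    \<comment> \<open>Otherwise x is independent of a, so |b| is at most |x|, which is at most (|a|
      + |b|)/2. As |a| is at most |b|, all three lengths agree, and this borderline case must be
      excluded separately.\<close>
    have "\<beta>' = 0"
    proof (rule ccontr)
      assume "\<beta>' \<noteq> 0"
      then have cx: "cross a x \<noteq> 0" using b(1) by (simp add: x cross_def algebra_simps)
      have "norm x \<le> \<bar>\<alpha>'\<bar> * norm a + \<bar>\<beta>'\<bar> * norm b"
        using norm_triangle_ineq[of "\<alpha>' *\<^sub>R a" "\<beta>' *\<^sub>R b"] by (simp add: x)
      also have "\<dots> \<le> 1/2 * norm a + 1/2 * norm b"
        using small by (intro add_mono mult_right_mono) auto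
      finally have le: "norm x \<le> 1/2 * norm a + 1/2 * norm b" .
      moreover have "norm b \<le> norm x" using b(2) xL cx by simp
      ultimately have eq: "norm x = norm b" "norm a = norm b" using ab by linarith+
      \<comment> \<open>Expanding the square bounds the mixed term from below by a quarter of |b|^2.
        This forces equality in the Cauchy-Schwarz inequality, hence dependence of a and b.\<close>
      have "(norm x)\<^sup>2 = \<alpha>'\<^sup>2 * (norm a)\<^sup>2 + \<beta>'\<^sup>2 * (norm b)\<^sup>2 + 2 * (\<alpha>' * \<beta>') * (a \<bullet> b)"
        unfolding power2_norm_eq_inner x
        by (simp add: inner_add_left inner_add_right inner_commute[of b a]
            power2_eq_square algebra_simps)
      moreover have "\<alpha>'\<^sup>2 \<le> 1/4" "\<beta>'\<^sup>2 \<le> 1/4"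
        using power_mono[OF small(1), of 2] power_mono[OF small(2), of 2] by (simp_all add: power2_eq_square)
      moreover have "\<alpha>' * \<beta>' * (a \<bullet> b) \<le> 1/4 * (norm a * norm b)"
      proof -
        have "\<alpha>' * \<beta>' * (a \<bullet> b) \<le> \<bar>\<alpha>'\<bar> * \<bar>\<beta>'\<bar> * \<bar>a \<bullet> b\<bar>" by (metis abs_ge_self abs_mult)
        also have "\<dots> \<le> (1/2 * (1/2)) * (norm a * norm b)"
          using small by (intro mult_mono Cauchy_Schwarz_ineq2) auto
        finally show ?thesis by simp
      qed
      ultimately have "(norm b)\<^sup>2 \<le> 1/4 * (norm b)\<^sup>2 + 1/4 * (norm b)\<^sup>2 + 2 * (\<alpha>' * \<beta>' * (a \<bullet> b))"
        "\<alpha>' * \<beta>' * (a \<bullet> b) \<le> 1/4 * (norm b)\<^sup>2"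
        using eq mult_right_mono[of "\<alpha>'\<^sup>2" "1/4" "(norm b)\<^sup>2"] mult_right_mono[of "\<beta>'\<^sup>2" "1/4" "(norm b)\<^sup>2"]
        by (simp_all add: power2_eq_square)
      then have eq2: "\<alpha>' * \<beta>' * (a \<bullet> b) = 1/4 * (norm b)\<^sup>2" by linarith
      have "\<bar>\<alpha>'\<bar> * \<bar>\<beta>'\<bar> * \<bar>a \<bullet> b\<bar> \<le> 1/4 * \<bar>a \<bullet> b\<bar>"
        using mult_mono[OF small] by (intro mult_right_mono) auto
      moreover have "\<alpha>' * \<beta>' * (a \<bullet> b) \<le> \<bar>\<alpha>'\<bar> * \<bar>\<beta>'\<bar> * \<bar>a \<bullet> b\<bar>" by (metis abs_ge_self abs_mult)
      ultimately have "(norm b)\<^sup>2 \<le> \<bar>a \<bullet> b\<bar>" using eq2 by linarith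
      then have "\<bar>a \<bullet> b\<bar> = norm a * norm b"
        using Cauchy_Schwarz_ineq2[of a b] eq by (simp add: power2_eq_square)
      then have "(a \<bullet> b)\<^sup>2 = (a \<bullet> a) * (b \<bullet> b)"
        by (metis power2_abs power_mult_distrib power2_norm_eq_inner)
      then have "(cross a b)\<^sup>2 = 0"
        by (simp add: cross_def inner_prod_def power2_eq_square algebra_simps)
      then show False using b(1) by simp
    qed
    moreover have "\<alpha>' = 0"
    proof (rule ccontr)
      assume "\<alpha>' \<noteq> 0"
      then have "x \<noteq> 0" using a(1) \<open>\<beta>' = 0\<close> by (simp add: x)
      then have "norm a \<le> norm x" using a(2) xL by simp
      also have "\<dots> \<le> 1/2 * norm a" using mult_right_mono[OF small(1), of "norm a"] \<open>\<beta>' = 0\<close> by (simp add: x)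
      finally show False using a(1) by simp
    qed
    ultimately have "x = 0" by (simp add: x)
    then have "w = of_int (round \<alpha>) *\<^sub>R a + of_int (round \<beta>) *\<^sub>R b" by (simp add: x_def algebra_simps)
    then show "\<exists>k l::int. w = of_int k *\<^sub>R a + of_int l *\<^sub>R b" by blast
  qed (use a b in auto)
qed

lemma additive_int_pair:
  fixes f :: "int \<times> int \<Rightarrow> 'g::real_vector"
  assumes f: "\<And>x y. f (x + y) = f x + f y"
  shows "f (k, l) = of_int k *\<^sub>R f (1, 0) + of_int l *\<^sub>R f (0, 1)"
proof -
  have f0: "f (0, 0) = 0" using f[of "(0, 0)" "(0, 0)"] by simp
  have 1: "f (k, 0) = of_int k *\<^sub>R f (1, 0)" for k
  proof (induction k rule: int_induct[of _ 0])
    case base show ?case by (simp add: f0)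
  next
    case (step1 i) then show ?case using f[of "(i, 0)" "(1, 0)"] by (simp add: scaleR_add_left)
  next
    case (step2 i) then show ?case using f[of "(i - 1, 0)" "(1, 0)"] by (simp add: scaleR_diff_left)
  qed
  have 2: "f (0, l) = of_int l *\<^sub>R f (0, 1)" for l
  proof (induction l rule: int_induct[of _ 0])
    case base show ?case by (simp add: f0)
  next
    case (step1 i) then show ?case using f[of "(0, i)" "(0, 1)"] by (simp add: scaleR_add_left)
  next
    case (step2 i) then show ?case using f[of "(0, i - 1)" "(0, 1)"] by (simp add: scaleR_diff_left)
  qed
  have "f (k, l) = f (k, 0) + f (0, l)" using f[of "(k, 0)" "(0, l)"] by simp
  then show ?thesis unfolding 1[of k] 2[of l] .
qed

text \<open>If the images of the two generators were dependent, infinitely many integer combinations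
  of them would fall into one ball, contrary to discreteness and injectivity.\<close>

lemma discrete_subgroup_rank_2:
  fixes f :: "int \<times> int \<Rightarrow> real \<times> real"
  assumes L: "discrete_subgroup L" and f: "\<And>x y. f (x + y) = f x + f y" "inj f" "range f \<subseteq> L"
  obtains u v where "u \<in> L" "v \<in> L" "cross u v \<noteq> 0"
proof -
  let ?u = "f (1, 0)" and ?v = "f (0, 1)"
  have lin: "f (k, l) = of_int k *\<^sub>R ?u + of_int l *\<^sub>R ?v" for k l
    by (rule additive_int_pair) (rule f(1))
  have "cross ?u ?v \<noteq> 0"
  proof
    assume c: "cross ?u ?v = 0"
    have "f (0, 0) = 0" using lin[of 0 0] by simp
    then have "?u \<noteq> 0" using injD[OF f(2), of "(1, 0)" "(0, 0)"] by auto
    then obtain r where r: "?v = r *\<^sub>R ?u" using cross_eq_0_imp[OF c] by blast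
    \<comment> \<open>With v = r u, the floor reduces l v modulo u to the fractional part of l r
      times u, which is no longer than u.\<close>
    define X where "X l = f (- \<lfloor>of_int l * r\<rfloor>, l)" for l :: int
    have "inj X" using f(2) by (auto simp: X_def inj_def)
    have "X l \<in> L \<inter> cball 0 (norm ?u)" for l
    proof -
      have "X l = of_int (- \<lfloor>of_int l * r\<rfloor>) *\<^sub>R ?u + of_int l *\<^sub>R ?v"
        unfolding X_def by (rule lin)
      also have "\<dots> = (of_int l * r - of_int \<lfloor>of_int l * r\<rfloor>) *\<^sub>R ?u"
        unfolding r by (simp add: algebra_simps)
      finally have "X l = (of_int l * r - of_int \<lfloor>of_int l * r\<rfloor>) *\<^sub>R ?u" .
      moreover have "\<bar>of_int l * r - of_int \<lfloor>of_int l * r\<rfloor>\<bar> \<le> 1" by linarith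
      ultimately have "norm (X l) \<le> norm ?u" by (simp add: mult_left_le_one_le)
      then show ?thesis using f(3) by (auto simp: X_def)
    qed
    then have "range X \<subseteq> L \<inter> cball 0 (norm ?u)" by blast
    then have "finite (range X)" using discrete_subgroup_finite[OF L] finite_subset by blast
    then show False using \<open>inj X\<close> finite_imageD by fastforce
  qed
  then show ?thesis using f(3) by (intro that[of ?u ?v]) auto
qed

text \<open>In a basis of L, the map diag(\<alpha>, \<beta>) and its inverse have integer matrices,
  so the determinant is a unit of the integers; being positive, it is 1.\<close>

lemma lattice_diagonal_det:
  fixes L :: "(real \<times> real) set"
  assumes L: "discrete_subgroup L" and uv: "u \<in> L" "v \<in> L" "cross u v \<noteq> 0"
    and pos: "\<alpha> * \<beta> > 0"
    and inv: "\<And>x y. (x, y) \<in> L \<Longrightarrow> (\<alpha> * x, \<beta> * y) \<in> L"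
      "\<And>x y. (x, y) \<in> L \<Longrightarrow> (inverse \<alpha> * x, inverse \<beta> * y) \<in> L"
  shows "\<alpha> * \<beta> = 1"
proof -
  obtain a b where ab: "a \<in> L" "b \<in> L" "cross a b \<noteq> 0"
    "\<And>w. w \<in> L \<Longrightarrow> \<exists>k l::int. w = of_int k *\<^sub>R a + of_int l *\<^sub>R b"
    using lattice_basis[OF L uv] by blast
  have int: "\<exists>m::int. \<gamma> * \<delta> = of_int m"
    if \<gamma>: "\<And>x y. (x, y) \<in> L \<Longrightarrow> (\<gamma> * x, \<delta> * y) \<in> L" for \<gamma> \<delta>
  proof -
    have "\<exists>k l::int. (\<gamma> * fst a, \<delta> * snd a) = of_int k *\<^sub>R a + of_int l *\<^sub>R b"
      "\<exists>k l::int. (\<gamma> * fst b, \<delta> * snd b) = of_int k *\<^sub>R a + of_int l *\<^sub>R b"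
      using ab \<gamma> by simp_all
    then obtain k l k' l' :: int where
      *: "(\<gamma> * fst a, \<delta> * snd a) = of_int k *\<^sub>R a + of_int l *\<^sub>R b"
         "(\<gamma> * fst b, \<delta> * snd b) = of_int k' *\<^sub>R a + of_int l' *\<^sub>R b" by blast
    have "\<gamma> * \<delta> * cross a b = cross (\<gamma> * fst a, \<delta> * snd a) (\<gamma> * fst b, \<delta> * snd b)"
      by (simp add: cross_def algebra_simps)
    also have "\<dots> = of_int (k * l' - l * k') * cross a b"
      unfolding * by (simp add: cross_def algebra_simps)
    finally have "\<gamma> * \<delta> = of_int (k * l' - l * k')" using ab(3) by (simp only: mult_cancel_right) simp
    then show ?thesis by blast
  qed
  obtain m where m: "\<alpha> * \<beta> = of_int m" using int[of \<alpha> \<beta>] inv(1) by blast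
  obtain n where n: "inverse \<alpha> * inverse \<beta> = of_int n" using int[of "inverse \<alpha>" "inverse \<beta>"] inv(2) by blast
  have "(\<alpha> * \<beta>) * (inverse \<alpha> * inverse \<beta>) = 1" using pos by (auto simp: field_simps)
  then have "m * n = 1" unfolding m n by (metis of_int_eq_1_iff of_int_mult)
  moreover have "m > 0" using pos m by simp
  ultimately have "m = 1" using pos_zmult_eq_1_iff by blast
  then show ?thesis using m by simp
qed

text \<open>If L lay on a line, a nonzero linear functional would vanish on L and be bounded on K,
  hence bounded on the whole plane.\<close>

lemma cocompact_imp_independent:
  assumes K: "bounded K" and cov: "\<And>x. \<exists>y\<in>L. x - y \<in> K"
  obtains u v where "u \<in> L" "v \<in> L" "cross u v \<noteq> 0"
proof (rule ccontr)
  assume "\<not> thesis"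
  then have dep: "\<And>u v. u \<in> L \<Longrightarrow> v \<in> L \<Longrightarrow> cross u v = 0" using that by blast
  obtain u where u: "u \<noteq> 0" "\<And>v. v \<in> L \<Longrightarrow> cross u v = 0"
  proof (cases "L \<subseteq> {0}")
    case True then show ?thesis by (intro that[of "(1, 0)"]) (auto simp: cross_def zero_prod_def)
  next
    case False then show ?thesis using dep that by blast
  qed
  have "\<exists>w. cross u w \<noteq> 0"
  proof (cases "fst u = 0")
    case True then show ?thesis using u(1) by (intro exI[of _ "(1, 0)"]) (auto simp: cross_def prod_eq_iff)
  next
    case False then show ?thesis by (intro exI[of _ "(0, 1)"]) (auto simp: cross_def)
  qed
  then obtain w where w: "cross u w \<noteq> 0" ..
  obtain B where B: "\<And>x. x \<in> K \<Longrightarrow> norm x \<le> B" using K by (auto simp: bounded_iff)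
  have bound: "\<bar>cross u x\<bar> \<le> 2 * norm u * norm x" for x
  proof -
    have "\<bar>cross u x\<bar> \<le> \<bar>fst u\<bar> * \<bar>snd x\<bar> + \<bar>snd u\<bar> * \<bar>fst x\<bar>"
      unfolding cross_def by (metis abs_mult abs_triangle_ineq4)
    also have "\<dots> \<le> norm u * norm x + norm u * norm x"
      using norm_fst_le[of "fst u" "snd u"] norm_snd_le[of "snd u" "fst u"]
        norm_fst_le[of "fst x" "snd x"] norm_snd_le[of "snd x" "fst x"]
      by (intro add_mono mult_mono) auto
    finally show ?thesis by simp
  qed
  \<comment> \<open>Chosen so that the functional \<open>cross u\<close> takes at s w a value
    exceeding by 1 its bound on K.\<close>
  define s where "s = (2 * norm u * B + 1) / cross u w"
  obtain y where y: "y \<in> L" "s *\<^sub>R w - y \<in> K" using cov by blast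
  have "2 * norm u * B + 1 = cross u (s *\<^sub>R w - y)"
    using w u(2)[OF y(1)] by (simp add: cross_diff_right cross_scaleR_right s_def)
  also have "\<dots> \<le> 2 * norm u * norm (s *\<^sub>R w - y)" using bound[of "s *\<^sub>R w - y"] by linarith
  also have "\<dots> \<le> 2 * norm u * B" using B[OF y(2)] by (intro mult_left_mono) auto
  finally show False by simp
qed

text \<open>Among the vectors u + k v, each line through the origin contains at most one, because
  two of them are independent. Four lines have to be avoided.\<close>

lemma lattice_avoids_lines:
  assumes L: "discrete_subgroup L" and uv: "u \<in> L" "v \<in> L" "cross u v \<noteq> 0"
  obtains x :: "real \<times> real" where "x \<in> L" "fst x \<noteq> 0" "snd x \<noteq> 0" "\<bar>fst x\<bar> \<noteq> \<bar>snd x\<bar>"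
proof -
  \<comment> \<open>The indices k for which u + k v lies on the line p x + q y = 0; the pairs (1,0),
    (0,1), (1,1) and (1,-1) give the axes and the diagonals.\<close>
  define bad where "bad p q = {k::nat. p * fst (u + real k *\<^sub>R v) + q * snd (u + real k *\<^sub>R v) = 0}" for p q
  have fin: "finite (bad p q)" (is "finite ?B") if pq: "p \<noteq> 0 \<or> q \<noteq> 0" for p q :: real
  proof -
    have "k = l" if "k \<in> ?B" "l \<in> ?B" for k l
    proof (rule ccontr)
      assume "k \<noteq> l"
      have *: "(p * fst u + q * snd u) + real k * (p * fst v + q * snd v) = 0"
        "(p * fst u + q * snd u) + real l * (p * fst v + q * snd v) = 0"
        using that by (simp_all add: bad_def algebra_simps)
      then have "(real k - real l) * (p * fst v + q * snd v) = 0" by (simp add: algebra_simps)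
      then have v: "p * fst v + q * snd v = 0" using \<open>k \<noteq> l\<close> by simp
      then have u: "p * fst u + q * snd u = 0" using *(1) by simp
      have "p * cross u v = snd v * (p * fst u + q * snd u) - snd u * (p * fst v + q * snd v)"
        "q * cross u v = fst u * (p * fst v + q * snd v) - fst v * (p * fst u + q * snd u)"
        by (simp_all add: cross_def algebra_simps)
      then have "p * cross u v = 0" "q * cross u v = 0" unfolding u v by simp_all
      then show False using pq uv(3) by simp
    qed
    then have sub: "?B \<subseteq> {k}" if "k \<in> ?B" for k using that by blast
    show ?thesis
    proof (cases "?B = {}")
      case True then show ?thesis by (simp only: finite.emptyI)
    next
      case False
      then obtain k where "k \<in> ?B" by blast
      then show ?thesis by (rule finite_subset[OF sub]) simp
    qed
  qed
  have "finite (bad 1 0 \<union> bad 0 1 \<union> bad 1 1 \<union> bad 1 (-1))"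
    by (intro finite_UnI fin) simp_all
  then have "\<exists>k. k \<notin> bad 1 0 \<union> bad 0 1 \<union> bad 1 1 \<union> bad 1 (-1)"
    by (rule ex_new_if_finite[OF infinite_UNIV_nat])
  then obtain k where k: "k \<notin> bad 1 0 \<union> bad 0 1 \<union> bad 1 1 \<union> bad 1 (-1)" ..
  show ?thesis
  proof (rule that)
    have "of_int (int k) *\<^sub>R v \<in> L" by (rule discrete_subgroup_scaleR_int) fact+
    then show "u + real k *\<^sub>R v \<in> L" using discrete_subgroup_plus[OF L uv(1)] by simp
    show "fst (u + real k *\<^sub>R v) \<noteq> 0" "snd (u + real k *\<^sub>R v) \<noteq> 0"
      "\<bar>fst (u + real k *\<^sub>R v)\<bar> \<noteq> \<bar>snd (u + real k *\<^sub>R v)\<bar>"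
      using k by (auto simp: bad_def)
  qed
qed

section \<open>Short elements of discrete groups containing a diagonal element\<close>

lemma mat_of_minus: "mat_of (s - t) = mat_of s ** adj2 (mat_of t)"
  by (simp only: minus_sl2_def mat_of_plus mat_of_uminus)

lemma matrix_mult_2_distrib:
  fixes A B C :: "real^2^2"
  shows "(A + B) ** C = A ** C + B ** C" "C ** (A + B) = C ** A + C ** B"
    "(A - B) ** C = A ** C - B ** C"
  by (auto intro!: mat2_eqI simp: matrix_mult_2_nth algebra_simps)

definition dg1 :: "real \<Rightarrow> sl2" where
  "dg1 t = Sl2 (mat2 (exp t) 0 0 (exp (- t)))"

lemma mat_of_dg1: "mat_of (dg1 t) = mat2 (exp t) 0 0 (exp (- t))"
  by (simp add: dg1_def mat_of_Sl2 det_2 flip: exp_add)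

lemma dg1_add: "dg1 (s + t) = dg1 s + dg1 t"
  by (intro sl2_eqI') (simp_all add: mat_of_dg1 mat_of_plus matrix_mult_2_nth flip: exp_add)

lemma dg1_0: "dg1 0 = 0"
  by (intro sl2_eqI') (simp_all add: mat_of_dg1 mat_of_0)

lemma dg1_uminus: "dg1 (- t) = - dg1 t"
  by (intro sl2_eqI') (simp_all add: mat_of_dg1 mat_of_uminus)

lemma dg1_eq_iff: "dg1 s = dg1 t \<longleftrightarrow> s = t"
  by (metis mat_of_dg1 mat2_nth(1) exp_inj_iff)

lemma continuous_on_dg1 [continuous_intros]:
  "continuous_on A f \<Longrightarrow> continuous_on A (\<lambda>x. dg1 (f x))"
  unfolding continuous_on_sl2_iff mat_of_dg1
  by (intro continuous_on_mat2I) (auto intro!: continuous_intros)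

text \<open>Logarithmic coordinates on the diagonal group: its discrete subgroups become discrete
  subgroups of the plane.\<close>

definition dg :: "real \<times> real \<Rightarrow> sl2 \<times> sl2" where
  "dg t = (dg1 (fst t), dg1 (snd t))"

lemma dg_add: "dg (s + t) = dg s + dg t"
  and dg_0: "dg 0 = 0"
  and dg_uminus: "dg (- t) = - dg t"
  by (simp_all add: dg_def dg1_add dg1_0 dg1_uminus plus_prod_def zero_prod_def uminus_prod_def)

lemma dg_diff: "dg (s - t) = dg s - dg t"
  using dg_add[of s "- t"] by (simp add: dg_uminus)

lemma dg_eq_iff: "dg s = dg t \<longleftrightarrow> s = t"
  by (simp add: dg_def dg1_eq_iff prod_eq_iff)

lemma continuous_on_dg [continuous_intros]:
  "continuous_on A f \<Longrightarrow> continuous_on A (\<lambda>x. dg (f x))"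
  unfolding dg_def by (intro continuous_intros)

lemma discrete_subgroup_dg:
  "discrete_subgroup E \<Longrightarrow> discrete_subgroup (dg -` E)"
  by (rule discrete_subgroup_vimage) (auto intro!: continuous_intros simp: inj_def dg_eq_iff dg_diff)

definition unip :: "bool \<Rightarrow> real \<Rightarrow> sl2" where
  "unip \<sigma> y = (if \<sigma> then upper y else lower y)"

text \<open>The sign of the root: conjugation by \<open>dg1 t\<close> multiplies the parameter of
  \<open>unip \<sigma>\<close> by exp(2 * sg \<sigma> * t), see \<open>conj_unip\<close>.\<close>

definition sg :: "bool \<Rightarrow> real" where
  "sg \<sigma> = (if \<sigma> then 1 else - 1)"

lemma mat_of_unip: "mat_of (unip \<sigma> y) = (if \<sigma> then mat2 1 y 0 1 else mat2 1 0 y 1)"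
  by (simp add: unip_def mat_of_upper mat_of_lower)

lemma unip_diff: "unip \<sigma> (x - y) = unip \<sigma> x - unip \<sigma> y"
  by (intro sl2_eqI') (simp_all add: mat_of_unip mat_of_minus matrix_mult_2_nth)

lemma unip_eq_iff: "unip \<sigma> x = unip \<sigma> y \<longleftrightarrow> x = y"
  by (metis mat_of_unip mat2_nth(2,3))

lemma continuous_on_unip [continuous_intros]:
  "continuous_on A f \<Longrightarrow> continuous_on A (\<lambda>x. unip \<sigma> (f x))"
  unfolding continuous_on_sl2_iff mat_of_unip
  by (cases \<sigma>) (auto intro!: continuous_on_mat2I)

lemma conj_unip: "dg1 t + unip \<sigma> y - dg1 t = unip \<sigma> (exp (2 * (sg \<sigma> * t)) * y)"
  by (intro sl2_eqI')
    (simp_all add: mat_of_unip mat_of_plus mat_of_minus mat_of_dg1 matrix_mult_2_nth sg_def mult_ac flip: exp_add)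

lemma diag_eq_dg1:
  assumes "mat_of s $1$2 = 0" "mat_of s $2$1 = 0" "mat_of s $1$1 > 0"
  shows "s = dg1 (ln (mat_of s $1$1))"
proof -
  have "mat_of s $1$1 * mat_of s $2$2 = 1" using det_mat_of[of s] assms by (simp add: det_2)
  then have "mat_of s $2$2 = inverse (mat_of s $1$1)" using assms(3) by (simp add: field_simps)
  then show ?thesis using assms by (intro sl2_eqI') (simp_all add: mat_of_dg1 exp_minus)
qed

text \<open>\<open>dg1 t\<close> has two distinct eigenvalues, so its centraliser is diagonal; the
  sign condition excludes the negatives of the matrices \<open>dg1 c\<close>.\<close>

lemma commute_dg1:
  assumes "t \<noteq> 0" "dg1 t + s = s + dg1 t" "mat_of s $1$1 > 0"
  shows "s = dg1 (ln (mat_of s $1$1))"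
proof (rule diag_eq_dg1)
  have eq: "mat_of (dg1 t + s) = mat_of (s + dg1 t)" using assms(2) by simp
  have "exp t * mat_of s $1$2 = mat_of s $1$2 * exp (- t)"
    using arg_cong[OF eq, of "\<lambda>M. M$1$2"] by (simp add: mat_of_plus mat_of_dg1 matrix_mult_2_nth)
  then have "(exp t - exp (- t)) * mat_of s $1$2 = 0" by (simp add: algebra_simps)
  then show "mat_of s $1$2 = 0" using assms(1) by simp
  have "exp (- t) * mat_of s $2$1 = mat_of s $2$1 * exp t"
    using arg_cong[OF eq, of "\<lambda>M. M$2$1"] by (simp add: mat_of_plus mat_of_dg1 matrix_mult_2_nth)
  then have "(exp (- t) - exp t) * mat_of s $2$1 = 0" by (simp add: algebra_simps)
  then show "mat_of s $2$1 = 0" using assms(1) by simp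
qed (rule assms)

text \<open>Conjugation multiplies b by q = exp(2 t) and c by 1/q and fixes a and d. Comparing
  entries of the two products gives b c = 0, b (a - d) = 0 and c (a - d) = 0. Positivity of a rules
  out a = d = -1.\<close>

lemma commute_conj_cases:
  assumes t: "t \<noteq> 0" and comm: "s + (dg1 t + s - dg1 t) = (dg1 t + s - dg1 t) + s"
    and pos: "mat_of s $1$1 > 0"
  obtains c where "s = dg1 c" | \<sigma> y where "s = unip \<sigma> y" "y \<noteq> 0"
proof -
  define a b c d where "a = mat_of s $1$1" and "b = mat_of s $1$2" and "c = mat_of s $2$1" and "d = mat_of s $2$2"
  define q where "q = exp (2 * t)"
  have q: "q > 0" "q \<noteq> 1" using t by (simp_all add: q_def)
  have det: "a * d - b * c = 1" using det_mat_of[of s] by (simp add: det_2 a_def b_def c_def d_def)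
  define s' where "s' = dg1 t + s - dg1 t"
  have "exp (t * 2) = exp t * exp t" by (simp flip: exp_add)
  then have s': "mat_of s' $1$1 = a" "mat_of s' $1$2 = q * b" "mat_of s' $2$1 = c / q" "mat_of s' $2$2 = d"
    unfolding s'_def
    by (simp_all add: mat_of_plus mat_of_minus mat_of_dg1 matrix_mult_2_nth a_def b_def c_def d_def q_def
        exp_minus field_simps exp_double power2_eq_square)
  have eq: "mat_of (s + s') = mat_of (s' + s)" using comm by (simp add: s'_def)
  have "b * (c / q) = q * b * c"
    using arg_cong[OF eq, of "\<lambda>M. M$1$1"] s' by (simp add: mat_of_plus matrix_mult_2_nth a_def b_def c_def d_def)
  then have "(q - 1) * (q + 1) * (b * c) = 0" using q by (simp add: field_simps)
  then have bc: "b = 0 \<or> c = 0" using q by simp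
  have "a * (q * b) + b * d = a * b + q * b * d"
    using arg_cong[OF eq, of "\<lambda>M. M$1$2"] s' by (simp add: mat_of_plus matrix_mult_2_nth a_def b_def c_def d_def)
  then have "(q - 1) * (b * (a - d)) = 0" by (simp add: algebra_simps)
  then have bd: "b = 0 \<or> a = d" using q by simp
  have "c * a + d * (c / q) = c / q * a + d * c"
    using arg_cong[OF eq, of "\<lambda>M. M$2$1"] s' by (simp add: mat_of_plus matrix_mult_2_nth a_def b_def c_def d_def)
  then have "(q - 1) * (c * (a - d)) = 0" using q by (simp add: field_simps)
  then have cd: "c = 0 \<or> a = d" using q by simp
  consider "b = 0" "c = 0" | "b \<noteq> 0" "c = 0" "a = d" | "b = 0" "c \<noteq> 0" "a = d"
    using bc bd cd by blast
  then show ?thesis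
  proof cases
    case 1
    then show ?thesis using pos diag_eq_dg1 that(1) by (metis b_def c_def)
  next
    case 2
    then have "a = 1" using det pos by (simp add: a_def flip: power2_eq_square) (metis power2_eq_1_iff less_numeral_extra(1) neg_0_less_iff_less not_less_iff_gr_or_eq)
    then have "s = unip True b"
      using 2 by (intro sl2_eqI') (simp_all add: mat_of_unip a_def b_def c_def d_def)
    then show ?thesis using 2 that(2) by blast
  next
    case 3
    then have "a = 1" using det pos by (simp add: a_def flip: power2_eq_square) (metis power2_eq_1_iff less_numeral_extra(1) neg_0_less_iff_less not_less_iff_gr_or_eq)
    then have "s = unip False c"
      using 3 by (intro sl2_eqI') (simp_all add: mat_of_unip a_def b_def c_def d_def)
    then show ?thesis using 3 that(2) by blast
  qed
qed

section \<open>Quadratic estimate for commutators near the identity\<close>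

lemma norm_mat2_le:
  fixes M :: "real^2^2"
  assumes "\<And>i j. \<bar>M $ i $ j\<bar> \<le> r"
  shows "norm M \<le> 4 * r"
proof -
  have "norm (M $ i) \<le> 2 * r" for i
    using norm_le_l1_cart[of "M $ i"] assms[of i 1] assms[of i 2] by (simp add: sum_2)
  then have "(\<Sum>i\<in>UNIV. norm (M $ i)) \<le> 4 * r" using \<open>\<And>i. norm (M $ i) \<le> 2 * r\<close>[of 1] by (simp add: sum_2) (metis add_mono mult_2 numeral_Bit0 distrib_right)
  then show ?thesis
    unfolding norm_vec_def[of M] using L2_set_le_sum[of UNIV "\<lambda>i. norm (M $ i)"] by simp
qed

lemma abs_nth_le_norm:
  fixes M :: "real^2^2"
  shows "\<bar>M $ i $ j\<bar> \<le> norm M"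
  using component_le_norm_cart[of "M $ i" j] Finite_Cartesian_Product.norm_nth_le[of M i] by linarith

lemma norm_mult_2_le:
  fixes A B :: "real^2^2"
  shows "norm (A ** B) \<le> 8 * (norm A * norm B)"
proof -
  have "\<bar>(A ** B) $ i $ j\<bar> \<le> 2 * (norm A * norm B)" for i j
  proof -
    have "\<bar>A$i$k * B$k$j\<bar> \<le> norm A * norm B" for k
      unfolding abs_mult by (intro mult_mono abs_nth_le_norm) auto
    from this[of 1] this[of 2] show ?thesis unfolding matrix_mult_2_nth by linarith
  qed
  from norm_mat2_le[OF this] show ?thesis by simp
qed

lemma norm_adj2_le: "norm (adj2 M) \<le> 4 * norm M"
proof (rule norm_mat2_le)
  show "\<bar>adj2 M $ i $ j\<bar> \<le> norm M" for i j
    using abs_nth_le_norm[of M] exhaust_2[of i] exhaust_2[of j] by auto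
qed

text \<open>Write s = I + X and its conjugate s' = I + X', where X' is bounded by a multiple of X.
  The linear terms cancel in s s' - s' s = X X' - X' X, which is therefore quadratic in X.\<close>

lemma commutator_bound:
  obtains K where "K > 0"
    "\<And>s. dist s 0 \<le> 1 \<Longrightarrow> dist (s + (dg1 t + s - dg1 t) - s - (dg1 t + s - dg1 t)) 0 \<le> K * (dist s 0)\<^sup>2"
proof -
  define I :: "real^2^2" where "I = mat 1"
  \<comment> \<open>64 = 8 * 8 comes from two uses of \<open>norm_mult_2_le\<close>. In K, the
    factor 16 * \<kappa> bounds the difference of products, and the last two factors bound the
    inverses of s and s'.\<close>
  define \<kappa> where "\<kappa> = 64 * (norm (mat_of (dg1 t)) * norm (mat_of (- dg1 t)))"
  define K where "K = 64 * (16 * \<kappa>) * (4 * (1 + norm I)) * (4 * (\<kappa> + norm I))"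
  have \<kappa>: "\<kappa> \<ge> 0" by (simp add: \<kappa>_def)
  have *: "dist (s + (dg1 t + s - dg1 t) - s - (dg1 t + s - dg1 t)) 0 \<le> K * (dist s 0)\<^sup>2"
    if s: "dist s 0 \<le> 1" for s
  proof -
    define s' where "s' = dg1 t + s - dg1 t"
    define X X' where "X = mat_of s - I" and "X' = mat_of s' - I"
    have X: "norm X = dist s 0" by (simp add: X_def I_def dist_sl2_def mat_of_0 dist_norm)
    have S: "mat_of s = I + X" "mat_of s' = I + X'" by (simp_all add: X_def X'_def)
    have I: "I ** A = A" "A ** I = A" for A by (simp_all add: I_def)
    have r: "mat_of u ** mat_of (- u) = I" for u
      using mat_of_plus[of u "- u"] by (simp add: mat_of_0 I_def)
    have "mat_of s' = mat_of (dg1 t) ** (I + X) ** mat_of (- dg1 t)"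
      by (simp only: s'_def mat_of_minus mat_of_uminus mat_of_plus S(1)[symmetric])
    then have "X' = mat_of (dg1 t) ** X ** mat_of (- dg1 t)"
      by (simp add: X'_def matrix_mult_2_distrib I r)
    then have "norm X' \<le> 8 * (8 * (norm (mat_of (dg1 t)) * norm X) * norm (mat_of (- dg1 t)))"
      using norm_mult_2_le[of "mat_of (dg1 t) ** X" "mat_of (- dg1 t)"]
        mult_right_mono[OF norm_mult_2_le[of "mat_of (dg1 t)" X], of "norm (mat_of (- dg1 t))"] by simp
    then have X': "norm X' \<le> \<kappa> * norm X" by (simp add: \<kappa>_def mult_ac)
    have X'1: "norm X' \<le> \<kappa>" using X' s X \<kappa> by (smt (verit) mult_left_le)
    let ?C = "mat_of s ** mat_of s' - mat_of s' ** mat_of s"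
    have C: "?C = X ** X' - X' ** X"
      by (simp add: S matrix_mult_2_distrib I)
    have "norm (X ** X') \<le> 8 * \<kappa> * (norm X)\<^sup>2" "norm (X' ** X) \<le> 8 * \<kappa> * (norm X)\<^sup>2"
      using norm_mult_2_le[of X X'] norm_mult_2_le[of X' X] mult_right_mono[OF X', of "norm X"]
      by (simp_all add: power2_eq_square mult_ac)
    then have nC: "norm ?C \<le> 16 * \<kappa> * (norm X)\<^sup>2"
      unfolding C using norm_triangle_ineq4[of "X ** X'" "X' ** X"] by linarith
    have a: "norm (adj2 (mat_of s)) \<le> 4 * (1 + norm I)"
      using norm_adj2_le[of "mat_of s"] norm_triangle_ineq[of I X] s X by (simp add: S)
    have b: "norm (adj2 (mat_of s')) \<le> 4 * (\<kappa> + norm I)"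
      using norm_adj2_le[of "mat_of s'"] norm_triangle_ineq[of I X'] X'1 by (simp add: S)
    note r' = r[unfolded mat_of_uminus]
    \<comment> \<open>Multiplying s' s by the two inverses gives I, so the commutator minus I is (s
      s' - s' s) times the inverses.\<close>
    have "mat_of (s + s' - s - s') - I = ?C ** adj2 (mat_of s) ** adj2 (mat_of s')"
    proof -
      have "mat_of s' ** mat_of s ** adj2 (mat_of s) ** adj2 (mat_of s') =
          mat_of s' ** (mat_of s ** adj2 (mat_of s)) ** adj2 (mat_of s')" by (simp only: matrix_mul_assoc)
      then have "mat_of s' ** mat_of s ** adj2 (mat_of s) ** adj2 (mat_of s') = I" by (simp only: r' I)
      then show ?thesis by (simp add: mat_of_plus mat_of_minus matrix_mult_2_distrib)
    qed
    then have "dist (s + s' - s - s') 0 = norm (?C ** adj2 (mat_of s) ** adj2 (mat_of s'))"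
      by (simp add: dist_sl2_def dist_norm mat_of_0 I_def)
    also have "\<dots> \<le> 8 * (8 * (norm ?C * norm (adj2 (mat_of s))) * norm (adj2 (mat_of s')))"
      using norm_mult_2_le[of "?C ** adj2 (mat_of s)" "adj2 (mat_of s')"]
        mult_right_mono[OF norm_mult_2_le[of ?C "adj2 (mat_of s)"], of "norm (adj2 (mat_of s'))"] by simp
    also have "\<dots> \<le> 8 * (8 * ((16 * \<kappa> * (norm X)\<^sup>2) * (4 * (1 + norm I))) * (4 * (\<kappa> + norm I)))"
      using \<kappa> by (intro mult_left_mono mult_mono nC a b) (auto intro!: mult_nonneg_nonneg)
    also have "\<dots> = K * (dist s 0)\<^sup>2" by (simp add: K_def X mult_ac)
    finally show ?thesis unfolding s'_def .
  qed
  \<comment> \<open>K could be 0 as far as its formula is bounded here; K + 1 is positive.\<close>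
  have "dist (s + (dg1 t + s - dg1 t) - s - (dg1 t + s - dg1 t)) 0 \<le> (K + 1) * (dist s 0)\<^sup>2"
    if "dist s 0 \<le> 1" for s
    using add_increasing2[OF zero_le_power2 *[OF that]] by (simp only: distrib_right mult_1)
  moreover have "K \<ge> 0" using \<kappa> by (auto simp: K_def intro!: mult_nonneg_nonneg add_nonneg_nonneg)
  ultimately show ?thesis by (intro that[of "K + 1"]) auto
qed

lemma unip_not_fixed:
  assumes "\<tau> \<noteq> 0" "y \<noteq> 0"
  shows "dg1 \<tau> + unip \<sigma> y - dg1 \<tau> \<noteq> unip \<sigma> y"
  using assms by (simp add: conj_unip unip_eq_iff sg_def)

lemma conj_dg1: "dg1 r + dg1 c - dg1 r = dg1 c"
  by (metis add.commute add_diff_cancel dg1_add)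

lemma conj_unip_tendsto:
  assumes "sg \<sigma> * \<tau> < 0"
  shows "(\<lambda>n. dg1 (real n * \<tau>) + unip \<sigma> y - dg1 (real n * \<tau>)) \<longlonglongrightarrow> unip \<sigma> 0"
proof -
  have "dg1 (real n * \<tau>) + unip \<sigma> y - dg1 (real n * \<tau>) = unip \<sigma> (exp (2 * (sg \<sigma> * \<tau>)) ^ n * y)" for n
    by (simp add: conj_unip mult_ac flip: exp_of_nat_mult)
  moreover have "(\<lambda>n. exp (2 * (sg \<sigma> * \<tau>)) ^ n * y) \<longlonglongrightarrow> 0"
    using assms by (intro tendsto_mult_left_zero LIMSEQ_realpow_zero) (simp_all add: mult.commute)
  then have "(\<lambda>n. unip \<sigma> (exp (2 * (sg \<sigma> * \<tau>)) ^ n * y)) \<longlonglongrightarrow> unip \<sigma> 0"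
    by (rule continuous_on_tendsto_compose[OF continuous_on_unip[OF continuous_on_id[of UNIV]]]) simp_all
  ultimately show ?thesis by simp
qed

text \<open>Conjugates by powers of \<open>dg t\<close> that converge must be constant, by discreteness.\<close>

lemma conj_convergent_imp_fixed:
  assumes E: "discrete_subgroup E" "dg t \<in> E" "\<delta> \<in> E"
    and lim: "(\<lambda>n. dg (real n *\<^sub>R t) + \<delta> - dg (real n *\<^sub>R t)) \<longlonglongrightarrow> l"
  shows "dg t + \<delta> - dg t = \<delta>"
proof -
  have mem: "dg (real n *\<^sub>R t) \<in> E" for n
    using discrete_subgroup_scaleR_int[OF discrete_subgroup_dg[OF E(1)], of t "int n"] E(2) by simp
  have "eventually (\<lambda>n. dg (real (Suc n) *\<^sub>R t) + \<delta> - dg (real (Suc n) *\<^sub>R t) =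
      dg (real n *\<^sub>R t) + \<delta> - dg (real n *\<^sub>R t)) sequentially"
    using E(3) mem by (intro discrete_subgroup_eventually_const[OF E(1) _ lim]
        discrete_subgroup_diff[OF E(1)] discrete_subgroup_plus[OF E(1)])
  then obtain n where n: "dg (real (Suc n) *\<^sub>R t) + \<delta> - dg (real (Suc n) *\<^sub>R t) =
      dg (real n *\<^sub>R t) + \<delta> - dg (real n *\<^sub>R t)"
    by (auto simp: eventually_sequentially)
  have "real (Suc n) *\<^sub>R t = real n *\<^sub>R t + t" by (simp add: scaleR_add_left add.commute)
  then have "dg (real (Suc n) *\<^sub>R t) = dg (real n *\<^sub>R t) + dg t" by (simp only: dg_add)
  then have "dg (real n *\<^sub>R t) + (dg t + \<delta> - dg t) - dg (real n *\<^sub>R t) =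
      dg (real n *\<^sub>R t) + \<delta> - dg (real n *\<^sub>R t)"
    using n by (simp only: diff_conv_add_uminus minus_add add.assoc)
  then show ?thesis by (metis add_left_cancel diff_add_cancel)
qed

definition diag_or_unip :: "sl2 \<Rightarrow> bool" where
  "diag_or_unip s \<longleftrightarrow> (\<exists>c. s = dg1 c) \<or> (\<exists>\<sigma> y. s = unip \<sigma> y \<and> y \<noteq> 0)"

text \<open>A unipotent component is never fixed by a, so convergence of the conjugates is
  contradictory. This settles every case in which a or its inverse contracts all unipotent
  components; only opposite behaviour of two unipotent components remains.\<close>

lemma discrete_diag_or_unip_imp_diag:
  assumes E: "discrete_subgroup E" "dg t \<in> E" "\<delta> \<in> E"
    and t: "fst t \<noteq> 0" "snd t \<noteq> 0" "\<bar>fst t\<bar> \<noteq> \<bar>snd t\<bar>"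
    and \<delta>: "diag_or_unip (fst \<delta>)" "diag_or_unip (snd \<delta>)"
  shows "\<exists>c. \<delta> = dg c"
proof -
  \<comment> \<open>Used with s' = t and with s' = - t. Diagonal components are fixed under
    conjugation and so do not disturb convergence.\<close>
  have contr: "\<exists>c. s = dg1 c" if s':
    "dg s' \<in> E" "fst s' \<noteq> 0" "snd s' \<noteq> 0"
    "(\<exists>c. fst \<delta> = dg1 c) \<or> (\<exists>\<sigma> y. fst \<delta> = unip \<sigma> y \<and> y \<noteq> 0 \<and> sg \<sigma> * fst s' < 0)"
    "(\<exists>c. snd \<delta> = dg1 c) \<or> (\<exists>\<sigma> y. snd \<delta> = unip \<sigma> y \<and> y \<noteq> 0 \<and> sg \<sigma> * snd s' < 0)"
    "s = fst \<delta> \<or> s = snd \<delta>" for s' s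
  proof -
    have conv: "\<exists>l. (\<lambda>n. dg1 (real n * \<tau>) + r - dg1 (real n * \<tau>)) \<longlonglongrightarrow> l"
      if "(\<exists>c. r = dg1 c) \<or> (\<exists>\<sigma> y. r = unip \<sigma> y \<and> y \<noteq> 0 \<and> sg \<sigma> * \<tau> < 0)" for r \<tau>
      using that conj_unip_tendsto by (fastforce simp: conj_dg1)
    obtain l1 l2 where
      "(\<lambda>n. dg1 (real n * fst s') + fst \<delta> - dg1 (real n * fst s')) \<longlonglongrightarrow> l1"
      "(\<lambda>n. dg1 (real n * snd s') + snd \<delta> - dg1 (real n * snd s')) \<longlonglongrightarrow> l2"
      using conv[of "fst \<delta>"] conv[of "snd \<delta>"] s'(4,5) by meson
    then have "(\<lambda>n. dg (real n *\<^sub>R s') + \<delta> - dg (real n *\<^sub>R s')) \<longlonglongrightarrow> (l1, l2)"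
      by (simp add: dg_def plus_prod_def minus_prod_def tendsto_Pair)
    then have "dg s' + \<delta> - dg s' = \<delta>" by (rule conj_convergent_imp_fixed[OF E(1) s'(1) E(3)])
    then have "dg1 (fst s') + fst \<delta> - dg1 (fst s') = fst \<delta>"
      "dg1 (snd s') + snd \<delta> - dg1 (snd s') = snd \<delta>"
      by (simp_all add: dg_def prod_eq_iff)
    then show ?thesis using s'(2-6) by (metis unip_not_fixed)
  qed
  have mt: "dg (- t) \<in> E" unfolding dg_uminus by (rule discrete_subgroup_uminus[OF E(1,2)])
  have mt_nz: "fst (- t) \<noteq> 0" "snd (- t) \<noteq> 0" using t by simp_all
  have nz: "sg \<sigma> * fst t \<noteq> 0" "sg \<sigma> * snd t \<noteq> 0" for \<sigma> using t by (auto simp: sg_def)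
  consider (dd) c d where "fst \<delta> = dg1 c" "snd \<delta> = dg1 d"
    | (du) c \<sigma> y where "fst \<delta> = dg1 c" "snd \<delta> = unip \<sigma> y" "y \<noteq> 0"
    | (ud) \<sigma> y c where "fst \<delta> = unip \<sigma> y" "y \<noteq> 0" "snd \<delta> = dg1 c"
    | (uu) \<sigma> y \<sigma>' y' where "fst \<delta> = unip \<sigma> y" "y \<noteq> 0" "snd \<delta> = unip \<sigma>' y'" "y' \<noteq> 0"
    using \<delta> unfolding diag_or_unip_def by blast
  then show ?thesis
  proof cases
    case dd
    then show ?thesis by (intro exI[of _ "(c, d)"]) (simp add: dg_def prod_eq_iff)
  next
    case du
    have "sg \<sigma> * snd t < 0 \<or> sg \<sigma> * snd (- t) < 0" using nz(2)[of \<sigma>] unfolding neq_iff by auto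
    then have "\<exists>c. snd \<delta> = dg1 c"
      using contr[OF E(2) t(1,2), of "snd \<delta>"] contr[OF mt mt_nz, of "snd \<delta>"] du by blast
    then show ?thesis using du by (auto intro!: exI[of _ "(c, _)"] simp: dg_def prod_eq_iff)
  next
    case ud
    have "sg \<sigma> * fst t < 0 \<or> sg \<sigma> * fst (- t) < 0" using nz(1)[of \<sigma>] unfolding neq_iff by auto
    then have "\<exists>c. fst \<delta> = dg1 c"
      using contr[OF E(2) t(1,2), of "fst \<delta>"] contr[OF mt mt_nz, of "fst \<delta>"] ud by blast
    then show ?thesis using ud by (auto intro!: exI[of _ "(_, c)"] simp: dg_def prod_eq_iff)
  next
    case uu
    \<comment> \<open>Half the exponents by which conjugation by \<open>dg t\<close> scales the two
      unipotent components.\<close>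
    define \<rho> \<rho>' where "\<rho> = sg \<sigma> * fst t" and "\<rho>' = sg \<sigma>' * snd t"
    have abs: "\<bar>\<rho>\<bar> = \<bar>fst t\<bar>" "\<bar>\<rho>'\<bar> = \<bar>snd t\<bar>" by (auto simp: \<rho>_def \<rho>'_def sg_def)
    consider "\<rho> < 0" "\<rho>' < 0" | "\<rho> > 0" "\<rho>' > 0" | "\<rho> * \<rho>' < 0"
      using nz[of \<sigma>] nz[of \<sigma>'] by (metis \<rho>_def \<rho>'_def linorder_neqE_linordered_idom mult_less_0_iff)
    then show ?thesis
    proof cases
      case 1
      have "\<exists>c. fst \<delta> = dg1 c" "\<exists>c. snd \<delta> = dg1 c"
        using contr[OF E(2) t(1,2)] 1 uu unfolding \<rho>_def \<rho>'_def by blast+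
      then show ?thesis by (auto intro!: exI[of _ "(_, _)"] simp: dg_def prod_eq_iff)
    next
      case 2
      then have *: "sg \<sigma> * fst (- t) < 0" "sg \<sigma>' * snd (- t) < 0"
        by (simp_all add: \<rho>_def \<rho>'_def)
      have "\<exists>c. fst \<delta> = dg1 c" "\<exists>c. snd \<delta> = dg1 c"
        using contr[OF mt mt_nz] * uu by blast+
      then show ?thesis by (auto intro!: exI[of _ "(_, _)"] simp: dg_def prod_eq_iff)
    next
      case 3
      \<comment> \<open>The plane of unipotent elements of the types of \<open>\<delta>\<close>;
        conjugation by \<open>dg t\<close> acts on it diagonally and preserves its intersection with
        E.\<close>
      define f where "f v = (unip \<sigma> (fst v), unip \<sigma>' (snd v))" for v :: "real \<times> real"
      define V where "V = f -` E"
      have V: "discrete_subgroup V"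
        unfolding V_def
      proof (rule discrete_subgroup_vimage[OF E(1)])
        show "continuous_on UNIV f" unfolding f_def by (intro continuous_intros)
        show "inj f" by (auto simp: inj_def f_def unip_eq_iff)
        show "f (x - y) = f x - f y" for x y by (simp add: f_def unip_diff)
      qed
      have conj: "(exp (2 * (sg \<sigma> * fst s)) * x, exp (2 * (sg \<sigma>' * snd s)) * z) \<in> V"
        if "dg s \<in> E" "(x, z) \<in> V" for s x z
      proof -
        have "dg s + f (x, z) - dg s \<in> E"
          using that unfolding V_def
          by (intro discrete_subgroup_diff[OF E(1)] discrete_subgroup_plus[OF E(1)]) auto
        then show ?thesis by (simp add: V_def f_def dg_def conj_unip)
      qed
      have mem: "(y, y') \<in> V" using E(3) uu by (simp add: V_def f_def) (metis prod.collapse)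
      have "exp (2 * \<rho>) * exp (2 * \<rho>') = 1"
      proof (rule lattice_diagonal_det[OF V mem])
        show "(exp (2 * \<rho>) * y, exp (2 * \<rho>') * y') \<in> V"
          unfolding \<rho>_def \<rho>'_def by (rule conj[OF E(2) mem])
        \<comment> \<open>The two scaling factors differ, so (y, y') and its image are independent
          and V has rank 2.\<close>
        have "\<rho> \<noteq> \<rho>'" using 3 by (auto simp: mult_less_0_iff)
        moreover have "cross (y, y') (exp (2 * \<rho>) * y, exp (2 * \<rho>') * y') = y * y' * (exp (2 * \<rho>') - exp (2 * \<rho>))"
          by (simp add: cross_def algebra_simps)
        ultimately show "cross (y, y') (exp (2 * \<rho>) * y, exp (2 * \<rho>') * y') \<noteq> 0" using uu by simp
        show "(exp (2 * \<rho>) * x, exp (2 * \<rho>') * z) \<in> V" if "(x, z) \<in> V" for x z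
          unfolding \<rho>_def \<rho>'_def by (rule conj[OF E(2) that])
        show "(inverse (exp (2 * \<rho>)) * x, inverse (exp (2 * \<rho>')) * z) \<in> V" if "(x, z) \<in> V" for x z
          using conj[OF mt that] by (simp add: \<rho>_def \<rho>'_def exp_minus)
      qed simp
      then have "exp (2 * \<rho> + 2 * \<rho>') = 1" by (simp only: exp_add)
      then have "\<rho> = - \<rho>'" by simp
      then show ?thesis using abs t(3) by simp
    qed
  qed
qed

text \<open>An almost shortest non-trivial element \<open>\<delta>\<close> commutes with its
  conjugate by \<open>dg t\<close>, since their commutator is much shorter than \<open>\<delta>\<close>.\<close>

lemma uniform_isolation:
  assumes t: "fst t \<noteq> 0" "snd t \<noteq> 0" "\<bar>fst t\<bar> \<noteq> \<bar>snd t\<bar>" and "e0 > 0"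
  obtains \<epsilon> where "\<epsilon> > 0"
    "\<And>E \<delta>. discrete_subgroup E \<Longrightarrow> dg t \<in> E \<Longrightarrow> (\<And>s. dg s \<in> E \<Longrightarrow> dist (dg s) 0 < e0 \<Longrightarrow> s = 0) \<Longrightarrow>
       \<delta> \<in> E \<Longrightarrow> dist \<delta> 0 < \<epsilon> \<Longrightarrow> \<delta> = 0"
proof -
  define comm where "comm \<tau> s = s + (dg1 \<tau> + s - dg1 \<tau>) - s - (dg1 \<tau> + s - dg1 \<tau>)" for \<tau> s
  obtain K1 where K1: "K1 > 0" "\<And>s. dist s 0 \<le> 1 \<Longrightarrow> dist (comm (fst t) s) 0 \<le> K1 * (dist s 0)\<^sup>2"
    using commutator_bound[of "fst t"] unfolding comm_def by blast
  obtain K2 where K2: "K2 > 0" "\<And>s. dist s 0 \<le> 1 \<Longrightarrow> dist (comm (snd t) s) 0 \<le> K2 * (dist s 0)\<^sup>2"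
    using commutator_bound[of "snd t"] unfolding comm_def by blast
  \<comment> \<open>The bound 1/2 keeps the upper left entries positive and allows the commutator
    estimate, e0 excludes diagonal elements, and the last bound makes commutators at most half as
    long as \<open>\<delta>\<close>.\<close>
  define \<epsilon> where "\<epsilon> = Min {1/2, e0, 1 / (2 * (K1 + K2))}"
  have \<epsilon>: "\<epsilon> > 0" "\<epsilon> \<le> 1/2" "\<epsilon> \<le> e0" "\<epsilon> \<le> 1 / (2 * (K1 + K2))"
    using K1(1) K2(1) \<open>e0 > 0\<close> by (simp_all add: \<epsilon>_def)
  have \<epsilon>K: "(K1 + K2) * \<epsilon> \<le> 1/2"
    using \<epsilon>(4) K1(1) K2(1) by (simp add: field_simps)
  show ?thesis
  proof (rule that[OF \<epsilon>(1)], rule ccontr)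
    fix E \<delta>\<^sub>0
    assume E: "discrete_subgroup E" "dg t \<in> E" "\<And>s. dg s \<in> E \<Longrightarrow> dist (dg s) 0 < e0 \<Longrightarrow> s = 0"
      and \<delta>\<^sub>0: "\<delta>\<^sub>0 \<in> E" "dist \<delta>\<^sub>0 0 < \<epsilon>" "\<delta>\<^sub>0 \<noteq> 0"
    define R where "R = (\<lambda>s. dist s 0) ` (E - {0})"
    have ne: "R \<noteq> {}" using \<delta>\<^sub>0 by (auto simp: R_def)
    have bdd: "bdd_below R" by (auto simp: R_def intro: bdd_belowI[of _ 0])
    obtain V where "open V" "0 \<in> V" "V \<inter> E \<subseteq> {0}" using E(1) by (auto simp: discrete_subgroup_def)
    then obtain r\<^sub>0 where r\<^sub>0: "r\<^sub>0 > 0" "\<And>s. dist s 0 < r\<^sub>0 \<Longrightarrow> s \<in> V"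
      by (metis open_dist)
    have "r\<^sub>0 \<le> x" if "x \<in> R" for x
      using that r\<^sub>0(2) \<open>V \<inter> E \<subseteq> {0}\<close> by (force simp: R_def not_less[symmetric])
    then have r: "Inf R > 0" using r\<^sub>0(1) cInf_greatest[OF ne] by fastforce
    have lower: "Inf R \<le> dist s 0" if "s \<in> E" "s \<noteq> 0" for s
      using that by (intro cInf_lower[OF _ bdd]) (auto simp: R_def)
    \<comment> \<open>The infimum need not be attained, but \<open>\<delta>\<close> is shorter than
      twice the infimum. Halving its length then falls below the infimum.\<close>
    have "Inf R < min (2 * Inf R) \<epsilon>" using r lower[OF \<delta>\<^sub>0(1,3)] \<delta>\<^sub>0(2) by simp
    then obtain x where "x \<in> R" "x < min (2 * Inf R) \<epsilon>" using cInf_lessD[OF ne] by blast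
    then obtain \<delta> where \<delta>: "\<delta> \<in> E" "\<delta> \<noteq> 0" "dist \<delta> 0 < 2 * Inf R" "dist \<delta> 0 < \<epsilon>"
      by (auto simp: R_def)
    have comp: "dist (fst \<delta>) 0 \<le> dist \<delta> 0" "dist (snd \<delta>) 0 \<le> dist \<delta> 0"
      using dist_fst_le[of \<delta> 0] dist_snd_le[of \<delta> 0] by simp_all
    define \<delta>' where "\<delta>' = dg t + \<delta> - dg t"
    have \<delta>': "\<delta>' \<in> E"
      unfolding \<delta>'_def using E \<delta> by (intro discrete_subgroup_diff discrete_subgroup_plus)
    have c: "\<delta> + \<delta>' - \<delta> - \<delta>' = (comm (fst t) (fst \<delta>), comm (snd t) (snd \<delta>))"
      by (simp add: \<delta>'_def comm_def dg_def prod_eq_iff)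
    have "dist (\<delta> + \<delta>' - \<delta> - \<delta>') 0 \<le> dist (comm (fst t) (fst \<delta>)) 0 + dist (comm (snd t) (snd \<delta>)) 0"
      unfolding c zero_prod_def dist_Pair_Pair by (rule sqrt_sum_squares_le_sum) simp_all
    also have "\<dots> \<le> K1 * (dist (fst \<delta>) 0)\<^sup>2 + K2 * (dist (snd \<delta>) 0)\<^sup>2"
      using comp \<delta>(4) \<epsilon>(2) by (intro add_mono K1(2) K2(2)) linarith+
    also have "\<dots> \<le> K1 * (dist \<delta> 0)\<^sup>2 + K2 * (dist \<delta> 0)\<^sup>2"
      using K1(1) K2(1) comp by (intro add_mono mult_left_mono power_mono) auto
    also have "\<dots> = ((K1 + K2) * dist \<delta> 0) * dist \<delta> 0" by (simp add: power2_eq_square algebra_simps)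
    also have "\<dots> \<le> 1/2 * dist \<delta> 0"
    proof (rule mult_right_mono)
      have "(K1 + K2) * dist \<delta> 0 \<le> (K1 + K2) * \<epsilon>" using K1(1) K2(1) \<delta>(4) by (intro mult_left_mono) auto
      then show "(K1 + K2) * dist \<delta> 0 \<le> 1/2" using \<epsilon>K by linarith
    qed simp
    also have "\<dots> < Inf R" using \<delta>(3) by simp
    finally have "\<delta> + \<delta>' - \<delta> - \<delta>' = 0"
      using lower[of "\<delta> + \<delta>' - \<delta> - \<delta>'"] E(1) \<delta>(1) \<delta>'
      by (meson discrete_subgroup_diff discrete_subgroup_plus not_le)
    then have "\<delta> + \<delta>' = \<delta>' + \<delta>" by (metis diff_add_cancel eq_iff_diff_eq_0)
    then have "fst \<delta> + (dg1 (fst t) + fst \<delta> - dg1 (fst t)) = (dg1 (fst t) + fst \<delta> - dg1 (fst t)) + fst \<delta>"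
      "snd \<delta> + (dg1 (snd t) + snd \<delta> - dg1 (snd t)) = (dg1 (snd t) + snd \<delta> - dg1 (snd t)) + snd \<delta>"
      by (simp_all add: \<delta>'_def dg_def prod_eq_iff)
    moreover have pos: "mat_of s $1$1 > 0" if "dist s 0 < 1/2" for s
    proof -
      have "\<bar>(mat_of s - mat 1)$1$1\<bar> \<le> norm (mat_of s - mat 1)" by (rule abs_nth_le_norm)
      then have "\<bar>mat_of s $1$1 - 1\<bar> < 1/2" using that by (simp add: dist_sl2_def dist_norm mat_of_0)
      then show ?thesis by linarith
    qed
    have "dist (fst \<delta>) 0 < 1/2" "dist (snd \<delta>) 0 < 1/2" using comp \<delta>(4) \<epsilon>(2) by linarith+
    ultimately have "diag_or_unip (fst \<delta>)" "diag_or_unip (snd \<delta>)"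
      using commute_conj_cases[OF t(1), of "fst \<delta>"] commute_conj_cases[OF t(2), of "snd \<delta>"] pos
      unfolding diag_or_unip_def by metis+
    then obtain c where "\<delta> = dg c"
      using discrete_diag_or_unip_imp_diag[OF E(1,2) \<delta>(1) t] by blast
    then show False using E(3)[of c] \<delta> \<epsilon>(3) dg_0 by auto
  qed
qed

section \<open>Disjoint translates and finite covolume\<close>

lemma discrete_subgroup_conj:
  assumes "discrete_subgroup D"
  shows "discrete_subgroup ((\<lambda>s. h + s - h) -` D)"
proof (rule discrete_subgroup_vimage[OF assms])
  show "continuous_on UNIV (\<lambda>s. h + s - h)" by (intro continuous_intros)
  show "inj (\<lambda>s. h + s - h)" by (metis (no_types, lifting) injI add_left_cancel diff_add_cancel)
  show "h + (x - y) - h = (h + x - h) - (h + y - h)" for x y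
    by (simp only: diff_conv_add_uminus minus_add minus_minus add.assoc minus_add_cancel)
qed

text \<open>The diagonal group is abelian, so all conjugated groups (g b)^-1 D (g b) have the same
  diagonal elements.\<close>

lemma conj_dg:
  "g + dg b + dg s - (g + dg b) = g + dg s - g"
proof -
  have "g + dg b + dg s - (g + dg b) = g + (dg b + dg s - dg b) - g"
    by (simp only: diff_conv_add_uminus minus_add add.assoc)
  also have "dg b + dg s - dg b = dg s"
    by (metis add_diff_cancel dg_add add.commute)
  finally show ?thesis .
qed

text \<open>The direction (0, 1) is off the line of t because \<open>cross t (0, 1)\<close> equals
  \<open>fst t\<close>. Conjugation by powers in this direction does not spoil the isolation
  constant \<open>\<epsilon>\<close>, so commutators with \<open>dg t\<close> can be tested
  uniformly in m and n.\<close>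

lemma packing_nbhd:
  assumes D: "discrete_subgroup D" and t: "fst t \<noteq> 0" "snd t \<noteq> 0"
    and tD: "g + dg t - g \<in> D" and dep: "\<And>s. g + dg s - g \<in> D \<Longrightarrow> cross t s = 0"
    and "\<epsilon> > 0" and iso: "\<And>b \<delta>. g + dg b + \<delta> - (g + dg b) \<in> D \<Longrightarrow> dist \<delta> 0 < \<epsilon> \<Longrightarrow> \<delta> = 0"
  obtains W where "open W" "0 \<in> W"
    "\<And>m n u u'. u \<in> W \<Longrightarrow> u' \<in> W \<Longrightarrow>
       (g + dg (0, real n) + u) - (g + dg (0, real m) + u') \<in> D \<Longrightarrow> n = m \<and> u = u'"
proof -
  \<comment> \<open>The logarithmic coordinate of w if w turns out to be a positive diagonal
    element.\<close>
  define log where "log w = (ln (mat_of (fst w) $1$1), ln (mat_of (snd w) $1$1))" for w :: "sl2 \<times> sl2"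
  \<comment> \<open>Both w and its commutator are below the isolation threshold. The last bound
    keeps \<open>log w\<close> closer to the line of t than one step in the direction (0,
    1).\<close>
  define P where "P w \<longleftrightarrow> dist w 0 < \<epsilon> \<and> dist (- w + dg t + w - dg t) 0 < \<epsilon> \<and>
      mat_of (fst w) $1$1 > 0 \<and> mat_of (snd w) $1$1 > 0 \<and> \<bar>cross t (log w)\<bar> < \<bar>fst t\<bar>" for w
  have id: "((\<lambda>w. w) \<longlongrightarrow> (0 :: sl2 \<times> sl2)) (nhds 0)" by (rule filterlim_ident)
  have fs: "((\<lambda>w. mat_of (fst w) $1$1) \<longlongrightarrow> 1) (nhds (0 :: sl2 \<times> sl2))"
    "((\<lambda>w. mat_of (snd w) $1$1) \<longlongrightarrow> 1) (nhds (0 :: sl2 \<times> sl2))"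
    using tendsto_vec_nth[OF tendsto_vec_nth[OF tendsto_mat_of[OF tendsto_fst[OF id]], of 1], of 1]
      tendsto_vec_nth[OF tendsto_vec_nth[OF tendsto_mat_of[OF tendsto_snd[OF id]], of 1], of 1]
    by (simp_all add: mat_of_0)
  have "((\<lambda>w. - w + dg t + w - dg t) \<longlongrightarrow> - 0 + dg t + 0 - dg t) (nhds 0)"
    by (intro tendsto_intros id)
  then have c: "((\<lambda>w. - w + dg t + w - dg t) \<longlongrightarrow> 0) (nhds 0)" by simp
  have "((\<lambda>w. fst t * ln (mat_of (snd w) $1$1) - snd t * ln (mat_of (fst w) $1$1)) \<longlongrightarrow>
      fst t * ln 1 - snd t * ln 1) (nhds 0)"
    by (intro tendsto_intros fs) simp_all
  then have l: "((\<lambda>w. cross t (log w)) \<longlongrightarrow> 0) (nhds 0)" by (simp add: cross_def log_def)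
  have "eventually P (nhds 0)"
    unfolding P_def
    using tendstoD[OF id \<open>\<epsilon> > 0\<close>] tendstoD[OF c \<open>\<epsilon> > 0\<close>] order_tendstoD(1)[OF fs(1), of 0]
      order_tendstoD(1)[OF fs(2), of 0] tendstoD[OF l, of "\<bar>fst t\<bar>"] t(1)
    by (auto simp: dist_real_def intro!: eventually_conj)
  then obtain O' where O': "open O'" "0 \<in> O'" "\<And>w. w \<in> O' \<Longrightarrow> P w"
    by (auto simp: eventually_nhds)
  have "open ((\<lambda>p. fst p - snd p :: sl2 \<times> sl2) -` O')"
    by (intro open_vimage O' continuous_intros)
  moreover have "(0, 0) \<in> (\<lambda>p. fst p - snd p) -` O'" using O'(2) by simp
  ultimately obtain A B where AB: "open A" "open B" "(0, 0) \<in> A \<times> B"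
    "A \<times> B \<subseteq> (\<lambda>p. fst p - snd p) -` O'"
    by (rule open_prod_elim)
  show ?thesis
  proof (rule that[of "A \<inter> B"])
    fix m n :: nat and u u'
    assume u: "u \<in> A \<inter> B" "u' \<in> A \<inter> B"
      and diff: "(g + dg (0, real n) + u) - (g + dg (0, real m) + u') \<in> D"
    define w where "w = u - u'"
    have P: "P w" unfolding w_def using u AB(4) by (intro O'(3)) auto
    define b where "b = (0 :: real, real m)"
    define c where "c = (0 :: real, real n - real m)"
    define E where "E = (\<lambda>s. g + dg b + s - (g + dg b)) -` D"
    have E: "discrete_subgroup E" unfolding E_def by (rule discrete_subgroup_conj[OF D])
    have iso': "\<delta> = 0" if "\<delta> \<in> E" "dist \<delta> 0 < \<epsilon>" for \<delta>
      using iso[of b \<delta>] that by (simp add: E_def)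
    have dgE: "dg s \<in> E \<longleftrightarrow> g + dg s - g \<in> D" for s
      unfolding E_def vimage_eq conj_dg ..
    have "dg (0, real n) = dg b + dg c" by (simp add: b_def c_def flip: dg_add)
    then have "(g + dg (0, real n) + u) - (g + dg (0, real m) + u') = g + dg b + (dg c + w) - (g + dg b)"
      unfolding w_def b_def[symmetric] by (simp only: diff_conv_add_uminus minus_add add.assoc)
    then have \<lambda>: "dg c + w \<in> E" using diff by (simp add: E_def)
    have a: "dg t \<in> E" using tD by (simp add: dgE)
    \<comment> \<open>The commutator of an element of E with \<open>dg t\<close>. The factor
      \<open>dg c\<close> cancels, however large c is, and leaves a commutator of w alone, which is
      short.\<close>
    have "- (dg c + w) + dg t + (dg c + w) - dg t \<in> E"
      by (rule discrete_subgroup_diff[OF E discrete_subgroup_plus[OF E discrete_subgroup_plus[OF E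
              discrete_subgroup_uminus[OF E \<lambda>] a] \<lambda>] a])
    moreover have "- (dg c + w) + dg t + (dg c + w) - dg t = - w + (- dg c + (dg t + dg c)) + w - dg t"
      by (simp only: diff_conv_add_uminus minus_add add.assoc)
    moreover have "- dg c + (dg t + dg c) = dg t"
      by (metis add.commute dg_add minus_add_cancel)
    ultimately have "- w + dg t + w - dg t = 0" using P by (intro iso') (auto simp: P_def)
    then have "- w + (dg t + w) = dg t" by (simp add: add.assoc)
    then have comm: "dg t + w = w + dg t" by (metis add_minus_cancel)
    have "fst w = dg1 (ln (mat_of (fst w) $1$1))"
      using comm P by (intro commute_dg1[OF t(1)]) (auto simp: dg_def prod_eq_iff P_def)
    moreover have "snd w = dg1 (ln (mat_of (snd w) $1$1))"
      using comm P by (intro commute_dg1[OF t(2)]) (auto simp: dg_def prod_eq_iff P_def)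
    ultimately have w: "w = dg (log w)" by (simp add: dg_def log_def prod_eq_iff)
    \<comment> \<open>The logarithm c + log w lies on the line of t, so |fst t| |n - m| = |cross t
      (log w)| < |fst t|.\<close>
    then have "dg (c + log w) \<in> E" using \<lambda> by (simp add: dg_add)
    then have "cross t c + cross t (log w) = 0" using dep[of "c + log w"] by (simp only: dgE cross_add_right)
    then have "\<bar>fst t * (real n - real m)\<bar> < \<bar>fst t\<bar>" 
    proof -
      have "cross t c = fst t * (real n - real m)" by (simp add: c_def cross_def)
      moreover have "\<bar>cross t (log w)\<bar> < \<bar>fst t\<bar>" using P by (simp only: P_def)
      ultimately show ?thesis using \<open>cross t c + cross t (log w) = 0\<close> by linarith
    qed
    then have "\<bar>real n - real m\<bar> < 1" using t(1) by (simp add: abs_mult)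
    then have nm: "n = m" by linarith
    then have "dg c = 0" by (simp add: c_def dg_0 flip: zero_prod_def)
    \<comment> \<open>With n = m, the element w itself lies in E and is short.\<close>
    then have "w = 0" using \<lambda> P by (intro iso') (auto simp: P_def)
    then show "n = m \<and> u = u'" using nm by (simp add: w_def)
  qed (use AB in auto)
qed

lemma hyper_regular_imp_rank_2:
  fixes \<nu> :: "'x measure" and \<pi> :: "sl2 \<times> sl2 \<Rightarrow> 'x"
  assumes D: "discrete_subgroup D" and \<pi>: "\<And>x y. \<pi> x = \<pi> y \<longleftrightarrow> x - y \<in> D"
    and \<nu>: "finite_measure \<nu>" "space \<nu> = range \<pi>" "emeasure \<nu> (space \<nu>) \<noteq> 0"
    and open_image: "\<And>V. open V \<Longrightarrow> \<pi> ` V \<in> sets \<nu>"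
    and inv: "\<And>E k. \<pi> ` E \<in> sets \<nu> \<Longrightarrow> emeasure \<nu> (\<pi> ` (\<lambda>h. h + k) ` E) = emeasure \<nu> (\<pi> ` E)"
    and t: "fst t \<noteq> 0" "snd t \<noteq> 0" "\<bar>fst t\<bar> \<noteq> \<bar>snd t\<bar>" and tD: "g + dg t - g \<in> D"
  obtains s where "g + dg s - g \<in> D" "cross t s \<noteq> 0"
proof (rule ccontr)
  assume "\<not> thesis"
  then have dep: "\<And>s. g + dg s - g \<in> D \<Longrightarrow> cross t s = 0" using that by blast
  define E where "E b = (\<lambda>s. g + dg b + s - (g + dg b)) -` D" for b
  have E: "discrete_subgroup (E b)" for b unfolding E_def by (rule discrete_subgroup_conj[OF D])
  have dgE: "dg s \<in> E b \<longleftrightarrow> g + dg s - g \<in> D" for s b unfolding E_def vimage_eq conj_dg ..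
  obtain V where V: "open V" "0 \<in> V" "V \<inter> E 0 \<subseteq> {0}" using E[of 0] by (auto simp: discrete_subgroup_def)
  then obtain e0 where e0: "e0 > 0" "\<And>s. dist s 0 < e0 \<Longrightarrow> s \<in> V" by (metis open_dist)
  \<comment> \<open>One threshold e0 serves every b, since by \<open>dgE\<close> the diagonal
    elements of \<open>E b\<close> do not depend on b.\<close>
  have small: "s = 0" if "dg s \<in> E b" "dist (dg s) 0 < e0" for s b
  proof -
    have "dg s \<in> V \<inter> E 0" using that e0(2) by (simp add: dgE)
    then have "dg s = 0" using V(3) by blast
    then show ?thesis using dg_eq_iff[of s 0] by (simp add: dg_0)
  qed
  obtain \<epsilon> where \<epsilon>: "\<epsilon> > 0"
    and isoE: "\<And>E \<delta>. discrete_subgroup E \<Longrightarrow> dg t \<in> E \<Longrightarrow> (\<And>s. dg s \<in> E \<Longrightarrow> dist (dg s) 0 < e0 \<Longrightarrow> s = 0) \<Longrightarrow>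
       \<delta> \<in> E \<Longrightarrow> dist \<delta> 0 < \<epsilon> \<Longrightarrow> \<delta> = 0"
    using uniform_isolation[OF t e0(1)] by metis
  have iso: "\<delta> = 0" if "g + dg b + \<delta> - (g + dg b) \<in> D" "dist \<delta> 0 < \<epsilon>" for b \<delta>
  proof (rule isoE[OF E[of b] _ _ _ that(2)])
    show "dg t \<in> E b" using tD by (simp only: dgE)
    show "\<delta> \<in> E b" using that(1) by (simp only: E_def vimage_eq)
  qed (rule small)
  obtain W where W: "open W" "0 \<in> W"
    "\<And>m n u u'. u \<in> W \<Longrightarrow> u' \<in> W \<Longrightarrow>
       (g + dg (0, real n) + u) - (g + dg (0, real m) + u') \<in> D \<Longrightarrow> n = m \<and> u = u'"
    by (rule packing_nbhd[OF D t(1,2) tD dep \<epsilon> iso]) blast+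
  obtain U where U: "open U" "0 \<in> U" "U \<subseteq> W" "emeasure haar_sl2_prod U \<noteq> 0" "emeasure haar_sl2_prod U \<noteq> \<infinity>"
    using haar_sl2_prod_small_nbhd[OF W(1,2)] .
  have "\<not> inj_on \<pi> (\<Union>n. (+) (g + dg (0, real n)) ` U)"
  proof (rule no_infinite_packing[where m = haar_sl2_prod and \<nu> = \<nu>])
    show "disjoint_family (\<lambda>n. (+) (g + dg (0, real n)) ` U)"
      unfolding disjoint_family_on_def
    proof (intro ballI impI equals0I)
      fix m n :: nat and x assume "m \<noteq> n" "x \<in> (+) (g + dg (0, real m)) ` U \<inter> (+) (g + dg (0, real n)) ` U"
      then obtain u u' where "u \<in> U" "u' \<in> U" "x = g + dg (0, real m) + u" "x = g + dg (0, real n) + u'"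
        by blast
      then have "m = n" using W(3)[of u u' m n] U(3) discrete_subgroup_zero[OF D] by auto
      then show False using \<open>m \<noteq> n\<close> by simp
    qed
  qed (fact sigma_finite_haar_sl2_prod sets_haar_sl2_prod distr_haar_sl2_prod_plus
      distr_haar_sl2_prod_uminus \<nu> open_image inv U)+
  moreover have "inj_on \<pi> (\<Union>n. (+) (g + dg (0, real n)) ` U)"
  proof (rule inj_onI)
    fix x y assume "x \<in> (\<Union>n. (+) (g + dg (0, real n)) ` U)" "y \<in> (\<Union>n. (+) (g + dg (0, real n)) ` U)"
      and eq: "\<pi> x = \<pi> y"
    then obtain m n u u' where "u \<in> U" "u' \<in> U" "x = g + dg (0, real m) + u" "y = g + dg (0, real n) + u'"
      by blast
    then show "x = y" using W(3)[of u u' m n] U(3) eq \<pi>[of x y] by auto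
  qed
  ultimately show False by blast
qed

section \<open>Compact orbits of the diagonal subgroup\<close>

text \<open>D is closed, so the set of equivalent pairs is closed; an open map carries a product
  neighbourhood of an inequivalent pair to disjoint open sets.\<close>

lemma Hausdorff_quotient_discrete_subgroup:
  fixes \<pi> :: "'g::{topological_group_add, t2_space, first_countable_topology} \<Rightarrow> 'x"
  assumes D: "discrete_subgroup D" and \<pi>: "\<And>x y. \<pi> x = \<pi> y \<longleftrightarrow> x - y \<in> D"
    and X: "topspace X = range \<pi>" "open_map euclidean X \<pi>"
  shows "Hausdorff_space X"
  unfolding Hausdorff_space_def
proof (intro allI impI, elim conjE)
  fix x y assume "x \<in> topspace X" "y \<in> topspace X" "x \<noteq> y"
  then obtain s t where st: "x = \<pi> s" "y = \<pi> t" using X(1) by auto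
  then have "s - t \<notin> D" using \<open>x \<noteq> y\<close> \<pi> by simp
  have "open ((\<lambda>p. fst p - snd p) -` (- D))"
    by (intro open_vimage continuous_intros open_Compl discrete_subgroup_closed D)
  moreover have "(s, t) \<in> (\<lambda>p. fst p - snd p) -` (- D)" using \<open>s - t \<notin> D\<close> by simp
  ultimately obtain A B where AB: "open A" "open B" "(s, t) \<in> A \<times> B"
    "A \<times> B \<subseteq> (\<lambda>p. fst p - snd p) -` (- D)" by (rule open_prod_elim)
  have "openin X (\<pi> ` A)" "openin X (\<pi> ` B)" using X(2) AB by (simp_all add: open_map_def)
  moreover have "disjnt (\<pi> ` A) (\<pi> ` B)" using AB(4) \<pi> by (auto simp: disjnt_iff)
  ultimately show "\<exists>U V. openin X U \<and> openin X V \<and> x \<in> U \<and> y \<in> V \<and> disjnt U V"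
    using AB(3) st by blast
qed

text \<open>By Baire's theorem the image of some ball has non-empty interior in the compact orbit, and
  finitely many translates of that interior cover the orbit.\<close>

lemma compact_orbit_imp_rank_2:
  fixes \<pi> :: "sl2 \<times> sl2 \<Rightarrow> 'x"
  assumes D: "discrete_subgroup D" and \<pi>: "\<And>x y. \<pi> x = \<pi> y \<longleftrightarrow> x - y \<in> D"
    and X: "topspace X = range \<pi>" "open_map euclidean X \<pi>" "continuous_map euclidean X \<pi>"
    and cpt: "compactin X (range (\<lambda>t. \<pi> (g + dg t)))"
  obtains u v where "g + dg u - g \<in> D" "g + dg v - g \<in> D" "cross u v \<noteq> 0"
proof -
  define orb where "orb t = \<pi> (g + dg t)" for t
  define Y where "Y = subtopology X (range orb)"
  have cptO: "compactin X (range orb)" using cpt by (simp add: orb_def[abs_def])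
  have "continuous_map euclidean euclidean (\<lambda>t. g + dg t)"
    by (simp add: continuous_intros)
  from continuous_map_compose[OF this X(3)] have cont: "continuous_map euclidean X orb"
    unfolding orb_def[abs_def] o_def .
  have haus: "Hausdorff_space X" by (rule Hausdorff_quotient_discrete_subgroup) fact+
  have Y: "compact_space Y" "Hausdorff_space Y"
    unfolding Y_def by (rule compact_space_subtopology[OF cptO], rule Hausdorff_space_subtopology[OF haus])
  have topY: "topspace Y = range orb"
    using compactin_subset_topspace[OF cptO] by (auto simp: Y_def topspace_subtopology)
  have closed: "closedin Y (orb ` cball 0 (real n))" for n
  proof (rule compactin_imp_closedin[OF Y(2)])
    show "compactin Y (orb ` cball 0 (real n))"
      unfolding Y_def compactin_subtopology
      using image_compactin[OF _ cont, of "cball 0 (real n)"] by auto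
  qed
  have "(\<Union>n. orb ` cball 0 (real n)) = range orb"
  proof -
    have "t \<in> (\<Union>n. cball 0 (real n))" for t :: "real \<times> real"
      using real_arch_simple[of "norm t"] by auto
    then show ?thesis by (metis UNIV_eq_I image_UN)
  qed
  then have "Y interior_of (\<Union>(range (\<lambda>n. orb ` cball 0 (real n)))) = range orb"
    using topY by (metis interior_of_topspace)
  \<comment> \<open>The orbit has the topology of the quotient space, which may be coarser than that
    of the plane. Baire's theorem supplies the interior that balls in the plane do not give
    directly.\<close>
  then have "\<not> (\<forall>T\<in>range (\<lambda>n. orb ` cball 0 (real n)). closedin Y T \<and> Y interior_of T = {})"
    using Baire_category_alt[of Y "range (\<lambda>n. orb ` cball 0 (real n))"]
      compact_imp_locally_compact_space[OF Y(1)] compact_Hausdorff_imp_regular_space[OF Y] by auto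
  then obtain n where "Y interior_of (orb ` cball 0 (real n)) \<noteq> {}" using closed by blast
  then obtain P' where "openin Y P'" "P' \<noteq> {}" "P' \<subseteq> orb ` cball 0 (real n)"
    using openin_interior_of interior_of_subset by metis
  then obtain P t\<^sub>0 where P: "openin X P" "orb t\<^sub>0 \<in> P" "P \<inter> range orb \<subseteq> orb ` cball 0 (real n)"
    unfolding Y_def openin_subtopology by blast
  \<comment> \<open>P moved by the right action of \<open>dg s\<close>, computed upstairs on the
    full preimage so that openness is preserved.\<close>
  define Q where "Q s = \<pi> ` (\<lambda>h. h + dg s) ` (\<pi> -` P)" for s
  have "open (\<pi> -` P)" using X(3) P(1) by (auto simp: continuous_map_def vimage_def)
  then have openQ: "openin X (Q s)" for s
    using X(2) open_right_translation by (auto simp: Q_def open_map_def)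
  have "range orb \<subseteq> \<Union>(range Q)"
  proof
    fix y assume "y \<in> range orb"
    then obtain t where t: "y = orb t" by blast
    have "t = t\<^sub>0 + (t - t\<^sub>0)" by simp
    then have "g + dg t = g + dg t\<^sub>0 + dg (t - t\<^sub>0)" by (metis add.assoc dg_add)
    then have "y \<in> Q (t - t\<^sub>0)" using P(2) by (auto simp: Q_def t orb_def)
    then show "y \<in> \<Union>(range Q)" by blast
  qed
  moreover have "openin X V" if "V \<in> range Q" for V using openQ that by blast
  ultimately obtain \<F> where \<F>: "finite \<F>" "\<F> \<subseteq> range Q" "range orb \<subseteq> \<Union>\<F>"
    using compactinD[OF cptO, of "range Q"] by metis
  then obtain S where S: "finite S" "\<F> = Q ` S" by (meson finite_subset_image)
  \<comment> \<open>Points of the orbit near \<open>orb t\<close> are reached by a parameter in the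
    ball, up to one of finitely many shifts; hence every r is congruent modulo the period group to
    an element of K.\<close>
  define K where "K = {k + s | k s. k \<in> cball 0 (real n) \<and> s \<in> S}"
  have "bounded K"
    unfolding K_def
    by (intro compact_imp_bounded compact_sums compact_cball finite_imp_compact S(1))
  moreover have "\<exists>y\<in>{t. g + dg t - g \<in> D}. r - y \<in> K" for r
  proof -
    obtain s where s: "s \<in> S" "orb r \<in> Q s" using \<F>(3) S(2) by blast
    then obtain q where q: "\<pi> q \<in> P" "\<pi> (g + dg r) = \<pi> (q + dg s)" by (auto simp: Q_def orb_def)
    have "g + dg r - (q + dg s) = g + dg (r - s) - q"
      unfolding dg_diff by (simp only: diff_conv_add_uminus minus_add add.assoc)
    then have "\<pi> q = orb (r - s)" using q(2) \<pi> by (simp add: orb_def) (metis)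
    then obtain k where k: "k \<in> cball 0 (real n)" "orb (r - s) = orb k" using q(1) P(3) by auto
    have "g + dg (r - s) - (g + dg k) = g + dg (r - s - k) - g"
      unfolding dg_diff[of "r - s"] by (simp only: diff_conv_add_uminus minus_add add.assoc)
    then have "g + dg (r - s - k) - g \<in> D" using k(2) \<pi> by (simp add: orb_def)
    moreover have "r - (r - s - k) = k + s" by simp
    then have "r - (r - s - k) \<in> K" using k(1) s(1) unfolding K_def by blast
    ultimately show ?thesis by blast
  qed
  ultimately show ?thesis
    using cocompact_imp_independent[of K "{t. g + dg t - g \<in> D}"] that by blast
qed

text \<open>The closed parallelogram spanned by two independent periods is compact and its image is
  the whole orbit.\<close>

lemma rank_2_imp_compact_orbit:
  fixes \<pi> :: "sl2 \<times> sl2 \<Rightarrow> 'x"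
  assumes D: "discrete_subgroup D" and \<pi>: "\<And>x y. \<pi> x = \<pi> y \<longleftrightarrow> x - y \<in> D"
    and X: "continuous_map euclidean X \<pi>"
    and uv: "g + dg u - g \<in> D" "g + dg v - g \<in> D" "cross u v \<noteq> 0"
  shows "compactin X (range (\<lambda>t. \<pi> (g + dg t)))"
proof -
  define L where "L = (\<lambda>s. g + dg s - g) -` D"
  have L: "discrete_subgroup L"
    using discrete_subgroup_dg[OF discrete_subgroup_conj[OF D, of g]] by (simp add: L_def vimage_def)
  define F where "F p = \<pi> (g + dg (fst p *\<^sub>R u + snd p *\<^sub>R v))" for p
  have "continuous_map euclidean euclidean (\<lambda>p. g + dg (fst p *\<^sub>R u + snd p *\<^sub>R v))"
    by (simp add: continuous_intros)
  from continuous_map_compose[OF this X] have "continuous_map euclidean X F"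
    unfolding F_def[abs_def] o_def .
  moreover have "compactin euclidean (cbox (0, 0) (1, 1 :: real) :: (real \<times> real) set)" by simp
  ultimately have "compactin X (F ` cbox (0, 0) (1, 1))" by (rule image_compactin[rotated])
  moreover have "range (\<lambda>t. \<pi> (g + dg t)) \<subseteq> F ` cbox (0, 0) (1, 1)"
  proof clarify
    fix a b :: real
    define t where "t = (a, b)"
    define \<alpha> \<beta> where "\<alpha> = cross t v / cross u v" and "\<beta> = cross u t / cross u v"
    have t: "t = \<alpha> *\<^sub>R u + \<beta> *\<^sub>R v" using cross_decomp[OF uv(3)] by (simp add: \<alpha>_def \<beta>_def)
    define l where "l = of_int \<lfloor>\<alpha>\<rfloor> *\<^sub>R u + of_int \<lfloor>\<beta>\<rfloor> *\<^sub>R v"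
    have "l \<in> L"
      unfolding l_def using uv
      by (intro discrete_subgroup_plus[OF L] discrete_subgroup_scaleR_int[OF L]) (auto simp: L_def)
    have "t - l = frac \<alpha> *\<^sub>R u + frac \<beta> *\<^sub>R v" by (simp add: t l_def frac_def algebra_simps)
    moreover have "t - (t - l) = l" by simp
    have "g + dg t - (g + dg (t - l)) = g + (dg t - dg (t - l)) - g"
      by (simp only: diff_conv_add_uminus minus_add add.assoc)
    then have "g + dg t - (g + dg (t - l)) = g + dg l - g"
      using \<open>t - (t - l) = l\<close> by (metis dg_diff)
    then have "\<pi> (g + dg t) = \<pi> (g + dg (t - l))" using \<pi> \<open>l \<in> L\<close> by (simp add: L_def)
    ultimately have "\<pi> (g + dg t) = F (frac \<alpha>, frac \<beta>)" by (simp add: F_def)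
    moreover have "(frac \<alpha>, frac \<beta>) \<in> cbox (0, 0) (1, 1)"
      using frac_lt_1[of \<alpha>] frac_lt_1[of \<beta>] by (simp add: cbox_Pair_eq less_imp_le)
    ultimately show "\<pi> (g + dg (a, b)) \<in> F ` cbox (0, 0) (1, 1)" unfolding t_def by blast
  qed
  moreover have "F ` cbox (0, 0) (1, 1) \<subseteq> range (\<lambda>t. \<pi> (g + dg t))" by (auto simp: F_def)
  ultimately show ?thesis by (metis subset_antisym)
qed

section \<open>Boundary action and eigenvalues\<close>

text \<open>Homogeneous coordinates on the boundary. Moebius transformations become linear in them,
  which turns composition into matrix multiplication.\<close>

definition proj_pt :: "real \<Rightarrow> real \<Rightarrow> boundary" where
  "proj_pt x y = (if y = 0 then Infty else Fin (x / y))"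

lemma moebius_mat_proj_pt:
  assumes "x \<noteq> 0 \<or> y \<noteq> 0"
  shows "moebius_mat M (proj_pt x y) = proj_pt (M$1$1 * x + M$1$2 * y) (M$2$1 * x + M$2$2 * y)"
proof (cases "y = 0")
  case False
  then have "M$2$1 * (x / y) + M$2$2 = (M$2$1 * x + M$2$2 * y) / y"
    "M$1$1 * (x / y) + M$1$2 = (M$1$1 * x + M$1$2 * y) / y" by (simp_all add: field_simps)
  then show ?thesis using False by (simp add: proj_pt_def)
qed (use assms in \<open>simp add: proj_pt_def\<close>)

lemma proj_pt_surj: obtains x y where "z = proj_pt x y" "x \<noteq> 0 \<or> y \<noteq> 0"
proof (cases z)
  case (Fin t)
  then show ?thesis by (intro that[of t 1]) (simp_all add: proj_pt_def)
next
  case Infty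
  then show ?thesis by (intro that[of 1 0]) (simp_all add: proj_pt_def)
qed

lemma moebius_mat_mult:
  assumes "det B = 1"
  shows "moebius_mat (A ** B) z = moebius_mat A (moebius_mat B z)"
proof -
  obtain x y where z: "z = proj_pt x y" "x \<noteq> 0 \<or> y \<noteq> 0" by (rule proj_pt_surj)
  define x' y' where "x' = B$1$1 * x + B$1$2 * y" and "y' = B$2$1 * x + B$2$2 * y"
  have "x = det B * x" "y = det B * y" using assms by simp_all
  then have "x = B$2$2 * x' - B$1$2 * y'" "y = B$1$1 * y' - B$2$1 * x'"
    by (simp_all add: det_2 x'_def y'_def algebra_simps)
  then have nz: "x' \<noteq> 0 \<or> y' \<noteq> 0" using z(2) by auto
  have "moebius_mat A (moebius_mat B z) = proj_pt (A$1$1 * x' + A$1$2 * y') (A$2$1 * x' + A$2$2 * y')"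
    unfolding z(1) moebius_mat_proj_pt[OF z(2)] x'_def[symmetric] y'_def[symmetric]
    by (rule moebius_mat_proj_pt[OF nz])
  moreover have "moebius_mat (A ** B) z = proj_pt (A$1$1 * x' + A$1$2 * y') (A$2$1 * x' + A$2$2 * y')"
    unfolding z(1) moebius_mat_proj_pt[OF z(2)]
    by (simp add: x'_def y'_def matrix_mult_2_nth algebra_simps)
  ultimately show ?thesis by simp
qed

abbreviation moebius_sl2 :: "sl2 \<Rightarrow> boundary \<Rightarrow> boundary" where
  "moebius_sl2 s \<equiv> moebius_mat (mat_of s)"

lemma moebius_sl2_plus: "moebius_sl2 (s + t) z = moebius_sl2 s (moebius_sl2 t z)"
  by (simp add: mat_of_plus moebius_mat_mult)

lemma moebius_sl2_0: "moebius_sl2 0 z = z"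
  by (cases z) (simp_all add: mat_of_0)

lemma moebius_sl2_conj:
  "moebius_sl2 s (moebius_sl2 g z) = moebius_sl2 g z \<longleftrightarrow> moebius_sl2 (- g + s + g) z = z"
proof -
  have "moebius_sl2 (- g + s + g) z = moebius_sl2 (- g) (moebius_sl2 s (moebius_sl2 g z))"
    by (simp only: moebius_sl2_plus)
  moreover have "moebius_sl2 (- g) (moebius_sl2 g z) = z" "moebius_sl2 g (moebius_sl2 (- g) y) = y" for y
    by (simp_all add: moebius_sl2_0 flip: moebius_sl2_plus)
  ultimately show ?thesis by metis
qed

lemma psl_eq_iff: "psl (mat_of s) = psl (mat_of t) \<longleftrightarrow> mat_of s = mat_of t \<or> mat_of s = - mat_of t"
  by (auto simp: psl_eq doubleton_eq_iff)

text \<open>Fixing the point at infinity makes the matrix upper triangular, fixing 0 makes it lower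
  triangular; the sign of the diagonal disappears in the coset.\<close>

lemma fixes_0_infty_imp_diag:
  assumes "moebius_sl2 s Infty = Infty" "moebius_sl2 s (Fin 0) = Fin 0"
  obtains \<tau> where "psl (mat_of s) = psl (mat_of (dg1 \<tau>))"
proof -
  let ?l = "mat_of s $1$1"
  have 1: "mat_of s $2$1 = 0" using assms(1) by (simp split: if_splits)
  have 2: "mat_of s $1$2 = 0" using assms(2) by (simp split: if_splits)
  have det: "?l * mat_of s $2$2 = 1" using det_mat_of[of s] by (simp add: det_2 1 2)
  then have nz: "?l \<noteq> 0" by auto
  have 3: "mat_of s $2$2 = inverse ?l" using det nz by (simp add: field_simps)
  have "mat_of s = mat_of (dg1 (ln \<bar>?l\<bar>)) \<or> mat_of s = - mat_of (dg1 (ln \<bar>?l\<bar>))"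
  proof (cases "?l > 0")
    case True
    then have "mat_of s = mat_of (dg1 (ln \<bar>?l\<bar>))"
      using 1 2 3 by (intro mat2_eqI) (simp_all add: mat_of_dg1 exp_minus)
    then show ?thesis ..
  next
    case False
    then have "mat_of s = - mat_of (dg1 (ln \<bar>?l\<bar>))"
      using 1 2 3 nz by (intro mat2_eqI) (simp_all add: mat_of_dg1 exp_minus)
    then show ?thesis ..
  qed
  then show ?thesis by (intro that) (simp only: psl_eq_iff)
qed

text \<open>The right-hand side is the characteristic polynomial, with the determinant set to
  1.\<close>

lemma ex_eigenvector_iff:
  fixes M :: "real^2^2"
  assumes "det M = 1"
  shows "(\<exists>v. v \<noteq> 0 \<and> M *v v = l *\<^sub>R v) \<longleftrightarrow> l\<^sup>2 - trace M * l + 1 = 0"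
proof -
  define a b c d where "a = M$1$1" and "b = M$1$2" and "c = M$2$1" and "d = M$2$2"
  have det: "a * d - b * c = 1" using assms by (simp add: det_2 a_def b_def c_def d_def)
  have ev: "M *v v = l *\<^sub>R v \<longleftrightarrow> a * v$1 + b * v$2 = l * v$1 \<and> c * v$1 + d * v$2 = l * v$2" for v
    by (auto simp: vec_eq_iff forall_2 matrix_vector_mult_def sum_2 a_def b_def c_def d_def)
  have tr: "trace M = a + d" by (simp add: trace_def sum_2 a_def d_def)
  have char: "(a - l) * (d - l) - b * c = l\<^sup>2 - trace M * l + 1"
    using det by (simp add: tr power2_eq_square algebra_simps)
  show ?thesis
  proof
    assume "\<exists>v. v \<noteq> 0 \<and> M *v v = l *\<^sub>R v"
    then obtain v :: "real^2" where v: "v \<noteq> 0" "a * v$1 + b * v$2 = l * v$1" "c * v$1 + d * v$2 = l * v$2"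
      using ev by auto
    have "((a - l) * (d - l) - b * c) * v$1 =
        (d - l) * (a * v$1 + b * v$2 - l * v$1) - b * (c * v$1 + d * v$2 - l * v$2)"
      "((a - l) * (d - l) - b * c) * v$2 =
        (a - l) * (c * v$1 + d * v$2 - l * v$2) - c * (a * v$1 + b * v$2 - l * v$1)"
      by (simp_all add: algebra_simps)
    then have "((a - l) * (d - l) - b * c) * v$1 = 0" "((a - l) * (d - l) - b * c) * v$2 = 0"
      using v by simp_all
    moreover have "v$1 \<noteq> 0 \<or> v$2 \<noteq> 0" using v(1) by (simp add: vec_eq_iff forall_2)
    ultimately show "l\<^sup>2 - trace M * l + 1 = 0" unfolding char by auto
  next
    assume "l\<^sup>2 - trace M * l + 1 = 0"
    then have eq: "(a - l) * (d - l) = b * c" using char by simp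
    have vec: "(vector [x, y] :: real^2) \<noteq> 0 \<longleftrightarrow> x \<noteq> 0 \<or> y \<noteq> 0" for x y
      by (simp add: vec_eq_iff forall_2)
    \<comment> \<open>(b, l - a) and (l - d, c) are each orthogonal to one row of M - l, and to the
      other by the characteristic equation. Both vanish only if M is l times the identity.\<close>
    consider "b \<noteq> 0 \<or> a \<noteq> l" | "c \<noteq> 0 \<or> d \<noteq> l" | "b = 0" "a = l" "c = 0" "d = l" by blast
    then show "\<exists>v. v \<noteq> 0 \<and> M *v v = l *\<^sub>R v"
    proof cases
      case 1
      then show ?thesis using eq
        by (intro exI[of _ "vector [b, l - a]"]) (auto simp: ev vec algebra_simps)
    next
      case 2
      then show ?thesis using eq
        by (intro exI[of _ "vector [l - d, c]"]) (auto simp: ev vec algebra_simps)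
    next
      case 3
      then show ?thesis by (intro exI[of _ "vector [1, 0]"]) (auto simp: ev vec)
    qed
  qed
qed

lemma exp_plus_exp_minus_gt_2:
  fixes \<tau> :: real
  assumes "\<tau> \<noteq> 0" shows "exp \<tau> + exp (- \<tau>) > 2"
proof -
  have "exp \<tau> \<noteq> 1" using assms by simp
  then have "0 < (exp \<tau> - 1)\<^sup>2" by simp
  then have "2 * exp \<tau> < exp \<tau> * exp \<tau> + 1" by (simp add: power2_eq_square algebra_simps)
  then show ?thesis by (simp add: exp_minus inverse_eq_divide field_simps)
qed

text \<open>The representative with positive trace has eigenvalues exp |\<tau>| and exp(- |\<tau>|),
  of which exactly one exceeds 1.\<close>

lemma dominant_eigenvalue_psl:
  fixes \<tau> :: real
  assumes "det M = 1" "\<bar>trace M\<bar> = exp \<tau> + exp (- \<tau>)" "\<tau> \<noteq> 0"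
  shows "dominant_eigenvalue (psl M) = exp \<bar>\<tau>\<bar>"
proof -
  have tr: "\<bar>trace M\<bar> = exp \<bar>\<tau>\<bar> + exp (- \<bar>\<tau>\<bar>)" using assms(2) by (cases "\<tau> \<ge> 0") auto
  have tr0: "\<bar>trace M\<bar> > 0" unfolding tr by (simp add: add_pos_pos)
  have trm: "trace (- M) = - trace M" by (simp add: trace_def sum_negf)
  have eig: "(\<exists>v. v \<noteq> 0 \<and> N *v v = l *\<^sub>R v) \<longleftrightarrow> (l - exp \<bar>\<tau>\<bar>) * (l - exp (- \<bar>\<tau>\<bar>)) = 0"
    if "N \<in> psl M" "trace N > 0" for N l
  proof -
    have N: "N = M \<or> N = - M" using that(1) by (simp add: psl_eq)
    then have "det N = 1" using assms(1) by (auto simp: det_uminus_2)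
    moreover have "trace N = exp \<bar>\<tau>\<bar> + exp (- \<bar>\<tau>\<bar>)" using N that(2) tr trm by auto
    moreover have "exp \<bar>\<tau>\<bar> * exp (- \<bar>\<tau>\<bar>) = 1" by (simp flip: exp_add)
    ultimately show ?thesis
      using ex_eigenvector_iff[of N l] by (simp add: power2_eq_square algebra_simps)
  qed
  show ?thesis
    unfolding dominant_eigenvalue_def
  proof (rule the_equality)
    have "\<exists>N\<in>psl M. trace N > 0"
      using tr0 trm by (cases "trace M > 0") (auto simp: psl_eq)
    then show "exp \<bar>\<tau>\<bar> > 1 \<and> (\<exists>N\<in>psl M. trace N > 0 \<and> (\<exists>v. v \<noteq> 0 \<and> N *v v = exp \<bar>\<tau>\<bar> *\<^sub>R v))"
      using eig assms(3) by auto
  next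
    fix l assume "l > 1 \<and> (\<exists>N\<in>psl M. trace N > 0 \<and> (\<exists>v. v \<noteq> 0 \<and> N *v v = l *\<^sub>R v))"
    then have "l > 1" "(l - exp \<bar>\<tau>\<bar>) * (l - exp (- \<bar>\<tau>\<bar>)) = 0" using eig by blast+
    moreover have "exp (- \<bar>\<tau>\<bar>) \<le> 1" by simp
    ultimately show "l = exp \<bar>\<tau>\<bar>" by auto
  qed
qed

section \<open>Passage from determinant 1 matrices to cosets\<close>

lemma one_PSL2R: "\<one>\<^bsub>PSL2R\<^esub> = psl (mat 1)"
  by (simp add: PSL2R_def FactGroup_def psl_eq)

lemma carrier_SL2R_eq: "carrier SL2R = range mat_of"
  by (auto simp: SL2R_def image_iff) (metis mat_of_Sl2)

lemma psl_in_carrier: "psl (mat_of s) \<in> carrier PSL2R"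
  by (auto simp: carrier_PSL2R carrier_SL2R_eq)

lemma hyperbolic_psl: "hyperbolic_PSL2R (psl (mat_of s)) \<longleftrightarrow> \<bar>trace (mat_of s)\<bar> > 2"
proof -
  have "abs_trace \<one>\<^bsub>PSL2R\<^esub> = 2" by (simp add: one_PSL2R abs_trace_psl trace_def sum_2)
  then show ?thesis
    using abs_trace_psl[of "mat_of s"] unfolding hyperbolic_PSL2R_def by (auto simp: psl_in_carrier)
qed

lemma trace_conj_dg1: "trace (mat_of (g + dg1 \<tau> - g)) = exp \<tau> + exp (- \<tau>)"
proof -
  have "trace (mat_of (g + dg1 \<tau> - g)) = trace (mat_of (- g) ** mat_of (g + dg1 \<tau>))"
    unfolding mat_of_minus mat_of_uminus by (rule trace_mul_sym)
  also have "mat_of (- g) ** mat_of (g + dg1 \<tau>) = mat_of (dg1 \<tau>)"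
    by (simp flip: mat_of_plus)
  finally show ?thesis by (simp add: trace_def sum_2 mat_of_dg1)
qed

definition GG_of :: "sl2 \<times> sl2 \<Rightarrow> (real^2^2) set \<times> (real^2^2) set" where
  "GG_of s = (psl (mat_of (fst s)), psl (mat_of (snd s)))"

lemma act_GG_of: "act (GG_of s) z = (moebius_sl2 (fst s) (fst z), moebius_sl2 (snd s) (snd z))"
  by (simp add: act_def GG_of_def moebius_psl)

text \<open>Traces are invariant under conjugation, so both conditions can be read off from the
  logarithms of the diagonal part.\<close>

lemma hyper_regular_GG_of:
  "hyper_regular (GG_of (g + dg t - g)) \<longleftrightarrow> fst t \<noteq> 0 \<and> snd t \<noteq> 0 \<and> \<bar>fst t\<bar> \<noteq> \<bar>snd t\<bar>"
proof -
  have hyp: "hyperbolic_PSL2R (psl (mat_of (h + dg1 \<tau> - h))) \<longleftrightarrow> \<tau> \<noteq> 0" for h \<tau>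
    using exp_plus_exp_minus_gt_2[of \<tau>] by (auto simp: hyperbolic_psl trace_conj_dg1)
  have dom: "dominant_eigenvalue (psl (mat_of (h + dg1 \<tau> - h))) = exp \<bar>\<tau>\<bar>" if "\<tau> \<noteq> 0" for h \<tau>
    using that by (intro dominant_eigenvalue_psl) (simp_all add: trace_conj_dg1 add_pos_pos less_imp_le)
  show ?thesis
    by (auto simp: hyper_regular_def hyperbolic_def GG_of_def dg_def hyp dom)
qed

lemma psl_mult: "psl (mat_of s) \<otimes>\<^bsub>PSL2R\<^esub> psl (mat_of t) = psl (mat_of (s + t))"
proof -
  have "psl (mat_of s) <#>\<^bsub>SL2R\<^esub> psl (mat_of t) = psl (mat_of s \<otimes>\<^bsub>SL2R\<^esub> mat_of t)"
    unfolding psl_def by (rule normal.rcos_sum[OF center_normal_SL2R]) (simp_all add: carrier_SL2R_eq)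
  then show ?thesis by (simp add: PSL2R_def FactGroup_def SL2R_def mat_of_plus)
qed

lemma GG_of_plus: "GG_of (s + t) = GG_of s \<otimes>\<^bsub>GG\<^esub> GG_of t"
  by (simp add: GG_of_def GG_def psl_mult)

lemma GG_of_0: "GG_of 0 = \<one>\<^bsub>GG\<^esub>"
  by (simp add: GG_of_def GG_def one_PSL2R mat_of_0)

lemma carrier_GG_eq: "carrier GG = range GG_of"
proof -
  have "carrier GG = range (\<lambda>s. psl (mat_of s)) \<times> range (\<lambda>s. psl (mat_of s))"
    by (simp add: GG_def carrier_PSL2R carrier_SL2R_eq image_image)
  also have "\<dots> = range GG_of" by (auto simp: GG_of_def image_iff)
  finally show ?thesis .
qed

lemma GG_of_in_carrier [simp]: "GG_of s \<in> carrier GG"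
  by (simp add: carrier_GG_eq)

lemma GG_of_uminus: "inv\<^bsub>GG\<^esub> GG_of s = GG_of (- s)"
  by (rule group.inv_equality[OF group_GG]) (simp_all add: GG_of_0 flip: GG_of_plus)

text \<open>Diagonal matrices with positive entries never differ by the sign -1, so the projection
  is injective on them.\<close>

lemma GG_of_dg_eq_iff: "GG_of (dg s) = GG_of (dg t) \<longleftrightarrow> s = t"
proof -
  have "psl (mat_of (dg1 x)) = psl (mat_of (dg1 y)) \<longleftrightarrow> x = y" for x y
  proof -
    have "mat_of (dg1 x) \<noteq> - mat_of (dg1 y)"
    proof
      assume "mat_of (dg1 x) = - mat_of (dg1 y)"
      then have "mat_of (dg1 x) $1$1 = (- mat_of (dg1 y)) $1$1" by simp
      then have "exp x + exp y = 0" by (simp add: mat_of_dg1)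
      then show False using exp_gt_zero[of x] exp_gt_zero[of y] by linarith
    qed
    then show ?thesis unfolding psl_eq_iff by (auto simp: mat_of_inject dg1_eq_iff)
  qed
  then show ?thesis by (simp add: GG_of_def dg_def prod_eq_iff)
qed

lemma diag_subgroup_eq: "diag_subgroup = range (\<lambda>t. GG_of (dg t))"
proof -
  have "\<exists>t. l = exp t" if "l > 0" for l :: real using that by (metis exp_ln)
  moreover have "GG_of (dg (x, y)) = (psl (mat2 (exp x) 0 0 (inverse (exp x))), psl (mat2 (exp y) 0 0 (inverse (exp y))))" for x y
    by (simp add: GG_of_def dg_def mat_of_dg1 exp_minus)
  ultimately show ?thesis
    unfolding diag_subgroup_def by (auto simp: image_iff) (metis exp_gt_zero)+
qed

section \<open>Lattices in \<open>PSL(2,\<real>) \<times> PSL(2,\<real>)\<close>\<close>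

text \<open>The preimage of the image consists of V and its negative, both open.\<close>

lemma openin_PSL2R_image:
  assumes "open U" shows "openin PSL2R_topology ((\<lambda>s. psl (mat_of s)) ` U)"
proof -
  obtain V where V: "open V" "U = mat_of -` V" using assms by (auto simp: open_sl2_iff)
  have "{M \<in> carrier SL2R. psl M \<in> (\<lambda>s. psl (mat_of s)) ` U} = carrier SL2R \<inter> (V \<union> uminus -` V)"
  proof (intro equalityI subsetI)
    fix M assume "M \<in> {M \<in> carrier SL2R. psl M \<in> (\<lambda>s. psl (mat_of s)) ` U}"
    then obtain s where "M \<in> carrier SL2R" "mat_of s \<in> V" "psl M = psl (mat_of s)" using V(2) by auto
    then show "M \<in> carrier SL2R \<inter> (V \<union> uminus -` V)" by (auto simp: psl_eq doubleton_eq_iff)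
  next
    fix M assume M: "M \<in> carrier SL2R \<inter> (V \<union> uminus -` V)"
    then have det: "det M = 1" "det (- M) = 1" by (simp_all add: SL2R_def det_uminus_2)
    have "psl (- M) = psl M" by (auto simp: psl_eq)
    then have "psl M \<in> (\<lambda>s. psl (mat_of s)) ` U"
      using M det V(2) by (auto intro: image_eqI[of _ _ "Sl2 M"] image_eqI[of _ _ "Sl2 (- M)"] simp: mat_of_Sl2)
    then show "M \<in> {M \<in> carrier SL2R. psl M \<in> (\<lambda>s. psl (mat_of s)) ` U}" using M by simp
  qed
  moreover have "open (V \<union> uminus -` V)" using V(1) by (intro open_Un open_vimage continuous_intros)
  ultimately have "openin (top_of_set (carrier SL2R)) {M \<in> carrier SL2R. psl M \<in> (\<lambda>s. psl (mat_of s)) ` U}"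
    by (simp add: openin_open_Int)
  then show ?thesis
    unfolding PSL2R_topology_def openin_quotient_topology by (auto simp: carrier_SL2R_eq)
qed

lemma continuous_map_psl_mat_of: "continuous_map euclidean PSL2R_topology (\<lambda>s. psl (mat_of s))"
proof -
  have "continuous_map (top_of_set (carrier SL2R)) PSL2R_topology psl"
    unfolding PSL2R_topology_def by (intro quotient_imp_continuous_map quotient_map_quotient_topology)
  moreover have "continuous_map euclidean (top_of_set (carrier SL2R)) mat_of"
    by (auto simp: continuous_map_in_subtopology carrier_SL2R_eq intro!: continuous_on_mat_of continuous_on_id)
  ultimately have "continuous_map euclidean PSL2R_topology (psl \<circ> mat_of)"
    by (rule continuous_map_compose[rotated])
  then show ?thesis unfolding o_def .
qed

lemma continuous_map_GG_of: "continuous_map euclidean GG_topology GG_of"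
proof -
  have "continuous_map (prod_topology euclidean euclidean) GG_topology
      (\<lambda>s. (psl (mat_of (fst s)), psl (mat_of (snd s))))"
    unfolding GG_topology_def
    by (intro continuous_map_pairedI
        continuous_map_compose[OF continuous_map_fst continuous_map_psl_mat_of, unfolded o_def]
        continuous_map_compose[OF continuous_map_snd continuous_map_psl_mat_of, unfolded o_def])
  then show ?thesis by (simp add: GG_of_def[abs_def])
qed

lemma openin_GG_image:
  assumes "open W" shows "openin GG_topology (GG_of ` W)"
  unfolding GG_topology_def openin_prod_topology_alt
proof (intro allI impI)
  fix x y assume "(x, y) \<in> GG_of ` W"
  then obtain s where s: "s \<in> W" "x = psl (mat_of (fst s))" "y = psl (mat_of (snd s))"
    by (auto simp: GG_of_def)
  obtain A B where AB: "open A" "open B" "s \<in> A \<times> B" "A \<times> B \<subseteq> W"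
    using open_prod_elim[OF assms s(1)] .
  show "\<exists>U V. openin PSL2R_topology U \<and> openin PSL2R_topology V \<and> x \<in> U \<and> y \<in> V \<and> U \<times> V \<subseteq> GG_of ` W"
  proof (intro exI conjI)
    show "openin PSL2R_topology ((\<lambda>s. psl (mat_of s)) ` A)" "openin PSL2R_topology ((\<lambda>s. psl (mat_of s)) ` B)"
      using AB by (simp_all add: openin_PSL2R_image)
    show "x \<in> (\<lambda>s. psl (mat_of s)) ` A" "y \<in> (\<lambda>s. psl (mat_of s)) ` B"
      using AB(3) s by auto
    show "(\<lambda>s. psl (mat_of s)) ` A \<times> (\<lambda>s. psl (mat_of s)) ` B \<subseteq> GG_of ` W"
    proof clarify
      fix a b assume "a \<in> A" "b \<in> B"
      then show "(psl (mat_of a), psl (mat_of b)) \<in> GG_of ` W"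
        using AB(4) by (intro image_eqI[of _ _ "(a, b)"]) (auto simp: GG_of_def)
    qed
  qed
qed

lemma GG_of_diff: "GG_of (s - t) = GG_of s \<otimes>\<^bsub>GG\<^esub> inv\<^bsub>GG\<^esub> GG_of t"
  by (simp only: diff_conv_add_uminus GG_of_plus GG_of_uminus)

lemma discrete_subgroup_vimage_GG_of:
  assumes \<Gamma>: "subgroup \<Gamma> GG" and discrete: "subtopology GG_topology \<Gamma> = discrete_topology \<Gamma>"
  shows "discrete_subgroup (GG_of -` \<Gamma>)"
proof -
  interpret subgroup \<Gamma> GG by fact
  have "openin (subtopology GG_topology \<Gamma>) {\<one>\<^bsub>GG\<^esub>}"
    unfolding discrete by simp
  then obtain T where T: "openin GG_topology T" "T \<inter> \<Gamma> = {\<one>\<^bsub>GG\<^esub>}"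
    by (auto simp: openin_subtopology)
  \<comment> \<open>The preimage of \<open>\<Gamma>\<close> contains the whole kernel of the
    projection, that is, all sign changes. Positivity of the upper left entries separates the
    identity from the others.\<close>
  define V where "V = GG_of -` T \<inter> {s. mat_of (fst s) $1$1 > 0} \<inter> {s. mat_of (snd s) $1$1 > 0}"
  have "open (GG_of -` T)"
    using continuous_map_GG_of T(1) by (auto simp: continuous_map_def vimage_def)
  then have "open V"
    unfolding V_def
    by (intro open_Int open_Collect_less continuous_intros continuous_on_component)
  moreover have "0 \<in> V" using T(2) by (auto simp: V_def GG_of_0 mat_of_0)
  moreover have "s = 0" if "s \<in> V \<inter> GG_of -` \<Gamma>" for s
  proof -
    have "GG_of s = GG_of 0" using that T(2) by (auto simp: V_def GG_of_0)
    moreover have pos: "mat_of r \<noteq> - mat_of 0" if "mat_of r $1$1 > 0" for r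
      using that by (auto simp: mat_of_0)
    ultimately show ?thesis
      using that by (auto simp: GG_of_def psl_eq_iff V_def mat_of_inject prod_eq_iff)
  qed
  ultimately show ?thesis
    unfolding discrete_subgroup_def by (auto simp: GG_of_0 GG_of_diff)
qed

lemma coset_GG_of_eq_iff:
  assumes \<Gamma>: "subgroup \<Gamma> GG"
  shows "\<Gamma> #>\<^bsub>GG\<^esub> GG_of s = \<Gamma> #>\<^bsub>GG\<^esub> GG_of t \<longleftrightarrow> s - t \<in> GG_of -` \<Gamma>"
proof
  interpret group GG by (rule group_GG)
  assume "\<Gamma> #>\<^bsub>GG\<^esub> GG_of s = \<Gamma> #>\<^bsub>GG\<^esub> GG_of t"
  then have "GG_of s \<in> \<Gamma> #>\<^bsub>GG\<^esub> GG_of t" using rcos_self[OF GG_of_in_carrier \<Gamma>] by metis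
  then obtain h where h: "h \<in> \<Gamma>" "GG_of s = h \<otimes>\<^bsub>GG\<^esub> GG_of t" by (auto simp: r_coset_def)
  then have "h \<in> carrier GG" using subgroup.subset[OF \<Gamma>] by blast
  then have "GG_of (s - t) = h" using h(2) by (simp add: GG_of_diff m_assoc)
  then show "s - t \<in> GG_of -` \<Gamma>" using h(1) by simp
next
  interpret group GG by (rule group_GG)
  assume "s - t \<in> GG_of -` \<Gamma>"
  moreover have "GG_of s = GG_of (s - t) \<otimes>\<^bsub>GG\<^esub> GG_of t" by (simp flip: GG_of_plus)
  ultimately have "GG_of s \<in> \<Gamma> #>\<^bsub>GG\<^esub> GG_of t" by (auto simp: r_coset_def)
  then show "\<Gamma> #>\<^bsub>GG\<^esub> GG_of s = \<Gamma> #>\<^bsub>GG\<^esub> GG_of t"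
    using repr_independence[OF _ GG_of_in_carrier \<Gamma>] by metis
qed

lemma rcosets_GG_eq: "rcosets\<^bsub>GG\<^esub> \<Gamma> = range (\<lambda>s. \<Gamma> #>\<^bsub>GG\<^esub> GG_of s)"
  by (auto simp: RCOSETS_def carrier_GG_eq)

lemma topspace_coset_topology_GG:
  "topspace (coset_topology GG GG_topology \<Gamma>) = range (\<lambda>s. \<Gamma> #>\<^bsub>GG\<^esub> GG_of s)"
  by (simp add: coset_topology_def topspace_quotient_topology topspace_GG_topology carrier_GG_eq image_image)

lemma continuous_map_coset:
  "continuous_map euclidean (coset_topology GG GG_topology \<Gamma>) (\<lambda>s. \<Gamma> #>\<^bsub>GG\<^esub> GG_of s)"
proof -
  have "continuous_map GG_topology (coset_topology GG GG_topology \<Gamma>) (\<lambda>x. \<Gamma> #>\<^bsub>GG\<^esub> x)"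
    unfolding coset_topology_def by (intro quotient_imp_continuous_map quotient_map_quotient_topology)
  from continuous_map_compose[OF continuous_map_GG_of this] show ?thesis by (simp add: o_def)
qed

lemma open_map_coset:
  assumes \<Gamma>: "subgroup \<Gamma> GG"
  shows "open_map euclidean (coset_topology GG GG_topology \<Gamma>) (\<lambda>s. \<Gamma> #>\<^bsub>GG\<^esub> GG_of s)"
  unfolding open_map_def
proof (intro allI impI)
  fix W :: "(sl2 \<times> sl2) set" assume "openin euclidean W"
  then have "open W" by simp
  let ?\<pi> = "\<lambda>s. \<Gamma> #>\<^bsub>GG\<^esub> GG_of s"
  \<comment> \<open>The saturation of W: the union of its left translates by the preimage of
    \<open>\<Gamma>\<close>.\<close>
  define W' where "W' = (\<Union>d\<in>GG_of -` \<Gamma>. (+) d ` W)"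
  have "open W'" unfolding W'_def using \<open>open W\<close> by (intro open_UN ballI open_left_translation)
  have "s \<in> W'" if "?\<pi> s = ?\<pi> w" "w \<in> W" for s w
    using that coset_GG_of_eq_iff[OF \<Gamma>, of s w]
    by (auto simp: W'_def intro!: bexI[of _ "s - w"] image_eqI[of _ _ w])
  moreover have "?\<pi> s \<in> ?\<pi> ` W" if s: "s \<in> W'" for s
  proof -
    obtain d w where "d \<in> GG_of -` \<Gamma>" "w \<in> W" "s = d + w" using s unfolding W'_def by blast
    then show ?thesis using coset_GG_of_eq_iff[OF \<Gamma>, of s w] by (intro image_eqI[of _ _ w]) auto
  qed
  ultimately have "{x \<in> topspace GG_topology. \<Gamma> #>\<^bsub>GG\<^esub> x \<in> ?\<pi> ` W} = GG_of ` W'"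
    by (auto simp: topspace_GG_topology carrier_GG_eq)
  moreover have "?\<pi> ` W \<subseteq> (\<lambda>x. \<Gamma> #>\<^bsub>GG\<^esub> x) ` topspace GG_topology"
    by (auto simp: topspace_GG_topology)
  ultimately show "openin (coset_topology GG GG_topology \<Gamma>) (?\<pi> ` W)"
    unfolding coset_topology_def openin_quotient_topology
    using openin_GG_image[OF \<open>open W\<close>] openin_GG_image[OF \<open>open W'\<close>] by simp
qed

lemma lattice_rank_2:
  assumes lat: "is_lattice GG GG_topology \<Gamma>"
    and t: "fst t \<noteq> 0" "snd t \<noteq> 0" "\<bar>fst t\<bar> \<noteq> \<bar>snd t\<bar>" and t\<Gamma>: "GG_of (g + dg t - g) \<in> \<Gamma>"
  obtains s where "GG_of (g + dg s - g) \<in> \<Gamma>" "cross t s \<noteq> 0"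
proof -
  interpret group GG by (rule group_GG)
  have \<Gamma>: "subgroup \<Gamma> GG" "subtopology GG_topology \<Gamma> = discrete_topology \<Gamma>"
    "finite_covolume GG GG_topology \<Gamma>" using lat by (simp_all add: is_lattice_def)
  let ?\<pi> = "\<lambda>s. \<Gamma> #>\<^bsub>GG\<^esub> GG_of s"
  obtain \<nu> where \<nu>: "space \<nu> = rcosets\<^bsub>GG\<^esub> \<Gamma>"
    "sets \<nu> = sigma_sets (rcosets\<^bsub>GG\<^esub> \<Gamma>) {U. openin (coset_topology GG GG_topology \<Gamma>) U}"
    "\<And>h B. h \<in> carrier GG \<Longrightarrow> B \<in> sets \<nu> \<Longrightarrow> emeasure \<nu> ((\<lambda>x. x #>\<^bsub>GG\<^esub> h) ` B) = emeasure \<nu> B"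
    "0 < emeasure \<nu> (space \<nu>)" "emeasure \<nu> (space \<nu>) < \<infinity>"
    using \<Gamma>(3) unfolding finite_covolume_def by blast
  have D: "discrete_subgroup (GG_of -` \<Gamma>)" by (rule discrete_subgroup_vimage_GG_of[OF \<Gamma>(1,2)])
  show ?thesis
  proof (rule hyper_regular_imp_rank_2[OF D, of ?\<pi> \<nu> t g])
    show "finite_measure \<nu>" using \<nu>(5) by (intro finite_measureI) auto
    show "?\<pi> ` V \<in> sets \<nu>" if "open V" for V
      using open_map_coset[OF \<Gamma>(1)] that by (auto simp: \<nu>(2) open_map_def intro!: sigma_sets.Basic)
    show "emeasure \<nu> (?\<pi> ` (\<lambda>h. h + k) ` E) = emeasure \<nu> (?\<pi> ` E)" if "?\<pi> ` E \<in> sets \<nu>" for E k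
    proof -
      have "?\<pi> ` (\<lambda>h. h + k) ` E = (\<lambda>x. x #>\<^bsub>GG\<^esub> GG_of k) ` ?\<pi> ` E"
        unfolding image_image GG_of_plus
        by (intro image_cong refl coset_mult_assoc[symmetric] subgroup.subset[OF \<Gamma>(1)] GG_of_in_carrier)
      then show ?thesis using \<nu>(3)[OF GG_of_in_carrier that] by simp
    qed
    show "thesis" if "g + dg s - g \<in> GG_of -` \<Gamma>" "cross t s \<noteq> 0" for s
      using that \<open>\<And>s. GG_of (g + dg s - g) \<in> \<Gamma> \<Longrightarrow> cross t s \<noteq> 0 \<Longrightarrow> thesis\<close> by simp
  qed (use t t\<Gamma> \<nu> rcosets_GG_eq coset_GG_of_eq_iff[OF \<Gamma>(1)] in auto)
qed

lemma act_GG_of_fixed_iff: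
  "act (GG_of s) (act (GG_of h) (z, w)) = act (GG_of h) (z, w) \<longleftrightarrow>
     moebius_sl2 (- fst h + fst s + fst h) z = z \<and> moebius_sl2 (- snd h + snd s + snd h) w = w"
  by (simp only: act_GG_of fst_conv snd_conv prod.inject moebius_sl2_conj)

lemma conj_uminus_cancel: "- g + (g + x - g) + g = (x :: 'g::group_add)"
  by (simp only: diff_conv_add_uminus add.assoc minus_add_cancel left_minus add_0_right)

lemma conj_inter_diag_subgroup:
  assumes \<Gamma>: "subgroup \<Gamma> GG"
  shows "((inv\<^bsub>GG\<^esub> GG_of g <#\<^bsub>GG\<^esub> \<Gamma>) #>\<^bsub>GG\<^esub> GG_of g) \<inter> diag_subgroup =
    (\<lambda>t. GG_of (dg t)) ` {t. GG_of (g + dg t - g) \<in> \<Gamma>}"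
proof -
  have mem: "x \<in> (inv\<^bsub>GG\<^esub> GG_of g <#\<^bsub>GG\<^esub> \<Gamma>) #>\<^bsub>GG\<^esub> GG_of g \<longleftrightarrow>
      (\<exists>r. GG_of r \<in> \<Gamma> \<and> x = GG_of (- g + r + g))" for x
  proof -
    have "\<gamma> \<in> \<Gamma> \<Longrightarrow> \<exists>r. \<gamma> = GG_of r" for \<gamma>
      using subgroup.subset[OF \<Gamma>] unfolding carrier_GG_eq by blast
    then show ?thesis
      unfolding r_coset_def l_coset_def GG_of_uminus by (auto simp: GG_of_plus) (metis GG_of_plus)
  qed
  have "(\<exists>r. GG_of r \<in> \<Gamma> \<and> GG_of (dg t) = GG_of (- g + r + g)) \<longleftrightarrow> GG_of (g + dg t - g) \<in> \<Gamma>" for t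
  proof
    assume "\<exists>r. GG_of r \<in> \<Gamma> \<and> GG_of (dg t) = GG_of (- g + r + g)"
    then obtain r where r: "GG_of r \<in> \<Gamma>" "GG_of (dg t) = GG_of (- g + r + g)" by blast
    have "GG_of (g + dg t - g) = GG_of (g + (- g + r + g) - g)"
      unfolding diff_conv_add_uminus GG_of_plus[of _ "- g"] GG_of_plus[of g] r(2) ..
    also have "g + (- g + r + g) - g = r" by (simp add: add.assoc)
    finally show "GG_of (g + dg t - g) \<in> \<Gamma>" using r(1) by simp
  next
    assume "GG_of (g + dg t - g) \<in> \<Gamma>"
    moreover have "dg t = - g + (g + dg t - g) + g" by (simp only: conj_uminus_cancel)
    ultimately show "\<exists>r. GG_of r \<in> \<Gamma> \<and> GG_of (dg t) = GG_of (- g + r + g)" by metis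
  qed
  then have "GG_of (dg t) \<in> (inv\<^bsub>GG\<^esub> GG_of g <#\<^bsub>GG\<^esub> \<Gamma>) #>\<^bsub>GG\<^esub> GG_of g \<longleftrightarrow> GG_of (g + dg t - g) \<in> \<Gamma>" for t
    unfolding mem .
  then show ?thesis unfolding diag_subgroup_eq by blast
qed

text \<open>An isomorphism gives an additive injection of the integer pairs into L, whose generators
  must have independent images by discreteness. Conversely, a lattice basis provides the
  isomorphism.\<close>

lemma iso_Z2_iff_rank_2:
  assumes L: "discrete_subgroup L"
  shows "GG\<lparr>carrier := (\<lambda>t. GG_of (dg t)) ` L\<rparr> \<cong> integer_group \<times>\<times> integer_group \<longleftrightarrow>
    (\<exists>u\<in>L. \<exists>v\<in>L. cross u v \<noteq> 0)"
    (is "?G \<cong> ?Z \<longleftrightarrow> ?R")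
proof
  let ?\<phi> = "\<lambda>t. GG_of (dg t)"
  assume "?G \<cong> ?Z"
  then obtain h where h: "h \<in> hom ?G ?Z" "bij_betw h (carrier ?G) (carrier ?Z)"
    by (auto simp: is_iso_def iso_def)
  have "bij_betw ?\<phi> L (?\<phi> ` L)" by (auto simp: bij_betw_def inj_on_def GG_of_dg_eq_iff)
  then have bij: "bij_betw (h \<circ> ?\<phi>) L UNIV" using bij_betw_trans[of ?\<phi> L _ h] h(2)
    by (auto simp: DirProd_def integer_group_def)
  have add: "(h \<circ> ?\<phi>) (s + t) = (h \<circ> ?\<phi>) s + (h \<circ> ?\<phi>) t" if "s \<in> L" "t \<in> L" for s t
  proof -
    have Z: "x \<otimes>\<^bsub>?Z\<^esub> y = x + y" for x y :: "int \<times> int" by (cases x; cases y) simp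
    show ?thesis using hom_mult[OF h(1), of "?\<phi> s" "?\<phi> t"] that by (simp add: dg_add GG_of_plus Z)
  qed
  define f where "f = inv_into L (h \<circ> ?\<phi>)"
  have f: "bij_betw f UNIV L" unfolding f_def by (rule bij_betw_inv_into[OF bij])
  then have fL: "f x \<in> L" for x by (auto simp: bij_betw_def)
  have hf: "(h \<circ> ?\<phi>) (f x) = x" for x unfolding f_def by (rule bij_betw_inv_into_right[OF bij]) simp
  have fh: "f ((h \<circ> ?\<phi>) t) = t" if "t \<in> L" for t unfolding f_def by (rule bij_betw_inv_into_left[OF bij that])
  have fadd: "f (x + y) = f x + f y" for x y
    using fh[OF discrete_subgroup_plus[OF L fL fL], of x y] add[OF fL fL, of x y] by (simp only: hf)
  have "inj f" "range f \<subseteq> L" using f by (auto simp: bij_betw_def)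
  then obtain u v where "u \<in> L" "v \<in> L" "cross u v \<noteq> 0"
    by (rule discrete_subgroup_rank_2[OF L fadd])
  then show ?R by blast
next
  let ?\<phi> = "\<lambda>t. GG_of (dg t)"
  assume ?R
  then obtain u v where uv: "u \<in> L" "v \<in> L" "cross u v \<noteq> 0"
    "\<And>w. w \<in> L \<Longrightarrow> \<exists>k l::int. w = of_int k *\<^sub>R u + of_int l *\<^sub>R v"
    using lattice_basis[OF L] by metis
  define f where "f = (\<lambda>(k::int, l::int). of_int k *\<^sub>R u + of_int l *\<^sub>R v)"
  have fL: "f x \<in> L" for x
    unfolding f_def using uv by (auto intro!: discrete_subgroup_plus[OF L] discrete_subgroup_scaleR_int[OF L] split: prod.split)
  have fadd: "f (k + k', l + l') = f (k, l) + f (k', l')" for k k' l l'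
    by (simp add: f_def scaleR_add_left)
  have inj: "inj f"
  proof (rule injI)
    fix x y assume "f x = f y"
    then have "cross u (f x) = cross u (f y)" "cross (f x) v = cross (f y) v" by simp_all
    then have "of_int (snd x) * cross u v = of_int (snd y) * cross u v"
      "of_int (fst x) * cross u v = of_int (fst y) * cross u v"
      by (simp_all add: f_def case_prod_beta cross_def algebra_simps)
    then show "x = y" using uv(3) by (simp add: prod_eq_iff)
  qed
  have surj: "range f = L"
  proof
    show "range f \<subseteq> L" using fL by blast
    show "L \<subseteq> range f"
    proof
      fix w assume "w \<in> L"
      then obtain k l :: int where "w = of_int k *\<^sub>R u + of_int l *\<^sub>R v" using uv(4) by blast
      then have "w = f (k, l)" by (simp add: f_def)
      then show "w \<in> range f" by blast
    qed
  qed
  have "(\<lambda>x. ?\<phi> (f x)) \<in> iso ?Z ?G"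
    unfolding iso_def
  proof (intro CollectI conjI homI)
    show "?\<phi> (f x) \<in> carrier ?G" for x using fL by simp
    show "?\<phi> (f (x \<otimes>\<^bsub>?Z\<^esub> y)) = ?\<phi> (f x) \<otimes>\<^bsub>?G\<^esub> ?\<phi> (f y)" for x y
      by (cases x, cases y) (simp add: fadd dg_add GG_of_plus)
    have "range (\<lambda>x. ?\<phi> (f x)) = ?\<phi> ` L" unfolding surj[symmetric] by (simp add: image_image)
    then show "bij_betw (\<lambda>x. ?\<phi> (f x)) (carrier ?Z) (carrier ?G)"
      using inj by (auto simp: bij_betw_def inj_on_def GG_of_dg_eq_iff DirProd_def integer_group_def)
  qed
  then have "?Z \<cong> ?G" by (rule is_isoI)
  then show "?G \<cong> ?Z" by (rule group.iso_sym[OF DirProd_group[OF group_integer_group group_integer_group]])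
qed

theorem theorem1p3:
  fixes \<Gamma> :: "((real^2^2) set \<times> (real^2^2) set) set"
    and g :: "(real^2^2) set \<times> (real^2^2) set"
    and x :: "((real^2^2) set \<times> (real^2^2) set) set"
  assumes "irreducible_lattice \<Gamma>"
    and "g \<in> carrier GG"
    and "x = \<Gamma> #>\<^bsub>GG\<^esub> g"
  shows "(compactin (coset_topology GG GG_topology \<Gamma>) (diag_orbit x)
            \<longleftrightarrow> GG\<lparr>carrier := ((inv\<^bsub>GG\<^esub> g <#\<^bsub>GG\<^esub> \<Gamma>) #>\<^bsub>GG\<^esub> g) \<inter> diag_subgroup\<rparr>
                  \<cong> integer_group \<times>\<times> integer_group)
       \<and> (GG\<lparr>carrier := ((inv\<^bsub>GG\<^esub> g <#\<^bsub>GG\<^esub> \<Gamma>) #>\<^bsub>GG\<^esub> g) \<inter> diag_subgroup\<rparr>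
                  \<cong> integer_group \<times>\<times> integer_group
            \<longleftrightarrow> (\<exists>\<gamma>\<in>\<Gamma>. hyper_regular \<gamma>
                  \<and> act \<gamma> (act g (Infty, Infty)) = act g (Infty, Infty)
                  \<and> act \<gamma> (act g (Fin 0, Fin 0)) = act g (Fin 0, Fin 0)))"
proof -
  interpret group GG by (rule group_GG)
  have lat: "is_lattice GG GG_topology \<Gamma>" using assms(1) by (simp add: irreducible_lattice_def)
  then have \<Gamma>: "subgroup \<Gamma> GG" "subtopology GG_topology \<Gamma> = discrete_topology \<Gamma>"
    by (simp_all add: is_lattice_def)
  obtain h where h: "g = GG_of h" using assms(2) by (auto simp: carrier_GG_eq)
  define L where "L = {t. GG_of (h + dg t - h) \<in> \<Gamma>}"
  let ?\<pi> = "\<lambda>s. \<Gamma> #>\<^bsub>GG\<^esub> GG_of s" and ?X = "coset_topology GG GG_topology \<Gamma>"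
  have D: "discrete_subgroup (GG_of -` \<Gamma>)" by (rule discrete_subgroup_vimage_GG_of[OF \<Gamma>])
  have L: "discrete_subgroup L"
    using discrete_subgroup_dg[OF discrete_subgroup_conj[OF D, of h]] by (simp add: L_def vimage_def)
  have iso: "GG\<lparr>carrier := ((inv\<^bsub>GG\<^esub> g <#\<^bsub>GG\<^esub> \<Gamma>) #>\<^bsub>GG\<^esub> g) \<inter> diag_subgroup\<rparr> \<cong> integer_group \<times>\<times> integer_group
      \<longleftrightarrow> (\<exists>u\<in>L. \<exists>v\<in>L. cross u v \<noteq> 0)"
    unfolding h conj_inter_diag_subgroup[OF \<Gamma>(1)] L_def[symmetric] by (rule iso_Z2_iff_rank_2[OF L])
  have "x #>\<^bsub>GG\<^esub> GG_of (dg t) = ?\<pi> (h + dg t)" for t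
    unfolding assms(3) h GG_of_plus
    by (intro coset_mult_assoc subgroup.subset[OF \<Gamma>(1)] GG_of_in_carrier)
  then have orbit: "diag_orbit x = range (\<lambda>t. ?\<pi> (h + dg t))"
    by (simp add: diag_orbit_def diag_subgroup_eq image_image)
  have "compactin ?X (diag_orbit x) \<longleftrightarrow> (\<exists>u\<in>L. \<exists>v\<in>L. cross u v \<noteq> 0)"
  proof
    assume "compactin ?X (diag_orbit x)"
    then have "compactin ?X (range (\<lambda>t. ?\<pi> (h + dg t)))" unfolding orbit .
    then obtain u v where "h + dg u - h \<in> GG_of -` \<Gamma>" "h + dg v - h \<in> GG_of -` \<Gamma>" "cross u v \<noteq> 0"
      by (rule compact_orbit_imp_rank_2[OF D coset_GG_of_eq_iff[OF \<Gamma>(1)] topspace_coset_topology_GG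
          open_map_coset[OF \<Gamma>(1)] continuous_map_coset])
    then show "\<exists>u\<in>L. \<exists>v\<in>L. cross u v \<noteq> 0" unfolding L_def by blast
  next
    assume "\<exists>u\<in>L. \<exists>v\<in>L. cross u v \<noteq> 0"
    then obtain u v where "h + dg u - h \<in> GG_of -` \<Gamma>" "h + dg v - h \<in> GG_of -` \<Gamma>" "cross u v \<noteq> 0"
      unfolding L_def by blast
    then show "compactin ?X (diag_orbit x)"
      unfolding orbit
      by (rule rank_2_imp_compact_orbit[OF D coset_GG_of_eq_iff[OF \<Gamma>(1)] continuous_map_coset])
  qed
  moreover have "(\<exists>u\<in>L. \<exists>v\<in>L. cross u v \<noteq> 0) \<longleftrightarrow> (\<exists>\<gamma>\<in>\<Gamma>. hyper_regular \<gamma>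
      \<and> act \<gamma> (act g (Infty, Infty)) = act g (Infty, Infty)
      \<and> act \<gamma> (act g (Fin 0, Fin 0)) = act g (Fin 0, Fin 0))" (is "_ \<longleftrightarrow> ?R")
  proof
    assume "\<exists>u\<in>L. \<exists>v\<in>L. cross u v \<noteq> 0"
    then obtain t where t: "t \<in> L" "fst t \<noteq> 0" "snd t \<noteq> 0" "\<bar>fst t\<bar> \<noteq> \<bar>snd t\<bar>"
      using lattice_avoids_lines[OF L] by metis
    define s where "s = h + dg t - h"
    have "moebius_sl2 (dg1 \<tau>) Infty = Infty" "moebius_sl2 (dg1 \<tau>) (Fin 0) = Fin 0" for \<tau>
      by (simp_all add: mat_of_dg1)
    then have fx: "moebius_sl2 (dg1 \<tau>) z = z" if "z = Infty \<or> z = Fin 0" for \<tau> z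
      using that by blast
    have conj: "- fst h + fst s + fst h = dg1 (fst t)" "- snd h + snd s + snd h = dg1 (snd t)"
      by (simp_all add: s_def dg_def conj_uminus_cancel)
    have "act (GG_of s) (act g (Infty, Infty)) = act g (Infty, Infty)"
      "act (GG_of s) (act g (Fin 0, Fin 0)) = act g (Fin 0, Fin 0)"
      unfolding h act_GG_of_fixed_iff conj by (intro conjI fx; blast)+
    moreover have "GG_of s \<in> \<Gamma>" using t(1) by (simp add: L_def s_def)
    moreover have "hyper_regular (GG_of s)" unfolding s_def hyper_regular_GG_of using t by simp
    ultimately show ?R by blast
  next
    assume ?R
    then obtain s where s: "GG_of s \<in> \<Gamma>" "hyper_regular (GG_of s)"
      "act (GG_of s) (act g (Infty, Infty)) = act g (Infty, Infty)"
      "act (GG_of s) (act g (Fin 0, Fin 0)) = act g (Fin 0, Fin 0)"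
      using subgroup.subset[OF \<Gamma>(1)] by (fastforce simp: carrier_GG_eq)
    have fx: "moebius_sl2 (- fst h + fst s + fst h) Infty = Infty" "moebius_sl2 (- fst h + fst s + fst h) (Fin 0) = Fin 0"
      "moebius_sl2 (- snd h + snd s + snd h) Infty = Infty" "moebius_sl2 (- snd h + snd s + snd h) (Fin 0) = Fin 0"
      using s(3,4) unfolding h act_GG_of_fixed_iff by blast+
    obtain a where a: "psl (mat_of (- fst h + fst s + fst h)) = psl (mat_of (dg1 a))"
      using fixes_0_infty_imp_diag[OF fx(1,2)] .
    obtain b where b: "psl (mat_of (- snd h + snd s + snd h)) = psl (mat_of (dg1 b))"
      using fixes_0_infty_imp_diag[OF fx(3,4)] .
    define t where "t = (a, b)"
    have "GG_of (- h + s + h) = GG_of (dg t)" by (simp add: GG_of_def dg_def t_def a b)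
    \<comment> \<open>g^-1 \<gamma> g is diagonal only up to signs, so s itself may differ from h +
      dg t - h; the projections agree, which is all that membership in \<open>\<Gamma>\<close> and
      hyper-regularity see.\<close>
    then have "GG_of (h + dg t - h) = GG_of (h + (- h + s + h) - h)"
      unfolding diff_conv_add_uminus GG_of_plus[of _ "- h"] GG_of_plus[of h] by simp
    also have "h + (- h + s + h) - h = s" by (simp add: add.assoc)
    finally have eq: "GG_of (h + dg t - h) = GG_of s" .
    then have t: "fst t \<noteq> 0" "snd t \<noteq> 0" "\<bar>fst t\<bar> \<noteq> \<bar>snd t\<bar>"
      using s(2) hyper_regular_GG_of[of h t] by simp_all
    have "t \<in> L" using eq s(1) by (simp add: L_def)
    \<comment> \<open>Finite covolume enters here: it excludes that all periods are multiples of
      t.\<close>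
    moreover obtain r where "r \<in> L" "cross t r \<noteq> 0"
      using lattice_rank_2[OF lat t, of h] eq s(1) by (auto simp: L_def)
    ultimately show "\<exists>u\<in>L. \<exists>v\<in>L. cross u v \<noteq> 0" by blast
  qed
  ultimately show ?thesis unfolding iso by simp
qed

end
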